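(* Let $T>0$, let $K_y\ge 1$ be a fixed integer, and let $f:[0,T]\times\mathbb{R}\to\mathbb{R}$ and $g:\mathbb{R}\to\mathbb{R}$ be bounded and sufficiently smooth with bounded derivatives. Let $(Y_t,Z_t)$ be the adapted square-integrable solution of $$Y_t = g(W_T) + \int_t^T f(s,Y_s)\,ds - \int_t^T Z_s\,dW_s,\qquad t\in[0,T],$$ and, for a uniform partition $t_i=ih$, $h=T/N_T$, $i=0,\dots,N_T$, write $Y_i=Y_{t_i}$. Given initial values $Y^i$ for $N_T-K_y<i\le N_T$, let $Y^i$ for $i=N_T-K_y,\dots,0$ be defined by the (implicit) multi-step scheme $$Y^i=E_i[Y^{i+K_y}]+hK_y\sum_{j=0}^{K_y}\gamma^{K_y}_{K_y,j}\,E_i[f(t_{i+j},Y^{i+j})],$$ with the coefficients $\gamma^{K_y}_{K_y,j}$ defined in the context. Suppose that the initial values satisfy $$\max_{N_T-K_y<i\le N_T}E\big[|Y_i-Y^i|\big]=\begin{cases}\mathcal O(h^{K_y+1}), & K_y=1,2,3,\\ \mathcal O(h^4), & K_y>3.\end{cases}$$ Then, for sufficiently small time step $h$, $$\sup_{0\le i\le N_T}E\big[|Y_i-Y^i|\big]\le C\,h^{\min\{K_y+1,\,4\}},$$ where $C>0$ is a constant depending on $T,f,g$ and the derivatives of $f,g$ (and not on $h$).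
   Context: $(\Omega,\mathcal F,P;\{\mathcal F_t\}_{0\le t\le T})$ is a complete filtered probability space satisfying the usual hypotheses, carrying a standard one-dimensional Brownian motion $W$ which generates the filtration; $E_i[\cdot]=E[\cdot\mid\mathcal F_{t_i}]$. All processes are scalar ($m=d=1$). The initial values $Y^i$ are $\mathcal F_{t_i}$-measurable square-integrable random variables, as are the values $Y^i$ produced by the scheme. The $\mathcal O(\cdot)$ is as $h\to0$ (i.e. $N_T\to\infty$). $K$-step interpolant: given an integer $K\ge1$ and values at the nodes $t_{i+j}=t_i+jh$, $j=0,\dots,K$, the $K$-step interpolant on $[t_i,t_{i+K}]$ is: for $K=1$, the affine interpolant; for $K=2$, the polynomial of degree at most $2$ interpolating at the three nodes; for $K\ge3$, the not-a-knot cubic spline, i.e. the $C^2$ function on $[t_i,t_{i+K}]$ that is a cubic polynomial on each $[t_{i+j},t_{i+j+1}]$, $j=0,\dots,K-1$, takes the prescribed values at all nodes, and has continuous third derivative at $t_{i+1}$ and $t_{i+K-1}$ (for $K=3$ this is the cubic interpolation polynomial). Coefficients: $\gamma^{K}_{K,j}$, $j=0,\dots,K$, are the numbers (independent of $h$ and $i$) such that for all nodal values $\varphi_0,\dots,\varphi_K$ the $K$-step interpolant $\tilde S$ with $\tilde S(t_{i+j})=\varphi_j$ satisfies $\int_{t_i}^{t_{i+K}}\tilde S(s)\,ds=hK\sum_{j=0}^{K}\gamma^{K}_{K,j}\varphi_j$. For example $(\gamma^K_{K,j})_{j}$ equals $(\tfrac12,\tfrac12)$ for $K=1$, $(\tfrac16,\tfrac23,\tfrac16)$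 for $K=2$, $(\tfrac18,\tfrac38,\tfrac38,\tfrac18)$ for $K=3$, $(\tfrac1{12},\tfrac13,\tfrac16,\tfrac13,\tfrac1{12})$ for $K=4$. *)

theory Defs
  imports "HOL-Probability.Probability" "HOL-Computational_Algebra.Polynomial"
begin

section \<open>The filtered probability space\<close>

locale brownian_basis = prob_space M + complete_measure M for M :: "'a measure" +
  fixes F :: "real \<Rightarrow> 'a measure" and T :: real and W :: "real \<Rightarrow> 'a \<Rightarrow> real"
  assumes filtration_subalgebra: "\<And>t. t \<in> {0..T} \<Longrightarrow> subalgebra M (F t)"
    and filtration_mono: "\<And>s t. 0 \<le> s \<Longrightarrow> s \<le> t \<Longrightarrow> t \<le> T \<Longrightarrow> sets (F s) \<subseteq> sets (F t)"
    and filtration_complete: "null_sets M \<subseteq> sets (F 0)"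
    and filtration_right_continuous:
      "\<And>t. 0 \<le> t \<Longrightarrow> t < T \<Longrightarrow> sets (F t) = (\<Inter>s\<in>{t<..T}. sets (F s))"
    and filtration_generated:
      "\<And>t. t \<in> {0..T} \<Longrightarrow> sets (F t) =
         sigma_sets (space M)
           ({W s -` B \<inter> space M |s B. s \<in> {0..t} \<and> B \<in> sets borel} \<union> null_sets M)"
    and brownian_start: "AE \<omega> in M. W 0 \<omega> = 0"
    and brownian_continuous: "AE \<omega> in M. continuous_on {0..T} (\<lambda>t. W t \<omega>)"
    and brownian_normal: "\<And>s t. 0 \<le> s \<Longrightarrow> s < t \<Longrightarrow> t \<le> T \<Longrightarrow>
      distributed M lborel (\<lambda>\<omega>. W t \<omega> - W s \<omega>) (normal_density 0 (sqrt (t - s)))"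
    and brownian_independent: "\<And>s t. 0 \<le> s \<Longrightarrow> s < t \<Longrightarrow> t \<le> T \<Longrightarrow>
      indep_set (sets (F s)) (sets (vimage_algebra (space M) (\<lambda>\<omega>. W t \<omega> - W s \<omega>) borel))"

section \<open>The Ito integral\<close>

text \<open>\<open>H\<close> is a simple process on \<open>[a, b]\<close>, and \<open>J\<close> is its elementary stochastic integral.\<close>

definition simple_ito_integral ::
  "(real \<Rightarrow> 'a measure) \<Rightarrow> (real \<Rightarrow> 'a \<Rightarrow> real) \<Rightarrow> real \<Rightarrow> real \<Rightarrow>
   (real \<Rightarrow> 'a \<Rightarrow> real) \<Rightarrow> ('a \<Rightarrow> real) \<Rightarrow> bool"
where
  "simple_ito_integral F W a b H J \<longleftrightarrow>
     (\<exists>(n::nat) \<tau> \<xi>. \<tau> 0 = a \<and> \<tau> n = b \<and> (\<forall>k<n. \<tau> k \<le> \<tau> (Suc k)) \<and>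
        (\<forall>k<n. \<xi> k \<in> borel_measurable (F (\<tau> k)) \<and> bounded (\<xi> k ` space (F (\<tau> k)))) \<and>
        H = (\<lambda>s \<omega>. \<Sum>k<n. \<xi> k \<omega> * indicator {\<tau> k<..\<tau> (Suc k)} s) \<and>
        J = (\<lambda>\<omega>. \<Sum>k<n. \<xi> k \<omega> * (W (\<tau> (Suc k)) \<omega> - W (\<tau> k) \<omega>)))"

text \<open>
  \<open>I\<close> is a version of \<open>\<integral>\<^sub>a\<^sup>b Z\<^sub>s dW\<^sub>s\<close>: the \<open>L\<^sup>2(P)\<close> limit of the elementary integrals of simple
  processes that converge to \<open>Z\<close> in \<open>L\<^sup>2(dt \<otimes> dP)\<close>.  By the Ito isometry \<open>I\<close> is unique up to a
  null set.
\<close>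

definition has_ito_integral ::
  "'a measure \<Rightarrow> (real \<Rightarrow> 'a measure) \<Rightarrow> (real \<Rightarrow> 'a \<Rightarrow> real) \<Rightarrow> real \<Rightarrow> real \<Rightarrow>
   (real \<Rightarrow> 'a \<Rightarrow> real) \<Rightarrow> ('a \<Rightarrow> real) \<Rightarrow> bool"
where
  "has_ito_integral M F W a b Z I \<longleftrightarrow>
     I \<in> borel_measurable M \<and>
     (\<exists>H J. (\<forall>n::nat. simple_ito_integral F W a b (H n) (J n)) \<and>
        (\<lambda>n. \<integral>\<^sup>+\<omega>. (\<integral>\<^sup>+s\<in>{a..b}. ennreal ((Z s \<omega> - H n s \<omega>)\<^sup>2) \<partial>lborel) \<partial>M) \<longlonglongrightarrow> 0 \<and>
        (\<lambda>n. \<integral>\<^sup>+\<omega>. ennreal ((I \<omega> - J n \<omega>)\<^sup>2) \<partial>M) \<longlonglongrightarrow> 0)"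

section \<open>The backward stochastic differential equation\<close>

text \<open>
  The equation is required almost surely for each fixed \<open>t\<close>; continuity of the paths of \<open>Y\<close> is not
  assumed.
\<close>

definition bsde_solution ::
  "'a measure \<Rightarrow> (real \<Rightarrow> 'a measure) \<Rightarrow> real \<Rightarrow> (real \<Rightarrow> 'a \<Rightarrow> real) \<Rightarrow>
   (real \<Rightarrow> real \<Rightarrow> real) \<Rightarrow> (real \<Rightarrow> real) \<Rightarrow>
   (real \<Rightarrow> 'a \<Rightarrow> real) \<Rightarrow> (real \<Rightarrow> 'a \<Rightarrow> real) \<Rightarrow> bool"
where
  "bsde_solution M F T W f g Y Z \<longleftrightarrow>
     (\<forall>X\<in>{Y, Z}.
        (\<lambda>(t, \<omega>). X t \<omega>) \<in> borel_measurable (restrict_space borel {0..T} \<Otimes>\<^sub>M M) \<and>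
        (\<forall>t\<in>{0..T}. X t \<in> borel_measurable (F t)) \<and>
        (\<integral>\<^sup>+\<omega>. (\<integral>\<^sup>+t\<in>{0..T}. ennreal ((X t \<omega>)\<^sup>2) \<partial>lborel) \<partial>M) < \<infinity>) \<and>
     (\<forall>t\<in>{0..T}. \<exists>I. has_ito_integral M F W t T Z I \<and>
        (AE \<omega> in M. Y t \<omega> = g (W T \<omega>) + (LINT s:{t..T}|lborel. f s (Y s \<omega>)) - I \<omega>))"

section \<open>Smoothness with bounded derivatives\<close>

definition Cb :: "nat \<Rightarrow> (real \<Rightarrow> real) \<Rightarrow> bool" where
  "Cb m g \<longleftrightarrow>
     (\<forall>i<m. \<forall>x. (deriv ^^ i) g field_differentiable at x) \<and>
     (\<forall>i\<le>m. continuous_on UNIV ((deriv ^^ i) g) \<and> bounded (range ((deriv ^^ i) g)))"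

text \<open>
  \<open>D i j\<close> is the partial derivative of order \<open>i\<close> in time and \<open>j\<close> in space, one-sided in time at the
  end points of \<open>[0, T]\<close>.
\<close>

definition Cb_strip :: "nat \<Rightarrow> real \<Rightarrow> (real \<Rightarrow> real \<Rightarrow> real) \<Rightarrow> bool" where
  "Cb_strip m T f \<longleftrightarrow>
     (\<exists>D :: nat \<Rightarrow> nat \<Rightarrow> real \<Rightarrow> real \<Rightarrow> real.
        (\<forall>t\<in>{0..T}. \<forall>y. D 0 0 t y = f t y) \<and>
        (\<forall>i j. i + j < m \<longrightarrow> (\<forall>t\<in>{0..T}. \<forall>y.
           ((\<lambda>s. D i j s y) has_real_derivative D (Suc i) j t y) (at t within {0..T}) \<and>
           (D i j t has_real_derivative D i (Suc j) t y) (at y))) \<and>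
        (\<forall>i j. i + j \<le> m \<longrightarrow>
           continuous_on ({0..T} \<times> UNIV) (\<lambda>(t, y). D i j t y) \<and>
           bounded ((\<lambda>(t, y). D i j t y) ` ({0..T} \<times> UNIV))))"

section \<open>The interpolants and their quadrature weights\<close>

definition not_a_knot_spline :: "nat \<Rightarrow> real \<Rightarrow> real \<Rightarrow> (real \<Rightarrow> real) \<Rightarrow> bool" where
  "not_a_knot_spline K a h S \<longleftrightarrow>
     (\<forall>j<K. \<exists>p :: real poly. degree p \<le> 3 \<and>
        (\<forall>x\<in>{a + real j * h..a + real (Suc j) * h}. S x = poly p x)) \<and>
     (\<exists>S1 S2.
        (\<forall>x\<in>{a..a + real K * h}.
           (S has_real_derivative S1 x) (at x within {a..a + real K * h}) \<and>
           (S1 has_real_derivative S2 x) (at x within {a..a + real K * h})) \<and>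
        continuous_on {a..a + real K * h} S2 \<and>
        (\<forall>p\<in>{a + h, a + real (K - 1) * h}. \<exists>S3.
           (\<forall>\<^sub>F x in nhds p. (S2 has_real_derivative S3 x) (at x)) \<and> isCont S3 p))"

definition step_interpolant ::
  "nat \<Rightarrow> real \<Rightarrow> real \<Rightarrow> (nat \<Rightarrow> real) \<Rightarrow> (real \<Rightarrow> real) \<Rightarrow> bool"
where
  "step_interpolant K a h \<phi> S \<longleftrightarrow>
     (\<forall>j\<le>K. S (a + real j * h) = \<phi> j) \<and>
     (if K \<le> 2
      then \<exists>p :: real poly. degree p \<le> K \<and> (\<forall>x\<in>{a..a + real K * h}. S x = poly p x)
      else not_a_knot_spline K a h S)"

definition interpolation_weights :: "nat \<Rightarrow> (nat \<Rightarrow> real) \<Rightarrow> bool" where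
  "interpolation_weights K \<gamma> \<longleftrightarrow>
     (\<forall>a h \<phi> S. 0 < h \<longrightarrow> step_interpolant K a h \<phi> S \<longrightarrow>
        (S has_integral h * real K * (\<Sum>j\<le>K. \<gamma> j * \<phi> j)) {a..a + real K * h})"

section \<open>The multi-step scheme\<close>

definition node :: "real \<Rightarrow> nat \<Rightarrow> nat \<Rightarrow> real" where
  "node T N i = real i * (T / real N)"

text \<open>
  \<open>y i\<close> is the approximation at \<open>node T N i\<close>; the values with \<open>N < i + K\<close> are the initial values,
  on which no equation is imposed.
\<close>

definition multistep_scheme ::
  "'a measure \<Rightarrow> (real \<Rightarrow> 'a measure) \<Rightarrow> real \<Rightarrow> (real \<Rightarrow> real \<Rightarrow> real) \<Rightarrow>
   nat \<Rightarrow> (nat \<Rightarrow> real) \<Rightarrow> nat \<Rightarrow> (nat \<Rightarrow> 'a \<Rightarrow> real) \<Rightarrow> bool"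
where
  "multistep_scheme M F T f K \<gamma> N y \<longleftrightarrow>
     (\<forall>i\<le>N. y i \<in> borel_measurable (F (node T N i)) \<and> integrable M (\<lambda>\<omega>. (y i \<omega>)\<^sup>2)) \<and>
     (\<forall>i. i + K \<le> N \<longrightarrow>
        (AE \<omega> in M. y i \<omega> =
           real_cond_exp M (F (node T N i)) (y (i + K)) \<omega> +
           (T / real N) * real K *
             (\<Sum>j\<le>K. \<gamma> j *
                real_cond_exp M (F (node T N i)) (\<lambda>\<omega>'. f (node T N (i + j)) (y (i + j) \<omega>')) \<omega>)))"

end

theory Submission
  imports Defs "HOL-Real_Asymp.Real_Asymp"
begin

text \<open>
  The weights integrate polynomials of degree at most \<open>min K 3\<close> exactly, so the local error of the
  scheme is of order \<open>h\<close> to the power \<open>min K 3 + 2\<close> as soon as \<open>s \<mapsto> E\<^sub>t[f(s, Y\<^sub>s)]\<close> has a Taylor expansion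
  with uniform remainder; stability is a discrete Gronwall argument. Neither the Ito formula nor
  the regularity theory of the semilinear heat equation is needed for the expansion. The Picard
  iterates \<open>u\<^sub>n\<close> of the mild formulation, started at \<open>0\<close>, are smooth with bounds uniform in
  \<open>n\<close>, because their space derivatives are Picard iterates of linear equations; hence
  \<open>E\<^sub>t[f(s, u\<^sub>n(s, W\<^sub>s))]\<close>, a Gaussian average at \<open>W\<^sub>t\<close>, has the required expansion. Since \<open>u\<^sub>n(t, W\<^sub>t)\<close> converges
  to \<open>Y\<^sub>t\<close> in the mean for each \<open>t\<close>, the local error bound passes to the limit.
\<close>

section \<open>Averages over the Gaussian measure\<close>

text \<open>Two obstacles shape the argument. \<open>Y\<close> is given only through an equation
  that holds almost surely at each fixed time, so no function \<open>u\<close> with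
  \<open>Y t = u t (W t)\<close> is at hand, let alone its derivatives. Hence \<open>Y\<close>
  enters only through its integrals over events of \<open>F t\<close>, where the stochastic integral
  vanishes, and an \<open>L^1\<close> limit at the \<open>K + 1\<close> nodes of one step suffices.
  The other obstacle is uniformity in the iterate: derivatives falling on the heat kernel would
  bring singular factors, so they are always put on the data, and the resulting linear iterations
  are controlled by the weight \<open>exp (\<beta> * (T - t))\<close>. The shift of index in the
  local error has a reason: iterate \<open>n + 1\<close> solves a linear equation whose source
  contains iterate \<open>n\<close>, so its one-step defect is exactly the quadrature error of that
  source. Eight derivatives come from expanding to order \<open>min K 3 + 1\<close>, at most 4, each
  order in time costing two in space. Summing the local errors over at most \<open>N = T / h\<close>
  steps loses one power of \<open>h\<close>.\<close>

lemma continuous_on_integral_param: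
  fixes f :: "'b::metric_space \<Rightarrow> 'z \<Rightarrow> real"
  assumes cont: "\<And>z. continuous_on A (\<lambda>p. f p z)"
    and meas: "\<And>p. p \<in> A \<Longrightarrow> f p \<in> borel_measurable N"
    and bnd: "\<And>p z. p \<in> A \<Longrightarrow> \<bar>f p z\<bar> \<le> w z"
    and w: "integrable N w"
  shows "continuous_on A (\<lambda>p. \<integral>z. f p z \<partial>N)"
proof (rule continuous_on_sequentiallyI)
  fix u a assume u: "\<forall>n. u n \<in> A" "a \<in> A" "u \<longlonglongrightarrow> a"
  show "(\<lambda>n. \<integral>z. f (u n) z \<partial>N) \<longlonglongrightarrow> (\<integral>z. f a z \<partial>N)"
  proof (rule integral_dominated_convergence[where w = w])
    show "AE z in N. (\<lambda>n. f (u n) z) \<longlonglongrightarrow> f a z"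
    proof (rule AE_I2)
      fix z
      have "((\<lambda>p. f p z) \<circ> u) \<longlonglongrightarrow> f a z"
        using cont[of z] u unfolding continuous_on_sequentially by blast
      then show "(\<lambda>n. f (u n) z) \<longlonglongrightarrow> f a z" by (simp add: o_def)
    qed
  qed (use u meas bnd w in auto)
qed

text \<open>The mean value inequality on the convex set \<open>S\<close> bounds the difference
  quotients by \<open>w\<close>, and dominated convergence applies. Domination is asked on
  \<open>S\<close> only, so a factor that is singular elsewhere can be kept under control by
  shrinking \<open>S\<close>.\<close>

lemma has_real_derivative_integral_param:
  fixes f :: "real \<Rightarrow> 'z \<Rightarrow> real"
  assumes S: "open S" "convex S" "x \<in> S"
    and der: "\<And>y z. y \<in> S \<Longrightarrow> ((\<lambda>y. f y z) has_real_derivative f' y z) (at y)"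
    and bnd: "\<And>y z. y \<in> S \<Longrightarrow> \<bar>f' y z\<bar> \<le> w z"
    and w: "integrable N w"
    and int: "\<And>y. y \<in> S \<Longrightarrow> integrable N (f y)"
    and meas: "f' x \<in> borel_measurable N"
  shows "((\<lambda>y. \<integral>z. f y z \<partial>N) has_real_derivative (\<integral>z. f' x z \<partial>N)) (at x)"
proof -
  have "((\<lambda>y. ((\<integral>z. f y z \<partial>N) - (\<integral>z. f x z \<partial>N)) / (y - x)) \<longlongrightarrow> (\<integral>z. f' x z \<partial>N)) (at x within S)"
    unfolding tendsto_at_iff_sequentially
  proof (intro allI impI)
    fix X assume X: "\<forall>i. X i \<in> S - {x}" "X \<longlonglongrightarrow> x"
    have eq: "((\<integral>z. f (X i) z \<partial>N) - (\<integral>z. f x z \<partial>N)) / (X i - x)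
        = (\<integral>z. (f (X i) z - f x z) / (X i - x) \<partial>N)" for i
      using X S int by simp
    have "(\<lambda>i. \<integral>z. (f (X i) z - f x z) / (X i - x) \<partial>N) \<longlonglongrightarrow> (\<integral>z. f' x z \<partial>N)"
    proof (rule integral_dominated_convergence[where w = w])
      show "AE z in N. (\<lambda>i. (f (X i) z - f x z) / (X i - x)) \<longlonglongrightarrow> f' x z"
      proof (rule AE_I2)
        fix z
        have "((\<lambda>y. (f y z - f x z) / (y - x)) \<longlongrightarrow> f' x z) (at x)"
          using der[OF S(3), of z] by (simp add: has_field_derivative_iff)
        then have "((\<lambda>y. (f y z - f x z) / (y - x)) \<circ> X) \<longlonglongrightarrow> f' x z"
          unfolding tendsto_at_iff_sequentially using X by blast
        then show "(\<lambda>i. (f (X i) z - f x z) / (X i - x)) \<longlonglongrightarrow> f' x z" by (simp add: o_def)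
      qed
      show "AE z in N. norm ((f (X i) z - f x z) / (X i - x)) \<le> w z" for i
      proof (rule AE_I2)
        fix z
        have "norm (f (X i) z - f x z) \<le> w z * norm (X i - x)"
          by (rule field_differentiable_bound[OF S(2), where f' = "\<lambda>y. f' y z"])
            (use X S der bnd in \<open>auto intro: has_field_derivative_at_within\<close>)
        moreover have "X i \<noteq> x" using X by auto
        ultimately show "norm ((f (X i) z - f x z) / (X i - x)) \<le> w z"
          by (simp add: divide_simps mult.commute)
      qed
      show "(\<lambda>z. (f (X i) z - f x z) / (X i - x)) \<in> borel_measurable N" for i
        using int[of "X i"] int[of x] X S by (intro borel_measurable_divide borel_measurable_diff) auto
    qed (use meas w in auto)
    then show "((\<lambda>y. ((\<integral>z. f y z \<partial>N) - (\<integral>z. f x z \<partial>N)) / (y - x)) \<circ> X) \<longlonglongrightarrow> (\<integral>z. f' x z \<partial>N)"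
      by (simp add: o_def eq)
  qed
  then have "((\<lambda>y. \<integral>z. f y z \<partial>N) has_real_derivative (\<integral>z. f' x z \<partial>N)) (at x within S)"
    by (simp add: has_field_derivative_iff)
  then show ?thesis by (simp only: at_within_open[OF S(3,1)])
qed

section \<open>The heat semigroup as an average over a standard Gaussian variable\<close>

definition gauss :: "real measure" where
  "gauss = density lborel std_normal_density"

lemma sets_gauss [simp, measurable_cong]: "sets gauss = sets borel"
  by (simp add: gauss_def)

lemma space_gauss [simp]: "space gauss = UNIV"
  by (simp add: gauss_def)

interpretation gauss: prob_space gauss
  unfolding gauss_def by (rule prob_space_normal_density) simp

lemma integral_gauss:
  "f \<in> borel_measurable borel \<Longrightarrow> (\<integral>z. f z \<partial>gauss) = (\<integral>z. std_normal_density z * f z \<partial>lborel)" for f :: "real \<Rightarrow> real"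
  unfolding gauss_def by (subst integral_density) auto

lemma integrable_gauss_abs: "integrable gauss (\<lambda>z. \<bar>z\<bar>)"
  unfolding gauss_def
  by (subst integrable_density) (use integrable_std_normal_moment_abs[of 1] in auto)

lemma integrable_gauss_bounded:
  fixes G :: "real \<Rightarrow> real"
  assumes "G \<in> borel_measurable borel" "\<And>z. \<bar>G z\<bar> \<le> B"
  shows "integrable gauss G"
  by (rule gauss.integrable_const_bound[where B = B]) (use assms in auto)

text \<open>Since \<open>sqrt\<close> is odd, \<open>heat \<tau>\<close> is \<open>heat \<bar>\<tau>\<bar>\<close> for negative \<open>\<tau>\<close>; it is continuous in \<open>\<tau>\<close> on the whole line.\<close>
definition heat :: "real \<Rightarrow> (real \<Rightarrow> real) \<Rightarrow> real \<Rightarrow> real" where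
  "heat \<tau> G x = (\<integral>z. G (x + sqrt \<tau> * z) \<partial>gauss)"

lemma heat_0 [simp]: "heat 0 G x = G x"
  using gauss.prob_space by (simp add: heat_def)

lemma borel_measurable_affine_comp:
  fixes G :: "real \<Rightarrow> real"
  assumes "continuous_on UNIV G"
  shows "(\<lambda>z. G (x + c * z)) \<in> borel_measurable borel"
  by (intro borel_measurable_continuous_onI continuous_on_compose2[OF assms] continuous_intros) auto

lemma heat_bound:
  assumes "continuous_on UNIV G" "\<And>y. \<bar>G y\<bar> \<le> B"
  shows "\<bar>heat \<tau> G x\<bar> \<le> B"
proof -
  have "integrable gauss (\<lambda>z. G (x + sqrt \<tau> * z))"
    by (rule integrable_gauss_bounded[OF borel_measurable_affine_comp]) (use assms in auto)
  have "\<bar>heat \<tau> G x\<bar> \<le> (\<integral>z. \<bar>G (x + sqrt \<tau> * z)\<bar> \<partial>gauss)"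
    unfolding heat_def by (rule integral_abs_bound)
  also have "\<dots> \<le> (\<integral>z. B \<partial>gauss)"
    by (rule integral_mono) (use assms(2) in \<open>auto intro!: integrable_abs integrable_gauss_bounded[OF borel_measurable_affine_comp[OF assms(1)]]\<close>)
  finally show ?thesis using gauss.prob_space by simp
qed

lemma heat_cmult: "heat \<tau> (\<lambda>y. c * G y) x = c * heat \<tau> G x"
  unfolding heat_def by simp

text \<open>The measure is fixed and the variance sits in the argument of the function, so variance
  zero is not a singular case: dominated convergence gives joint continuity up to it.\<close>

lemma continuous_on_heat:
  fixes F :: "real \<Rightarrow> real \<Rightarrow> real" and \<tau> s x :: "'p::metric_space \<Rightarrow> real"
  assumes F: "continuous_on (S \<times> UNIV) (\<lambda>(t, y). F t y)" "\<And>t y. t \<in> S \<Longrightarrow> \<bar>F t y\<bar> \<le> B"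
    and \<tau>: "continuous_on A \<tau>" and s: "continuous_on A s" "\<And>p. p \<in> A \<Longrightarrow> s p \<in> S"
    and x: "continuous_on A x"
  shows "continuous_on A (\<lambda>p. heat (\<tau> p) (F (s p)) (x p))"
  unfolding heat_def
proof (rule continuous_on_integral_param[where w = "\<lambda>_. B"])
  show "continuous_on A (\<lambda>p. F (s p) (x p + sqrt (\<tau> p) * z))" for z
  proof -
    have "continuous_on A (\<lambda>p. (s p, x p + sqrt (\<tau> p) * z))"
      by (intro continuous_intros \<tau> s x)
    from continuous_on_compose2[OF F(1) this] s(2) show ?thesis by auto
  qed
  show "(\<lambda>z. F (s p) (x p + sqrt (\<tau> p) * z)) \<in> borel_measurable gauss" if "p \<in> A" for p
  proof -
    have "continuous_on UNIV (F (s p))"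
      by (rule continuous_on_compose2[OF F(1), where f = "\<lambda>y. (s p, y)", simplified])
        (use s(2)[OF that] in \<open>auto intro!: continuous_intros\<close>)
    from borel_measurable_affine_comp[OF this] show ?thesis by simp
  qed
qed (use F s in auto)

lemma has_real_derivative_heat:
  assumes der: "\<And>y. (G has_real_derivative G' y) (at y)"
    and G: "\<And>y. \<bar>G y\<bar> \<le> B" and G': "continuous_on UNIV G'" "\<And>y. \<bar>G' y\<bar> \<le> B'"
  shows "(heat \<tau> G has_real_derivative heat \<tau> G' x) (at x)"
  unfolding heat_def[abs_def]
proof (rule has_real_derivative_integral_param[where S = UNIV and w = "\<lambda>_. B'"
    and f = "\<lambda>x z. G (x + sqrt \<tau> * z)" and f' = "\<lambda>x z. G' (x + sqrt \<tau> * z)"])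
  show "((\<lambda>x. G (x + sqrt \<tau> * z)) has_real_derivative G' (x + sqrt \<tau> * z)) (at x)" for x z
    using der[of "x + sqrt \<tau> * z"] by (simp only: DERIV_shift)
  have "continuous_on UNIV G" by (rule DERIV_continuous_on) (rule der)
  then show "integrable gauss (\<lambda>z. G (x + sqrt \<tau> * z))" for x
    by (rule integrable_gauss_bounded[OF borel_measurable_affine_comp]) (use G in auto)
  show "(\<lambda>z. G' (x + sqrt \<tau> * z)) \<in> borel_measurable gauss"
    using borel_measurable_affine_comp[OF G'(1)] by simp
qed (simp_all add: G'(2))

text \<open>Integration by parts: the Gaussian density has derivative \<open>- z\<close> times
  itself, and the boundary terms vanish because \<open>G\<close> is bounded. It trades the factor
  \<open>z\<close>, which appears when the square root of the variance is differentiated, for one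
  more space derivative.\<close>

lemma stein_identity:
  assumes der: "\<And>y. (G has_real_derivative G' y) (at y)"
    and G: "\<And>y. \<bar>G y\<bar> \<le> B" and G': "continuous_on UNIV G'" "\<And>y. \<bar>G' y\<bar> \<le> B'"
  shows "(\<integral>z. G z * z \<partial>gauss) = (\<integral>z. G' z \<partial>gauss)"
proof -
  let ?\<phi> = std_normal_density
  have contG: "continuous_on UNIV G" by (rule DERIV_continuous_on) (rule der)
  have [measurable]: "G \<in> borel_measurable borel" "G' \<in> borel_measurable borel"
    using contG G' by (auto intro: borel_measurable_continuous_onI)
  have d\<phi>: "(?\<phi> has_real_derivative - z * ?\<phi> z) (at z)" for z
    unfolding std_normal_density_def
    by (auto intro!: derivative_eq_intros simp: field_simps)
  have i1: "integrable lborel (\<lambda>z. ?\<phi> z * (G z * z))"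
  proof (rule Bochner_Integration.integrable_bound[where f = "\<lambda>z. B * (?\<phi> z * \<bar>z\<bar>)"])
    show "integrable lborel (\<lambda>z. B * (?\<phi> z * \<bar>z\<bar>))"
      using integrable_std_normal_moment_abs[of 1] by simp
    have "norm (?\<phi> z * (G z * z)) \<le> norm (B * (?\<phi> z * \<bar>z\<bar>))" for z
    proof -
      have "\<bar>G z\<bar> * (?\<phi> z * \<bar>z\<bar>) \<le> \<bar>B\<bar> * (?\<phi> z * \<bar>z\<bar>)"
        using G[of z] by (intro mult_right_mono) auto
      then show ?thesis by (simp add: abs_mult ac_simps)
    qed
    then show "AE z in lborel. norm (?\<phi> z * (G z * z)) \<le> norm (B * (?\<phi> z * \<bar>z\<bar>))" by simp
  qed simp
  have i2: "integrable lborel (\<lambda>z. ?\<phi> z * G' z)"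
    using integrable_gauss_bounded[of G' B'] G' unfolding gauss_def
    by (subst (asm) integrable_density) auto
  have lim: "((\<lambda>z. ?\<phi> z * G z) \<longlongrightarrow> 0) at_top" "((\<lambda>z. ?\<phi> z * G z) \<longlongrightarrow> 0) at_bot"
  proof -
    have *: "(?\<phi> \<longlongrightarrow> 0) at_top" "(?\<phi> \<longlongrightarrow> 0) at_bot"
      unfolding std_normal_density_def by real_asymp+
    have le: "norm (?\<phi> z * G z) \<le> ?\<phi> z * B" for z
      using G[of z] by (simp add: abs_mult mult_left_mono)
    show "((\<lambda>z. ?\<phi> z * G z) \<longlongrightarrow> 0) at_top"
      by (rule Lim_null_comparison[OF always_eventually tendsto_mult_left_zero[OF *(1), of B]]) (use le in blast)
    show "((\<lambda>z. ?\<phi> z * G z) \<longlongrightarrow> 0) at_bot"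
      by (rule Lim_null_comparison[OF always_eventually tendsto_mult_left_zero[OF *(2), of B]]) (use le in blast)
  qed
  have "(LBINT z=-\<infinity>..\<infinity>. ?\<phi> z * G' z - ?\<phi> z * (G z * z)) = 0 - 0"
  proof (rule interval_integral_FTC_integrable[where F = "\<lambda>z. ?\<phi> z * G z"])
    show "((\<lambda>z. ?\<phi> z * G z) has_vector_derivative ?\<phi> z * G' z - ?\<phi> z * (G z * z)) (at z)" for z
      by (subst has_real_derivative_iff_has_vector_derivative[symmetric])
        (auto intro!: derivative_eq_intros d\<phi> der simp: algebra_simps)
    have "continuous_on UNIV ?\<phi>" by (rule DERIV_continuous_on) (rule d\<phi>)
    then have "continuous_on UNIV (\<lambda>z. ?\<phi> z * G' z - ?\<phi> z * (G z * z))"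
      by (intro continuous_intros contG G')
    then show "isCont (\<lambda>z. ?\<phi> z * G' z - ?\<phi> z * (G z * z)) z" for z
      by (simp add: continuous_on_eq_continuous_at)
    show "set_integrable lborel (einterval (- \<infinity>) \<infinity>) (\<lambda>z. ?\<phi> z * G' z - ?\<phi> z * (G z * z))"
      using i1 i2 by (simp add: set_integrable_def)
    show "(((\<lambda>z. ?\<phi> z * G z) \<circ> real_of_ereal) \<longlongrightarrow> 0) (at_right (- \<infinity>))"
      "(((\<lambda>z. ?\<phi> z * G z) \<circ> real_of_ereal) \<longlongrightarrow> 0) (at_left \<infinity>)"
      using lim by (simp_all add: ereal_tendsto_simps)
  qed simp
  then have "(\<integral>z. ?\<phi> z * G' z - ?\<phi> z * (G z * z) \<partial>lborel) = 0"
    by (simp add: interval_lebesgue_integral_def set_lebesgue_integral_def)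
  then have "(\<integral>z. ?\<phi> z * (G z * z) \<partial>lborel) = (\<integral>z. ?\<phi> z * G' z \<partial>lborel)"
    using i1 i2 by simp
  then show ?thesis by (simp add: integral_gauss)
qed

section \<open>Functions on the strip and the heat flow\<close>

definition strip_bc :: "real \<Rightarrow> (real \<Rightarrow> real \<Rightarrow> real) \<Rightarrow> bool" where
  "strip_bc T F \<longleftrightarrow> continuous_on ({0..T} \<times> UNIV) (\<lambda>(t, x). F t x) \<and>
     (\<exists>B. \<forall>t\<in>{0..T}. \<forall>x. \<bar>F t x\<bar> \<le> B)"

definition has_dx :: "real \<Rightarrow> (real \<Rightarrow> real \<Rightarrow> real) \<Rightarrow> (real \<Rightarrow> real \<Rightarrow> real) \<Rightarrow> bool" where
  "has_dx T F G \<longleftrightarrow> (\<forall>t\<in>{0..T}. \<forall>x. (F t has_real_derivative G t x) (at x))"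

definition has_dt :: "real \<Rightarrow> (real \<Rightarrow> real \<Rightarrow> real) \<Rightarrow> (real \<Rightarrow> real \<Rightarrow> real) \<Rightarrow> bool" where
  "has_dt T F G \<longleftrightarrow> (\<forall>t\<in>{0..T}. \<forall>x. ((\<lambda>s. F s x) has_real_derivative G t x) (at t within {0..T}))"

lemma strip_bc_slice:
  assumes "strip_bc T F" "t \<in> {0..T}"
  shows "continuous_on UNIV (F t)"
proof -
  have "continuous_on UNIV (\<lambda>y. (case (t, y) of (t, x) \<Rightarrow> F t x))"
    by (rule continuous_on_compose2[where g = "\<lambda>(t, x). F t x" and f = "\<lambda>y. (t, y)" and t = "{0..T} \<times> UNIV"])
      (use assms in \<open>auto simp: strip_bc_def intro!: continuous_intros\<close>)
  then show ?thesis by simp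
qed

lemma strip_bc_comp:
  assumes "strip_bc T F" "continuous_on A s" "continuous_on A x" "\<And>p. p \<in> A \<Longrightarrow> s p \<in> {0..T}"
  shows "continuous_on A (\<lambda>p. F (s p) (x p))"
proof -
  have "continuous_on A (\<lambda>p. (case (s p, x p) of (t, x) \<Rightarrow> F t x))"
    by (rule continuous_on_compose2[where g = "\<lambda>(t, x). F t x" and f = "\<lambda>p. (s p, x p)" and t = "{0..T} \<times> UNIV"])
      (use assms in \<open>auto simp: strip_bc_def intro!: continuous_intros\<close>)
  then show ?thesis by simp
qed

lemma strip_bc_bound:
  assumes "strip_bc T F"
  obtains B where "\<And>t x. t \<in> {0..T} \<Longrightarrow> \<bar>F t x\<bar> \<le> B"
  using assms unfolding strip_bc_def by blast

lemma strip_bcI: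
  assumes "continuous_on ({0..T} \<times> UNIV) (\<lambda>(t, x). F t x)" "\<And>t x. t \<in> {0..T} \<Longrightarrow> \<bar>F t x\<bar> \<le> B"
  shows "strip_bc T F"
  using assms unfolding strip_bc_def by blast

lemma strip_bc_cont: "strip_bc T F \<Longrightarrow> continuous_on ({0..T} \<times> UNIV) (\<lambda>p. F (fst p) (snd p))"
  by (simp add: strip_bc_def split_beta)

lemma strip_bc_add:
  assumes "strip_bc T F" "strip_bc T G"
  shows "strip_bc T (\<lambda>t x. F t x + G t x)"
proof -
  obtain B C where B: "\<And>t x. t \<in> {0..T} \<Longrightarrow> \<bar>F t x\<bar> \<le> B" and C: "\<And>t x. t \<in> {0..T} \<Longrightarrow> \<bar>G t x\<bar> \<le> C"
    using assms strip_bc_bound by metis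
  show ?thesis
  proof (rule strip_bcI)
    show "continuous_on ({0..T} \<times> UNIV) (\<lambda>(t, x). F t x + G t x)"
      unfolding split_beta by (intro continuous_intros strip_bc_cont assms)
    show "\<bar>F t x + G t x\<bar> \<le> B + C" if "t \<in> {0..T}" for t x
      using B[OF that, of x] C[OF that, of x] by linarith
  qed
qed

lemma strip_bc_cmult:
  assumes "strip_bc T F"
  shows "strip_bc T (\<lambda>t x. c * F t x)"
proof -
  obtain B where B: "\<And>t x. t \<in> {0..T} \<Longrightarrow> \<bar>F t x\<bar> \<le> B" using assms strip_bc_bound by metis
  show ?thesis
  proof (rule strip_bcI)
    show "continuous_on ({0..T} \<times> UNIV) (\<lambda>(t, x). c * F t x)"
      unfolding split_beta by (intro continuous_intros strip_bc_cont assms)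
    show "\<bar>c * F t x\<bar> \<le> \<bar>c\<bar> * B" if "t \<in> {0..T}" for t x
      using B[OF that, of x] by (simp add: abs_mult mult_left_mono)
  qed
qed

lemma strip_bc_compose:
  assumes "strip_bc T f" "strip_bc T v"
  shows "strip_bc T (\<lambda>t x. f t (v t x))"
proof -
  obtain C where C: "\<And>t x. t \<in> {0..T} \<Longrightarrow> \<bar>f t x\<bar> \<le> C" using strip_bc_bound[OF assms(1)] by blast
  show ?thesis
  proof (rule strip_bcI)
    show "continuous_on ({0..T} \<times> UNIV) (\<lambda>(t, x). f t (v t x))"
      unfolding split_beta by (rule strip_bc_comp[OF assms(1) _ strip_bc_cont[OF assms(2)]]) (auto intro!: continuous_intros)
  qed (use C in auto)
qed

lemma strip_bc_const:
  "continuous_on UNIV G \<Longrightarrow> (\<And>y. \<bar>G y\<bar> \<le> B) \<Longrightarrow> strip_bc T (\<lambda>_. G)"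
  by (rule strip_bcI[where B = B])
    (auto simp: split_beta intro!: continuous_on_compose2[where g = G and t = UNIV] continuous_intros)

section \<open>Continuity and differentiation along the heat flow\<close>

lemma continuous_on_strip_heat:
  fixes \<tau> s x :: "'p::metric_space \<Rightarrow> real"
  assumes "strip_bc T F" "continuous_on A \<tau>" "continuous_on A s" "continuous_on A x"
    "\<And>p. p \<in> A \<Longrightarrow> s p \<in> {0..T}"
  shows "continuous_on A (\<lambda>p. heat (\<tau> p) (F (s p)) (x p))"
proof -
  obtain B where "\<And>t x. t \<in> {0..T} \<Longrightarrow> \<bar>F t x\<bar> \<le> B" using strip_bc_bound[OF assms(1)] by blast
  then show ?thesis
    using assms by (intro continuous_on_heat[where S = "{0..T}" and B = B]) (auto simp: strip_bc_def)
qed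

text \<open>The chain rule needs joint differentiability; this follows from the two partial
  derivatives together with joint continuity of the space derivative. One-sided time derivatives at
  the ends of the strip are covered.\<close>

lemma chain_strip:
  assumes dt: "has_dt T F Ft" and dx: "has_dx T F Fx" and Fx: "strip_bc T Fx"
    and t: "t \<in> {0..T}" and p: "(p has_real_derivative p') (at t within {0..T})"
  shows "((\<lambda>s. F s (p s)) has_real_derivative Ft t (p t) + Fx t (p t) * p') (at t within {0..T})"
proof -
  have "((\<lambda>(s, y). F s y) has_derivative (\<lambda>(ts, ty). ts * Ft t (p t) + blinfun_mult_right (Fx t (p t)) ty))
      (at (t, p t) within {0..T} \<times> UNIV)"
  proof (rule has_derivative_partialsI)
    show "((\<lambda>s. F s (p t)) has_derivative (\<lambda>ts. ts * Ft t (p t))) (at t within {0..T})"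
      using dt t unfolding has_dt_def has_field_derivative_def by (simp add: mult.commute[of _ "Ft t (p t)"])
    show "((\<lambda>y. F s y) has_derivative blinfun_apply (blinfun_mult_right (Fx s y))) (at y within UNIV)"
      if "s \<in> {0..T}" for s y
      using dx that unfolding has_dx_def has_field_derivative_def by (simp add: fun_eq_iff)
    have "continuous_on ({0..T} \<times> UNIV) (\<lambda>(s, y). blinfun_mult_right (Fx s y))"
      unfolding split_beta
      by (intro bounded_linear.continuous_on[OF bounded_linear_blinfun_mult_right] strip_bc_cont Fx)
    then show "continuous (at (t, p t) within {0..T} \<times> UNIV) (\<lambda>(s, y). blinfun_mult_right (Fx s y))"
      using t unfolding continuous_on_eq_continuous_within by blast
  qed auto
  moreover have "((\<lambda>s. (s, p s)) has_derivative (\<lambda>h. (h, h * p'))) (at t within {0..T})"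
    using p unfolding has_field_derivative_def
    by (auto intro!: derivative_eq_intros simp: mult.commute)
  ultimately have "((\<lambda>s. case (s, p s) of (s, y) \<Rightarrow> F s y) has_derivative
      (\<lambda>h. case (h, h * p') of (ts, ty) \<Rightarrow> ts * Ft t (p t) + blinfun_mult_right (Fx t (p t)) ty)) (at t within {0..T})"
    by (intro has_derivative_in_compose[where f = "\<lambda>s. (s, p s)" and s = "{0..T}"
          and g = "\<lambda>(s, y). F s y"]) (auto intro: has_derivative_subset)
  then show ?thesis
    unfolding has_field_derivative_def by (auto simp: algebra_simps fun_eq_iff elim!: has_derivative_eq_rhs)
qed

text \<open>One formula for both directions of time: \<open>b = 1\<close> lets the variance grow
  along the flow, \<open>b = -1\<close> lets it shrink. Differentiating the square root produces
  \<open>b * z / (2 * sqrt (a + b * r))\<close>, and Stein's identity converts it into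
  \<open>b / 2\<close> times the second space derivative. Positive variance is required because this
  factor is singular at zero.\<close>

lemma heat_path_derivative:
  assumes F: "strip_bc T F" and dt: "has_dt T F Ft" and Ft: "strip_bc T Ft" and dx: "has_dx T F Fx" and Fx: "strip_bc T Fx"
    and dxx: "has_dx T Fx Fxx" and Fxx: "strip_bc T Fxx"
    and r: "0 < r" "r < T" "0 < a + b * r"
  shows "((\<lambda>q. heat (a + b * q) (F q) x) has_real_derivative
      heat (a + b * r) (\<lambda>y. Ft r y + b / 2 * Fxx r y) x) (at r)"
proof -
  \<comment> \<open>Half of the variance at \<open>r\<close>: on \<open>S\<close> the variance stays
    above \<open>m\<close>, so the singular factor is dominated by a constant times the absolute
    value of \<open>z\<close>.\<close>
  define m where "m = (a + b * r) / 2"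
  have m: "0 < m" "m < a + b * r" using r by (auto simp: m_def)
  define S where "S = {0<..<T} \<inter> {q. m < a + b * q}"
  define f' where "f' q z = Ft q (x + sqrt (a + b * q) * z) + Fx q (x + sqrt (a + b * q) * z) * (b * z / (2 * sqrt (a + b * q)))" for q z
  obtain B1 where B1: "\<And>t x. t \<in> {0..T} \<Longrightarrow> \<bar>Ft t x\<bar> \<le> B1" using strip_bc_bound[OF Ft] by blast
  obtain B2 where B2: "\<And>t x. t \<in> {0..T} \<Longrightarrow> \<bar>Fx t x\<bar> \<le> B2" using strip_bc_bound[OF Fx] by blast
  obtain B3 where B3: "\<And>t x. t \<in> {0..T} \<Longrightarrow> \<bar>Fxx t x\<bar> \<le> B3" using strip_bc_bound[OF Fxx] by blast
  obtain B0 where B0: "\<And>t x. t \<in> {0..T} \<Longrightarrow> \<bar>F t x\<bar> \<le> B0" using strip_bc_bound[OF F] by blast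
  have rT: "r \<in> {0..T}" using r by auto
  have B2_nonneg: "0 \<le> B2" using B2[OF rT, of 0] by linarith
  have openS: "open S" unfolding S_def by (intro open_Int open_Collect_less continuous_intros open_greaterThanLessThan)
  have convS: "convex S"
  proof -
    have "convex {q. a + b * q > m}"
    proof -
      have "{q. a + b * q > m} = {q. inner b q > m - a}" by auto
      then show ?thesis using convex_halfspace_gt by metis
    qed
    then show ?thesis unfolding S_def by (intro convex_Int) auto
  qed
  have "((\<lambda>q. \<integral>z. F q (x + sqrt (a + b * q) * z) \<partial>gauss) has_real_derivative (\<integral>z. f' r z \<partial>gauss)) (at r)"
  proof (rule has_real_derivative_integral_param[where S = S and f' = f' and w = "\<lambda>z. B1 + B2 * (\<bar>b\<bar> / (2 * sqrt m)) * \<bar>z\<bar>"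
        and f = "\<lambda>q z. F q (x + sqrt (a + b * q) * z)", OF openS convS])
    show "r \<in> S" using r m by (auto simp: S_def)
    fix q z assume q: "q \<in> S"
    then have q': "q \<in> {0..T}" "0 < q" "q < T" "m < a + b * q" "0 < a + b * q" using m by (auto simp: S_def)
    have "((\<lambda>q. x + sqrt (a + b * q) * z) has_real_derivative b * z / (2 * sqrt (a + b * q))) (at q within {0..T})"
      using q' by (auto intro!: derivative_eq_intros simp: field_simps)
    from chain_strip[OF dt dx Fx q'(1) this]
    show "((\<lambda>q. F q (x + sqrt (a + b * q) * z)) has_real_derivative f' q z) (at q)"
      unfolding f'_def using q' by (simp add: at_within_Icc_at)
    have "\<bar>f' q z\<bar> \<le> B1 + B2 * (\<bar>b\<bar> * \<bar>z\<bar> / (2 * sqrt m))"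
      unfolding f'_def
    proof (intro order_trans[OF abs_triangle_ineq] add_mono)
      have "\<bar>b * z / (2 * sqrt (a + b * q))\<bar> \<le> \<bar>b\<bar> * \<bar>z\<bar> / (2 * sqrt m)"
        using q' m by (auto simp: abs_mult intro!: divide_left_mono mult_mono)
      then show "\<bar>Fx q (x + sqrt (a + b * q) * z) * (b * z / (2 * sqrt (a + b * q)))\<bar> \<le> B2 * (\<bar>b\<bar> * \<bar>z\<bar> / (2 * sqrt m))"
        unfolding abs_mult[of "Fx q _"] using B2[OF q'(1)] B2_nonneg by (intro mult_mono) auto
    qed (use B1 q' in auto)
    then show "\<bar>f' q z\<bar> \<le> B1 + B2 * (\<bar>b\<bar> / (2 * sqrt m)) * \<bar>z\<bar>" by simp
  next
    fix q assume "q \<in> S"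
    then have q: "q \<in> {0..T}" by (auto simp: S_def)
    show "integrable gauss (\<lambda>z. F q (x + sqrt (a + b * q) * z))"
      by (rule integrable_gauss_bounded[OF borel_measurable_affine_comp[OF strip_bc_slice[OF F q]]]) (use B0 q in auto)
  next
    show "integrable gauss (\<lambda>z. B1 + B2 * (\<bar>b\<bar> / (2 * sqrt m)) * \<bar>z\<bar>)"
      by (intro Bochner_Integration.integrable_add integrable_mult_right integrable_gauss_abs) auto
    have [measurable]: "(\<lambda>z. Ft r (x + sqrt (a + b * r) * z)) \<in> borel_measurable borel"
      "(\<lambda>z. Fx r (x + sqrt (a + b * r) * z)) \<in> borel_measurable borel"
      using borel_measurable_affine_comp strip_bc_slice[OF Ft rT] strip_bc_slice[OF Fx rT] by blast+
    show "f' r \<in> borel_measurable gauss" unfolding f'_def by measurable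
  qed
  moreover have "(\<integral>z. f' r z \<partial>gauss) = heat (a + b * r) (\<lambda>y. Ft r y + b / 2 * Fxx r y) x"
  proof -
    define c where "c = sqrt (a + b * r)"
    have c: "0 < c" using r by (simp add: c_def)
    note mm = borel_measurable_affine_comp[OF strip_bc_slice[OF Ft rT]] borel_measurable_affine_comp[OF strip_bc_slice[OF Fx rT]]
      borel_measurable_affine_comp[OF strip_bc_slice[OF Fxx rT]]
    have i1: "integrable gauss (\<lambda>z. Ft r (x + c * z))" "integrable gauss (\<lambda>z. Fxx r (x + c * z))"
      by (rule integrable_gauss_bounded[OF mm(1)], use B1 rT in auto) (rule integrable_gauss_bounded[OF mm(3)], use B3 rT in auto)
    have i2: "integrable gauss (\<lambda>z. Fx r (x + c * z) * z)"
    proof (rule Bochner_Integration.integrable_bound[where f = "\<lambda>z. B2 * \<bar>z\<bar>"])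
      show "integrable gauss (\<lambda>z. B2 * \<bar>z\<bar>)" using integrable_gauss_abs by simp
      show "(\<lambda>z. Fx r (x + c * z) * z) \<in> borel_measurable gauss" using mm(2)[of x c] by simp
      show "AE z in gauss. norm (Fx r (x + c * z) * z) \<le> norm (B2 * \<bar>z\<bar>)"
        using B2[OF rT] B2_nonneg by (auto simp: abs_mult intro!: mult_right_mono)
    qed
    \<comment> \<open>The chain rule gives a factor \<open>c\<close>, which will cancel the
      \<open>1 / c\<close> left by the derivative of the square root.\<close>
    have "(\<integral>z. Fx r (x + c * z) * z \<partial>gauss) = (\<integral>z. c * Fxx r (x + c * z) \<partial>gauss)"
    proof (rule stein_identity[where B = B2 and B' = "c * B3"])
      show "((\<lambda>z. Fx r (x + c * z)) has_real_derivative c * Fxx r (x + c * y)) (at y)" for y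
      proof -
        have "(Fx r has_real_derivative Fxx r (x + c * y)) (at (x + c * y))"
          using dxx rT unfolding has_dx_def by blast
        moreover have "((\<lambda>z. x + c * z) has_real_derivative c) (at y)"
          by (auto intro!: derivative_eq_intros)
        ultimately show ?thesis using DERIV_chain2 by (metis mult.commute)
      qed
      show "continuous_on UNIV (\<lambda>y. c * Fxx r (x + c * y))"
        by (intro continuous_intros continuous_on_compose2[OF strip_bc_slice[OF Fxx rT]]) auto
    qed (use B2 B3 rT c in \<open>auto simp: abs_mult\<close>)
    then have "(\<integral>z. Fx r (x + c * z) * z \<partial>gauss) * (b / (2 * c)) = b / 2 * (\<integral>z. Fxx r (x + c * z) \<partial>gauss)"
      using c by simp
    moreover have "(\<integral>z. f' r z \<partial>gauss) = (\<integral>z. Ft r (x + c * z) \<partial>gauss) + (\<integral>z. (Fx r (x + c * z) * z) * (b / (2 * c)) \<partial>gauss)"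
      unfolding f'_def c_def[symmetric]
      by (subst Bochner_Integration.integral_add[symmetric, OF i1(1) integrable_mult_left[OF i2]]) (auto simp: field_simps)
    moreover have "heat (a + b * r) (\<lambda>y. Ft r y + b / 2 * Fxx r y) x
        = (\<integral>z. Ft r (x + c * z) \<partial>gauss) + b / 2 * (\<integral>z. Fxx r (x + c * z) \<partial>gauss)"
      unfolding heat_def c_def[symmetric]
      by (subst Bochner_Integration.integral_add[OF i1(1) integrable_mult_right[OF i1(2)]]) simp
    ultimately show ?thesis by simp
  qed
  ultimately show ?thesis unfolding heat_def[abs_def] by simp
qed

text \<open>The Ito formula in expectation (Dynkin's formula), from the case \<open>a = - t\<close>,
  \<open>b = 1\<close>. The variance is zero at \<open>r = t\<close>, so the fundamental theorem is
  used in the form that asks for derivatives in the interior and continuity at the ends.\<close>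

lemma heat_dynkin:
  assumes F: "strip_bc T F" and dt: "has_dt T F Ft" and Ft: "strip_bc T Ft" and dx: "has_dx T F Fx" and Fx: "strip_bc T Fx"
    and dxx: "has_dx T Fx Fxx" and Fxx: "strip_bc T Fxx"
    and ts: "0 \<le> t" "t \<le> s" "s \<le> T"
  shows "((\<lambda>r. heat (r - t) (\<lambda>y. Ft r y + 1 / 2 * Fxx r y) x) has_integral heat (s - t) (F s) x - F t x) {t..s}"
proof -
  have "((\<lambda>r. heat (r - t) (\<lambda>y. Ft r y + 1 / 2 * Fxx r y) x) has_integral heat (s - t) (F s) x - heat (t - t) (F t) x) {t..s}"
  proof (rule fundamental_theorem_of_calculus_interior[OF ts(2), where f = "\<lambda>r. heat (r - t) (F r) x"])
    show "continuous_on {t..s} (\<lambda>r. heat (r - t) (F r) x)"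
      by (rule continuous_on_strip_heat[OF F]) (use ts in \<open>auto intro!: continuous_intros\<close>)
    fix r assume r: "r \<in> {t<..<s}"
    show "((\<lambda>r. heat (r - t) (F r) x) has_vector_derivative heat (r - t) (\<lambda>y. Ft r y + 1 / 2 * Fxx r y) x) (at r)"
      using heat_path_derivative[OF F dt Ft dx Fx dxx Fxx, of r "-t" 1 x] r ts
      by (simp add: has_real_derivative_iff_has_vector_derivative)
  qed
  then show ?thesis by simp
qed

text \<open>The case \<open>b = -1\<close> with \<open>G\<close> frozen in time: it expands a heat
  average around variance zero. The remainder carries the variance \<open>s - r\<close>, which is
  the form that matches the mild formula at time \<open>r\<close>.\<close>

lemma heat_backward:
  assumes G: "continuous_on UNIV G" "\<And>y. \<bar>G y\<bar> \<le> B" and G1: "continuous_on UNIV G1" "\<And>y. \<bar>G1 y\<bar> \<le> B1"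
    and G2: "continuous_on UNIV G2" "\<And>y. \<bar>G2 y\<bar> \<le> B2"
    and d: "\<And>y. (G has_real_derivative G1 y) (at y)" "\<And>y. (G1 has_real_derivative G2 y) (at y)"
    and ts: "0 \<le> t" "t \<le> s"
  shows "((\<lambda>r. heat (s - r) G2 x) has_integral 2 * (heat (s - t) G x - G x)) {t..s}"
proof -
  note bc = strip_bc_const[OF G, of "s + 1"] strip_bc_const[OF G1, of "s + 1"] strip_bc_const[OF G2, of "s + 1"]
  have 0: "strip_bc (s + 1) (\<lambda>_ _. 0)" by (rule strip_bc_const[where B = 0]) auto
  have "((\<lambda>r. heat (s - r) (\<lambda>y. -1 / 2 * G2 y) x) has_integral heat (s - s) G x - heat (s - t) G x) {t..s}"
  proof (rule fundamental_theorem_of_calculus_interior[OF ts(2), where f = "\<lambda>r. heat (s - r) G x"])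
    show "continuous_on {t..s} (\<lambda>r. heat (s - r) G x)"
      by (rule continuous_on_strip_heat[OF bc(1), where s = "\<lambda>_. 0"]) (use ts in \<open>auto intro!: continuous_intros\<close>)
    fix r assume r: "r \<in> {t<..<s}"
    show "((\<lambda>r. heat (s - r) G x) has_vector_derivative heat (s - r) (\<lambda>y. -1 / 2 * G2 y) x) (at r)"
      using heat_path_derivative[OF bc(1) _ 0 _ bc(2) _ bc(3), of r s "-1" x] r ts d
      by (simp add: has_real_derivative_iff_has_vector_derivative has_dt_def has_dx_def)
  qed
  from has_integral_mult_right[OF this, of "-2"] show ?thesis
    unfolding heat_cmult by (simp add: algebra_simps)
qed

section \<open>Mild solutions of the heat equation\<close>

text \<open>Fubini for the kernel cut off to the compact triangle of points with
  \<open>t \<le> r \<le> s \<le> T\<close>, where continuity yields integrability for the product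
  measure. The two Lebesgue integrals are then read back as gauge integrals.\<close>

lemma integral_swap_triangle:
  fixes k :: "real \<Rightarrow> real \<Rightarrow> real"
  assumes k: "continuous_on ({t..T} \<times> {t..T}) (\<lambda>(r, s). k r s)"
  shows "integral {t..T} (\<lambda>s. integral {t..s} (\<lambda>r. k r s)) = integral {t..T} (\<lambda>r. integral {r..T} (\<lambda>s. k r s))"
proof -
  define D where "D = {p::real \<times> real. t \<le> fst p \<and> fst p \<le> snd p \<and> snd p \<le> T}"
  define f where "f r s = indicator D (r, s) * k r s" for r s
  have "closed D" unfolding D_def by (intro closed_Collect_conj closed_Collect_le continuous_intros)
  moreover have sub: "D \<subseteq> {t..T} \<times> {t..T}" by (auto simp: D_def)
  moreover have "bounded D" using sub bounded_subset bounded_Times bounded_closed_interval by metis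
  ultimately have "compact D" by (simp add: compact_eq_bounded_closed)
  then have "integrable lborel (\<lambda>p. indicator D p *\<^sub>R (case p of (r, s) \<Rightarrow> k r s))"
    by (rule borel_integrable_compact) (rule continuous_on_subset[OF k sub])
  then have int: "integrable (lborel \<Otimes>\<^sub>M lborel) (\<lambda>(r, s). f r s)"
    unfolding lborel_prod f_def by (simp add: case_prod_unfold)
  have k1: "continuous_on {t..T} (\<lambda>r. k r s)" if "s \<in> {t..T}" for s
  proof -
    have "continuous_on {t..T} (\<lambda>r. case (r, s) of (r, s) \<Rightarrow> k r s)"
      by (rule continuous_on_compose2[OF k]) (use that in \<open>auto intro!: continuous_intros\<close>)
    then show ?thesis by simp
  qed
  have k2: "continuous_on {t..T} (\<lambda>s. k r s)" if "r \<in> {t..T}" for r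
  proof -
    have "continuous_on {t..T} (\<lambda>s. case (r, s) of (r, s) \<Rightarrow> k r s)"
      by (rule continuous_on_compose2[OF k]) (use that in \<open>auto intro!: continuous_intros\<close>)
    then show ?thesis by simp
  qed
  have in1: "(\<integral>r. f r s \<partial>lborel) = indicator {t..T} s * integral {t..s} (\<lambda>r. k r s)" for s
  proof (cases "s \<in> {t..T}")
    case True
    have "set_integrable lborel {t..s} (\<lambda>r. k r s)"
      unfolding set_integrable_def
      by (rule borel_integrable_compact) (use True in \<open>auto intro: continuous_on_subset[OF k1]\<close>)
    then have "integral {t..s} (\<lambda>r. k r s) = (LINT r:{t..s}|lborel. k r s)"
      by (simp add: set_borel_integral_eq_integral)
    also have "\<dots> = (\<integral>r. f r s \<partial>lborel)"
      unfolding set_lebesgue_integral_def f_def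
      by (rule Bochner_Integration.integral_cong) (use True in \<open>auto simp: D_def indicator_def\<close>)
    finally show ?thesis using True by simp
  next
    case False
    then have "f r s = 0" for r by (auto simp: f_def D_def indicator_def)
    then show ?thesis using False by simp
  qed
  have in2: "(\<integral>s. f r s \<partial>lborel) = indicator {t..T} r * integral {r..T} (\<lambda>s. k r s)" for r
  proof (cases "r \<in> {t..T}")
    case True
    have "set_integrable lborel {r..T} (\<lambda>s. k r s)"
      unfolding set_integrable_def
      by (rule borel_integrable_compact) (use True in \<open>auto intro: continuous_on_subset[OF k2]\<close>)
    then have "integral {r..T} (\<lambda>s. k r s) = (LINT s:{r..T}|lborel. k r s)"
      by (simp add: set_borel_integral_eq_integral)
    also have "\<dots> = (\<integral>s. f r s \<partial>lborel)"
      unfolding set_lebesgue_integral_def f_def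
      by (rule Bochner_Integration.integral_cong) (use True in \<open>auto simp: D_def indicator_def\<close>)
    finally show ?thesis using True by simp
  next
    case False
    then have "f r s = 0" for s by (auto simp: f_def D_def indicator_def)
    then show ?thesis using False by simp
  qed
  interpret lborel_pair: pair_sigma_finite "lborel :: real measure" "lborel :: real measure" ..
  have si: "set_integrable lborel {t..T} (\<lambda>s. integral {t..s} (\<lambda>r. k r s))"
    using lborel_pair.integrable_snd[OF int] by (simp add: in1 set_integrable_def)
  have sj: "set_integrable lborel {t..T} (\<lambda>r. integral {r..T} (\<lambda>s. k r s))"
    using lborel_pair.integrable_fst[OF int] by (simp add: in2 set_integrable_def)
  have "(\<integral>s. (\<integral>r. f r s \<partial>lborel) \<partial>lborel) = (\<integral>r. (\<integral>s. f r s \<partial>lborel) \<partial>lborel)"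
    by (rule lborel_pair.Fubini_integral[OF int])
  then show ?thesis
    unfolding in1 in2 using set_borel_integral_eq_integral(2)[OF si] set_borel_integral_eq_integral(2)[OF sj]
    by (simp add: set_lebesgue_integral_def)
qed

lemma integral_to_unit:
  fixes h :: "real \<Rightarrow> real"
  assumes "continuous_on {t..T} h" "t \<le> T"
  shows "integral {t..T} h = (T - t) * integral {0..1} (\<lambda>\<theta>. h (t + \<theta> * (T - t)))"
proof (cases "t = T")
  case False
  have "(h has_integral integral {t..T} h) (cbox t T)"
    using integrable_integral[OF integrable_continuous_real[OF assms(1)]] by simp
  from has_integral_affinity'[OF this, of "T - t" t] False assms(2)
  have "((\<lambda>\<theta>. h ((T - t) * \<theta> + t)) has_integral integral {t..T} h / (T - t)) {0..1}"
    by (simp add: divide_inverse mult.commute)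
  from integral_unique[OF this] False assms(2) show ?thesis
    by (simp add: field_simps)
qed auto

text \<open>The lower limit depends on the parameter; the substitution
  \<open>s = t + \<theta> * (T - t)\<close> moves this dependence into the integrand over the fixed
  interval from 0 to 1.\<close>

lemma continuous_on_integral_to_end:
  fixes h :: "real \<Rightarrow> real \<Rightarrow> real \<Rightarrow> real"
  assumes h: "continuous_on ({0..T} \<times> UNIV \<times> {0..T}) (\<lambda>(t, x, s). h t x s)"
  shows "continuous_on ({0..T} \<times> UNIV) (\<lambda>(t, x). integral {t..T} (h t x))"
proof -
  have "continuous_on (({0..T} \<times> UNIV) \<times> {0..1}) (\<lambda>q. h (fst (fst q)) (snd (fst q)) (fst (fst q) + snd q * (T - fst (fst q))))"
  proof -
    have "0 \<le> t + \<theta> * (T - t) \<and> t + \<theta> * (T - t) \<le> T" if "0 \<le> t" "t \<le> T" "0 \<le> \<theta>" "\<theta> \<le> 1" for t \<theta> :: real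
      using that mult_right_mono[of \<theta> 1 "T - t"] by simp
    then have "continuous_on (({0..T} \<times> UNIV) \<times> {0..1}) (\<lambda>q. case (fst (fst q), snd (fst q), fst (fst q) + snd q * (T - fst (fst q))) of (t, x, s) \<Rightarrow> h t x s)"
      by (intro continuous_on_compose2[OF h] continuous_intros) auto
    then show ?thesis by simp
  qed
  then have "continuous_on ({0..T} \<times> UNIV) (\<lambda>p. integral (cbox 0 1) (\<lambda>\<theta>. h (fst p) (snd p) (fst p + \<theta> * (T - fst p))))"
    by (intro integral_continuous_on_param) (simp add: split_beta)
  then have "continuous_on ({0..T} \<times> UNIV) (\<lambda>p. (T - fst p) * integral {0..1} (\<lambda>\<theta>. h (fst p) (snd p) (fst p + \<theta> * (T - fst p))))"
    by (intro continuous_intros) simp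
  then show ?thesis
  proof (rule continuous_on_eq)
    fix p :: "real \<times> real" assume p: "p \<in> {0..T} \<times> UNIV"
    have "continuous_on {fst p..T} (\<lambda>s. case (fst p, snd p, s) of (t, x, s) \<Rightarrow> h t x s)"
      by (intro continuous_on_compose2[OF h] continuous_intros) (use p in auto)
    then show "(T - fst p) * integral {0..1} (\<lambda>\<theta>. h (fst p) (snd p) (fst p + \<theta> * (T - fst p))) = (case p of (t, x) \<Rightarrow> integral {t..T} (h t x))"
      using integral_to_unit[of "fst p" T "h (fst p) (snd p)"] p by (auto simp: split_beta)
  qed
qed

text \<open>Duhamel's formula for the backward heat equation \<open>u_t + u_xx / 2 + F = 0\<close>
  with terminal value \<open>\<gamma>\<close> at time \<open>T\<close>.\<close>

definition mild :: "real \<Rightarrow> (real \<Rightarrow> real) \<Rightarrow> (real \<Rightarrow> real \<Rightarrow> real) \<Rightarrow> real \<Rightarrow> real \<Rightarrow> real" where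
  "mild T \<gamma> F t x = heat (T - t) \<gamma> x + integral {t..T} (\<lambda>s. heat (s - t) (F s) x)"

definition bc :: "(real \<Rightarrow> real) \<Rightarrow> bool" where
  "bc G \<longleftrightarrow> continuous_on UNIV G \<and> (\<exists>B. \<forall>y. \<bar>G y\<bar> \<le> B)"

lemma bcE:
  assumes "bc G"
  obtains B where "continuous_on UNIV G" "\<And>y. \<bar>G y\<bar> \<le> B"
  using assms unfolding bc_def by blast

lemma strip_bc_imp_bc: "strip_bc T F \<Longrightarrow> t \<in> {0..T} \<Longrightarrow> bc (F t)"
  using strip_bc_slice[of T F t] unfolding bc_def strip_bc_def by blast

lemma strip_bc_bc: "bc G \<Longrightarrow> strip_bc T (\<lambda>_. G)"
  by (erule bcE) (rule strip_bc_const)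

lemma bc_heat:
  assumes G: "bc G"
  shows "bc (heat \<tau> G)"
proof -
  obtain B where B: "continuous_on UNIV G" "\<And>y. \<bar>G y\<bar> \<le> B" using bcE[OF G] by blast
  have "continuous_on UNIV (heat \<tau> G)"
    using continuous_on_strip_heat[OF strip_bc_bc[OF G, of 1], of UNIV "\<lambda>_. \<tau>" "\<lambda>_. 0" "\<lambda>x. x"]
    by (auto intro!: continuous_intros)
  then show ?thesis unfolding bc_def using heat_bound[OF B] by blast
qed

lemma bc_borel_measurable: "bc G \<Longrightarrow> G \<in> borel_measurable borel"
  unfolding bc_def by (auto intro: borel_measurable_continuous_onI)

lemma continuous_on_heat_time:
  assumes "strip_bc T F" "0 \<le> t" "s \<le> T"
  shows "continuous_on {t..s} (\<lambda>r. heat (r - t') (F r) x)"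
  by (rule continuous_on_strip_heat[OF assms(1)]) (use assms in \<open>auto intro!: continuous_intros\<close>)

lemma continuous_on_mild:
  assumes \<gamma>: "bc \<gamma>" and F: "strip_bc T F"
  shows "continuous_on ({0..T} \<times> UNIV) (\<lambda>(t, x). mild T \<gamma> F t x)"
proof -
  have "continuous_on ({0..T} \<times> UNIV) (\<lambda>(t, x). integral {t..T} (\<lambda>s. heat (s - t) (F s) x))"
    by (rule continuous_on_integral_to_end)
      (auto simp: split_beta intro!: continuous_on_strip_heat[OF F] continuous_intros)
  moreover have "continuous_on ({0..T} \<times> UNIV) (\<lambda>p. heat (T - fst p) \<gamma> (snd p))"
    by (rule continuous_on_strip_heat[OF strip_bc_bc[OF \<gamma>], where s = fst]) (auto intro!: continuous_intros)
  ultimately show ?thesis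
    unfolding mild_def split_beta by (intro continuous_on_add)
qed

text \<open>The bound on the source may vary with time, which is what permits exponentially weighted
  estimates; constant \<open>b\<close> gives the plain ones.\<close>

lemma mild_bound:
  assumes \<gamma>: "bc \<gamma>" "\<And>y. \<bar>\<gamma> y\<bar> \<le> B" and F: "strip_bc T F" and t: "t \<in> {0..T}"
    and b: "\<And>s y. s \<in> {t..T} \<Longrightarrow> \<bar>F s y\<bar> \<le> b s" and bi: "(b has_integral I) {t..T}"
  shows "\<bar>mild T \<gamma> F t x\<bar> \<le> B + I"
proof -
  have "\<bar>integral {t..T} (\<lambda>s. heat (s - t) (F s) x)\<bar> \<le> integral {t..T} b"
  proof -
    have "norm (integral {t..T} (\<lambda>s. heat (s - t) (F s) x)) \<le> integral {t..T} b"
    proof (rule integral_norm_bound_integral)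
      show "(\<lambda>s. heat (s - t) (F s) x) integrable_on {t..T}"
        using continuous_on_heat_time[OF F] t by (intro integrable_continuous_real) auto
      show "norm (heat (s - t) (F s) x) \<le> b s" if "s \<in> {t..T}" for s
        using heat_bound[OF strip_bc_slice[OF F]] b that t by auto
    qed (use bi in auto)
    then show ?thesis by simp
  qed
  moreover have "\<bar>heat (T - t) \<gamma> x\<bar> \<le> B"
    by (rule heat_bound) (use \<gamma> in \<open>auto simp: bc_def\<close>)
  ultimately show ?thesis unfolding mild_def using bi integral_unique[OF bi] by linarith
qed

lemma strip_bc_mild:
  assumes \<gamma>: "bc \<gamma>" and F: "strip_bc T F"
  shows "strip_bc T (mild T \<gamma> F)"
proof -
  obtain B where B: "\<And>y. \<bar>\<gamma> y\<bar> \<le> B" using \<gamma> unfolding bc_def by blast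
  obtain C where C: "\<And>t x. t \<in> {0..T} \<Longrightarrow> \<bar>F t x\<bar> \<le> C" using strip_bc_bound[OF F] by blast
  show ?thesis
  proof (rule strip_bcI[OF continuous_on_mild[OF assms]])
    fix t x assume t: "t \<in> {0..T}"
    have "\<bar>mild T \<gamma> F t x\<bar> \<le> B + (T - t) * C"
      by (rule mild_bound[OF \<gamma> B F t, where b = "\<lambda>_. C"]) (use C t has_integral_const_real[of C t T] in auto)
    also have "\<dots> \<le> B + T * C" using t C[OF t, of 0] by (auto intro!: mult_right_mono)
    finally show "\<bar>mild T \<gamma> F t x\<bar> \<le> B + T * C" .
  qed
qed

text \<open>Heat averages commute with translations, so the space derivative falls on
  \<open>\<gamma>\<close> and \<open>F\<close> and never on the kernel.\<close>

lemma has_dx_mild: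
  assumes \<gamma>: "bc \<gamma>" and F: "strip_bc T F" and \<gamma>1: "bc \<gamma>1" and F1: "strip_bc T F1"
    and d: "\<And>y. (\<gamma> has_real_derivative \<gamma>1 y) (at y)" and dF: "has_dx T F F1"
  shows "has_dx T (mild T \<gamma> F) (mild T \<gamma>1 F1)"
  unfolding has_dx_def
proof (intro ballI allI)
  fix t x assume t: "t \<in> {0..T}"
  obtain B where B: "\<And>y. \<bar>\<gamma> y\<bar> \<le> B" using \<gamma> unfolding bc_def by blast
  obtain B1 where B1: "\<And>y. \<bar>\<gamma>1 y\<bar> \<le> B1" using \<gamma>1 unfolding bc_def by blast
  obtain C where C: "\<And>t x. t \<in> {0..T} \<Longrightarrow> \<bar>F t x\<bar> \<le> C" using strip_bc_bound[OF F] by blast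
  obtain C1 where C1: "\<And>t x. t \<in> {0..T} \<Longrightarrow> \<bar>F1 t x\<bar> \<le> C1" using strip_bc_bound[OF F1] by blast
  have "((\<lambda>x. integral (cbox t T) (\<lambda>s. heat (s - t) (F s) x)) has_field_derivative
      integral (cbox t T) (\<lambda>s. heat (s - t) (F1 s) x)) (at x within UNIV)"
  proof (rule leibniz_rule_field_derivative[where U = UNIV and fx = "\<lambda>x s. heat (s - t) (F1 s) x"])
    show "((\<lambda>x. heat (s - t) (F s) x) has_real_derivative heat (s - t) (F1 s) x) (at x)" if "s \<in> cbox t T" for x s
      by (rule has_real_derivative_heat[where B = C and B' = C1])
        (use dF that t C C1 strip_bc_slice[OF F1] in \<open>auto simp: has_dx_def\<close>)
    show "(\<lambda>s. heat (s - t) (F s) x) integrable_on cbox t T" for x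
      using continuous_on_heat_time[OF F] t by (auto intro!: integrable_continuous_real)
    show "continuous_on (UNIV \<times> cbox t T) (\<lambda>(x, s). heat (s - t) (F1 s) x)"
      unfolding split_beta by (rule continuous_on_strip_heat[OF F1]) (use t in \<open>auto intro!: continuous_intros\<close>)
  qed auto
  moreover have "(heat (T - t) \<gamma> has_real_derivative heat (T - t) \<gamma>1 x) (at x)"
    by (rule has_real_derivative_heat[where B = B and B' = B1]) (use B B1 d \<gamma>1 in \<open>auto simp: bc_def\<close>)
  ultimately show "(mild T \<gamma> F t has_real_derivative mild T \<gamma>1 F1 t x) (at x)"
    unfolding mild_def[abs_def] by (auto intro!: DERIV_add)
qed

text \<open>
  Expanding every heat kernel in the mild formulation to first order and exchanging the two time
  integrals exhibits the mild solution as a primitive in time, so that no differentiation of the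
  kernel at its singularity is needed.
\<close>
lemma mild_eq_integral:
  assumes \<gamma>: "bc \<gamma>" "bc \<gamma>1" "bc \<gamma>2" and F: "strip_bc T F" "strip_bc T F1" "strip_bc T F2"
    and d: "\<And>y. (\<gamma> has_real_derivative \<gamma>1 y) (at y)" "\<And>y. (\<gamma>1 has_real_derivative \<gamma>2 y) (at y)"
    and dF: "has_dx T F F1" "has_dx T F1 F2" and t: "t \<in> {0..T}"
  shows "mild T \<gamma> F t x = \<gamma> x + integral {t..T} (\<lambda>r. 1 / 2 * mild T \<gamma>2 F2 r x + F r x)"
proof -
  obtain B where B: "\<And>y. \<bar>\<gamma> y\<bar> \<le> B" using \<gamma> unfolding bc_def by blast
  obtain B1 where B1: "\<And>y. \<bar>\<gamma>1 y\<bar> \<le> B1" using \<gamma> unfolding bc_def by blast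
  obtain B2 where B2: "\<And>y. \<bar>\<gamma>2 y\<bar> \<le> B2" using \<gamma> unfolding bc_def by blast
  obtain C where C: "\<And>t x. t \<in> {0..T} \<Longrightarrow> \<bar>F t x\<bar> \<le> C" using strip_bc_bound[OF F(1)] by blast
  obtain C1 where C1: "\<And>t x. t \<in> {0..T} \<Longrightarrow> \<bar>F1 t x\<bar> \<le> C1" using strip_bc_bound[OF F(2)] by blast
  obtain C2 where C2: "\<And>t x. t \<in> {0..T} \<Longrightarrow> \<bar>F2 t x\<bar> \<le> C2" using strip_bc_bound[OF F(3)] by blast
  have \<gamma>c: "continuous_on UNIV \<gamma>" "continuous_on UNIV \<gamma>1" "continuous_on UNIV \<gamma>2"
    using \<gamma> by (auto simp: bc_def)
  have t': "0 \<le> t" "t \<le> T" using t by auto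
  have 1: "heat (T - t) \<gamma> x = \<gamma> x + 1 / 2 * integral {t..T} (\<lambda>r. heat (T - r) \<gamma>2 x)"
    using heat_backward[OF \<gamma>c(1) B \<gamma>c(2) B1 \<gamma>c(3) B2 d t', of x] by (simp add: integral_unique diff_divide_distrib)
  have 2: "heat (s - t) (F s) x = F s x + 1 / 2 * integral {t..s} (\<lambda>r. heat (s - r) (F2 s) x)" if s: "s \<in> {t..T}" for s
  proof -
    have s': "s \<in> {0..T}" "t \<le> s" using s t by auto
    have "((\<lambda>r. heat (s - r) (F2 s) x) has_integral 2 * (heat (s - t) (F s) x - F s x)) {t..s}"
      by (rule heat_backward[OF strip_bc_slice[OF F(1) s'(1)] C[OF s'(1)] strip_bc_slice[OF F(2) s'(1)] C1[OF s'(1)]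
            strip_bc_slice[OF F(3) s'(1)] C2[OF s'(1)]])
        (use s' t' dF in \<open>auto simp: has_dx_def\<close>)
    then show ?thesis by (simp add: integral_unique diff_divide_distrib)
  qed
  have ck: "continuous_on ({t..T} \<times> {t..T}) (\<lambda>(r, s). heat (s - r) (F2 s) x)"
    unfolding split_beta by (rule continuous_on_strip_heat[OF F(3)]) (use t in \<open>auto intro!: continuous_intros\<close>)
  have Fc: "continuous_on {t..T} (\<lambda>s. F s x)"
    by (rule strip_bc_comp[OF F(1)]) (use t in \<open>auto intro!: continuous_intros\<close>)
  have hc: "continuous_on {t..T} (\<lambda>s. heat (s - t) (F s) x)"
    by (rule continuous_on_heat_time[OF F(1)]) (use t in auto)
  have hT: "continuous_on {t..T} (\<lambda>r. heat (T - r) \<gamma>2 x)"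
    by (rule continuous_on_strip_heat[OF strip_bc_bc[OF \<gamma>(3)], where s = "\<lambda>_. t"]) (use t in \<open>auto intro!: continuous_intros\<close>)
  have mc: "continuous_on {t..T} (\<lambda>r. mild T \<gamma>2 F2 r x)"
    by (rule strip_bc_comp[OF strip_bc_mild[OF \<gamma>(3) F(3)]]) (use t in \<open>auto intro!: continuous_intros\<close>)
  have "integral {t..T} (\<lambda>s. heat (s - t) (F s) x) - integral {t..T} (\<lambda>s. F s x)
      = integral {t..T} (\<lambda>s. heat (s - t) (F s) x - F s x)"
    by (rule Henstock_Kurzweil_Integration.integral_diff[symmetric]) (intro integrable_continuous_real hc Fc)+
  also have "\<dots> = integral {t..T} (\<lambda>s. 1 / 2 * integral {t..s} (\<lambda>r. heat (s - r) (F2 s) x))"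
    by (rule Henstock_Kurzweil_Integration.integral_cong) (use 2 in auto)
  also have "\<dots> = 1 / 2 * integral {t..T} (\<lambda>r. integral {r..T} (\<lambda>s. heat (s - r) (F2 s) x))"
    unfolding integral_mult_right by (subst integral_swap_triangle[OF ck]) simp
  finally have 3: "integral {t..T} (\<lambda>s. heat (s - t) (F s) x) = integral {t..T} (\<lambda>s. F s x)
      + 1 / 2 * integral {t..T} (\<lambda>r. integral {r..T} (\<lambda>s. heat (s - r) (F2 s) x))" by simp
  \<comment> \<open>After the exchange, each inner integral is the one in the mild formula for the
    second derivatives, that is, \<open>mild\<close> less its terminal part. That part cancels
    against the integral in \<open>1\<close>.\<close>
  have "integral {t..T} (\<lambda>r. integral {r..T} (\<lambda>s. heat (s - r) (F2 s) x))
      = integral {t..T} (\<lambda>r. mild T \<gamma>2 F2 r x - heat (T - r) \<gamma>2 x)"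
    by (simp add: mild_def)
  also have "\<dots> = integral {t..T} (\<lambda>r. mild T \<gamma>2 F2 r x) - integral {t..T} (\<lambda>r. heat (T - r) \<gamma>2 x)"
    by (rule Henstock_Kurzweil_Integration.integral_diff) (intro integrable_continuous_real mc hT)+
  finally have 4: "integral {t..T} (\<lambda>r. integral {r..T} (\<lambda>s. heat (s - r) (F2 s) x)) = \<dots>" .
  have "integral {t..T} (\<lambda>r. 1 / 2 * mild T \<gamma>2 F2 r x + F r x)
      = 1 / 2 * integral {t..T} (\<lambda>r. mild T \<gamma>2 F2 r x) + integral {t..T} (\<lambda>r. F r x)"
    by (subst Henstock_Kurzweil_Integration.integral_add) (auto intro!: integrable_continuous_real mc Fc continuous_intros)
  then show ?thesis unfolding mild_def[of T \<gamma> F] 1 3 4 by (simp add: diff_divide_distrib)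
qed

text \<open>The backward heat equation, with \<open>mild T \<gamma>2 F2\<close> as the second space
  derivative. Differentiating the primitive uses continuity of its integrand alone, so both ends of
  the strip are included.\<close>

lemma has_dt_mild:
  assumes \<gamma>: "bc \<gamma>" "bc \<gamma>1" "bc \<gamma>2" and F: "strip_bc T F" "strip_bc T F1" "strip_bc T F2"
    and d: "\<And>y. (\<gamma> has_real_derivative \<gamma>1 y) (at y)" "\<And>y. (\<gamma>1 has_real_derivative \<gamma>2 y) (at y)"
    and dF: "has_dx T F F1" "has_dx T F1 F2"
  shows "has_dt T (mild T \<gamma> F) (\<lambda>t x. - (1 / 2 * mild T \<gamma>2 F2 t x + F t x))"
  unfolding has_dt_def
proof (intro ballI allI)
  fix t x assume t: "t \<in> {0..T}"
  have c: "continuous_on {0..T} (\<lambda>r. 1 / 2 * mild T \<gamma>2 F2 r x + F r x)"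
    by (intro continuous_intros strip_bc_comp[OF strip_bc_mild[OF \<gamma>(3) F(3)]] strip_bc_comp[OF F(1)]) auto
  have "((\<lambda>t. \<gamma> x + integral {t..T} (\<lambda>r. 1 / 2 * mild T \<gamma>2 F2 r x + F r x)) has_real_derivative
      0 + - (1 / 2 * mild T \<gamma>2 F2 t x + F t x)) (at t within {0..T})"
    by (intro DERIV_add DERIV_const integral_has_real_derivative'[OF c t])
  then have "((\<lambda>t. mild T \<gamma> F t x) has_real_derivative 0 + - (1 / 2 * mild T \<gamma>2 F2 t x + F t x)) (at t within {0..T})"
    by (rule has_field_derivative_transform_within[of _ _ _ _ 1])
      (use t mild_eq_integral[OF \<gamma> F d dF] in auto)
  then show "((\<lambda>s. mild T \<gamma> F s x) has_real_derivative - (1 / 2 * mild T \<gamma>2 F2 t x + F t x)) (at t within {0..T})"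
    by simp
qed

section \<open>Uniform smoothness of linear Picard iterates\<close>

definition family_bc :: "real \<Rightarrow> (nat \<Rightarrow> real \<Rightarrow> real \<Rightarrow> real) \<Rightarrow> bool" where
  "family_bc T F \<longleftrightarrow> (\<forall>n. continuous_on ({0..T} \<times> UNIV) (\<lambda>(t, x). F n t x)) \<and>
     (\<exists>B. \<forall>n. \<forall>t\<in>{0..T}. \<forall>x. \<bar>F n t x\<bar> \<le> B)"

text \<open>
  Parabolic weights: a time derivative counts as two space derivatives. All bounds are uniform over
  the sequence.
\<close>
fun parabolic :: "real \<Rightarrow> nat \<Rightarrow> (nat \<Rightarrow> real \<Rightarrow> real \<Rightarrow> real) \<Rightarrow> bool" where
  "parabolic T 0 F \<longleftrightarrow> family_bc T F"
| "parabolic T (Suc 0) F \<longleftrightarrow> family_bc T F \<and> (\<exists>Fx. (\<forall>n. has_dx T (F n) (Fx n)) \<and> parabolic T 0 Fx)"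
| "parabolic T (Suc (Suc k)) F \<longleftrightarrow> family_bc T F \<and>
     (\<exists>Fx. (\<forall>n. has_dx T (F n) (Fx n)) \<and> parabolic T (Suc k) Fx) \<and>
     (\<exists>Ft. (\<forall>n. has_dt T (F n) (Ft n)) \<and> parabolic T k Ft)"

fun Cb_order :: "nat \<Rightarrow> (real \<Rightarrow> real) \<Rightarrow> bool" where
  "Cb_order 0 G \<longleftrightarrow> bc G"
| "Cb_order (Suc k) G \<longleftrightarrow> bc G \<and> (\<exists>G'. (\<forall>y. (G has_real_derivative G' y) (at y)) \<and> Cb_order k G')"

lemma Cb_order_bc: "Cb_order k G \<Longrightarrow> bc G"
  by (cases k) auto

lemma Cb_order_Suc: "Cb_order (Suc k) G \<Longrightarrow> Cb_order k G"
proof (induction k arbitrary: G)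
  case (Suc k)
  then obtain G' where "bc G" "\<And>y. (G has_real_derivative G' y) (at y)" "Cb_order (Suc k) G'" by auto
  then show ?case using Suc.IH[of G'] by auto
qed simp

lemma family_bc_strip: "family_bc T F \<Longrightarrow> strip_bc T (F n)"
  unfolding family_bc_def strip_bc_def by blast

lemma family_bc_slice: "family_bc T u \<Longrightarrow> t \<in> {0..T} \<Longrightarrow> bc (u n t)"
  by (rule strip_bc_imp_bc[OF family_bc_strip])

lemma family_bc_bound:
  assumes "family_bc T F"
  obtains B where "0 \<le> B" "\<And>n t x. t \<in> {0..T} \<Longrightarrow> \<bar>F n t x\<bar> \<le> B"
proof -
  obtain B where "\<And>n t x. t \<in> {0..T} \<Longrightarrow> \<bar>F n t x\<bar> \<le> B" using assms unfolding family_bc_def by blast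
  then have "\<bar>F n t x\<bar> \<le> \<bar>B\<bar>" if "t \<in> {0..T}" for n t x using that by (meson abs_ge_self order_trans)
  then show ?thesis using that[of "\<bar>B\<bar>"] by simp
qed

lemma family_bcI:
  "(\<And>n. continuous_on ({0..T} \<times> UNIV) (\<lambda>(t, x). F n t x)) \<Longrightarrow> (\<And>n t x. t \<in> {0..T} \<Longrightarrow> \<bar>F n t x\<bar> \<le> B) \<Longrightarrow> family_bc T F"
  unfolding family_bc_def by blast

lemma family_bc_cont: "family_bc T F \<Longrightarrow> continuous_on ({0..T} \<times> UNIV) (\<lambda>p. F n (fst p) (snd p))"
  by (simp add: family_bc_def split_beta)

lemma family_bc_add:
  assumes "family_bc T F" "family_bc T G"
  shows "family_bc T (\<lambda>n t x. F n t x + G n t x)"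
proof -
  obtain B where B: "0 \<le> B" "\<And>n t x. t \<in> {0..T} \<Longrightarrow> \<bar>F n t x\<bar> \<le> B" using family_bc_bound[OF assms(1)] by blast
  obtain C where C: "0 \<le> C" "\<And>n t x. t \<in> {0..T} \<Longrightarrow> \<bar>G n t x\<bar> \<le> C" using family_bc_bound[OF assms(2)] by blast
  show ?thesis
  proof (rule family_bcI)
    show "continuous_on ({0..T} \<times> UNIV) (\<lambda>(t, x). F n t x + G n t x)" for n
      unfolding split_beta by (intro continuous_intros family_bc_cont assms)
    show "\<bar>F n t x + G n t x\<bar> \<le> B + C" if "t \<in> {0..T}" for n t x
      using B(2)[OF that, of n x] C(2)[OF that, of n x] by linarith
  qed
qed

lemma family_bc_mult:
  assumes "family_bc T F" "family_bc T G"
  shows "family_bc T (\<lambda>n t x. F n t x * G n t x)"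
proof -
  obtain B where B: "0 \<le> B" "\<And>n t x. t \<in> {0..T} \<Longrightarrow> \<bar>F n t x\<bar> \<le> B" using family_bc_bound[OF assms(1)] by blast
  obtain C where C: "0 \<le> C" "\<And>n t x. t \<in> {0..T} \<Longrightarrow> \<bar>G n t x\<bar> \<le> C" using family_bc_bound[OF assms(2)] by blast
  show ?thesis
  proof (rule family_bcI)
    show "continuous_on ({0..T} \<times> UNIV) (\<lambda>(t, x). F n t x * G n t x)" for n
      unfolding split_beta by (intro continuous_intros family_bc_cont assms)
    show "\<bar>F n t x * G n t x\<bar> \<le> B * C" if "t \<in> {0..T}" for n t x
      using B C that by (auto simp: abs_mult intro!: mult_mono)
  qed
qed

lemma family_bc_const: "family_bc T (\<lambda>_ _ _. c)"
  by (rule family_bcI[where B = "\<bar>c\<bar>"]) (auto simp: split_beta)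

lemma parabolic_bc: "parabolic T k F \<Longrightarrow> family_bc T F"
  by (cases "(T, k, F)" rule: parabolic.cases) auto

lemma parabolic_dx:
  assumes "parabolic T (Suc k) F"
  obtains Fx where "\<And>n. has_dx T (F n) (Fx n)" "parabolic T k Fx"
  using assms by (cases k) auto

lemma parabolic_dt:
  assumes "parabolic T (Suc (Suc k)) F"
  obtains Ft where "\<And>n. has_dt T (F n) (Ft n)" "parabolic T k Ft"
  using assms by auto

lemma parabolicI1: "family_bc T F \<Longrightarrow> (\<And>n. has_dx T (F n) (Fx n)) \<Longrightarrow> parabolic T 0 Fx \<Longrightarrow> parabolic T (Suc 0) F"
  by auto

lemma parabolicI2:
  "family_bc T F \<Longrightarrow> (\<And>n. has_dx T (F n) (Fx n)) \<Longrightarrow> parabolic T (Suc k) Fx \<Longrightarrow>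
   (\<And>n. has_dt T (F n) (Ft n)) \<Longrightarrow> parabolic T k Ft \<Longrightarrow> parabolic T (Suc (Suc k)) F"
  by auto

declare parabolic.simps(2,3) [simp del]

lemma parabolic_Suc: "parabolic T (Suc k) F \<Longrightarrow> parabolic T k F"
\<comment> \<open>Strong induction, because the space clause of \<open>parabolic\<close> descends by
  one order and the time clause by two.\<close>
proof (induction k arbitrary: F rule: less_induct)
  case (less k)
  obtain Fx where Fx: "\<And>n. has_dx T (F n) (Fx n)" "parabolic T k Fx" using parabolic_dx[OF less.prems] by blast
  note F = parabolic_bc[OF less.prems]
  consider "k = 0" | "k = 1" | j where "k = Suc (Suc j)" by (metis One_nat_def not0_implies_Suc)
  then show ?case
  proof cases
    case 1 then show ?thesis using F by simp
  next
    case 2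
    then show ?thesis using parabolicI1[OF F Fx(1)] less.IH[of 0 Fx] Fx(2) by simp
  next
    case 3
    obtain Ft where Ft: "\<And>n. has_dt T (F n) (Ft n)" "parabolic T (Suc j) Ft"
      using parabolic_dt less.prems 3 by blast
    show ?thesis unfolding 3
      by (rule parabolicI2[OF F Fx(1) _ Ft(1)]) (use less.IH[of "Suc j" Fx] less.IH[of j Ft] Fx Ft 3 in auto)
  qed
qed

lemma parabolic_le: "parabolic T k F \<Longrightarrow> j \<le> k \<Longrightarrow> parabolic T j F"
  by (induction k) (auto simp: le_Suc_eq dest: parabolic_Suc)

lemma parabolic_const: "parabolic T k (\<lambda>_ _ _. c)"
proof (induction k arbitrary: c rule: less_induct)
  case (less k)
  have dx: "has_dx T (\<lambda>_ _. c) (\<lambda>_ _. 0)" and dt: "has_dt T (\<lambda>_ _. c) (\<lambda>_ _. 0)"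
    by (auto simp: has_dx_def has_dt_def)
  consider "k = 0" | "k = 1" | j where "k = Suc (Suc j)" by (metis One_nat_def not0_implies_Suc)
  then show ?case
  proof cases
    case 1 then show ?thesis using family_bc_const by simp
  next
    case 2
    show ?thesis unfolding 2 One_nat_def
      by (rule parabolicI1[OF family_bc_const dx], rule less.IH) (use 2 in simp)
  next
    case 3
    show ?thesis unfolding 3
      by (rule parabolicI2[OF family_bc_const dx _ dt]; rule less.IH) (use 3 in simp_all)
  qed
qed

section \<open>Closure of the parabolic classes under sums, products and changes of index\<close>

lemma has_dx_add: "has_dx T F F' \<Longrightarrow> has_dx T G G' \<Longrightarrow> has_dx T (\<lambda>t x. F t x + G t x) (\<lambda>t x. F' t x + G' t x)"
  unfolding has_dx_def by (auto intro!: DERIV_add)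

lemma has_dt_add: "has_dt T F F' \<Longrightarrow> has_dt T G G' \<Longrightarrow> has_dt T (\<lambda>t x. F t x + G t x) (\<lambda>t x. F' t x + G' t x)"
  unfolding has_dt_def by (auto intro!: DERIV_add)

lemma has_dx_mult:
  "has_dx T F F' \<Longrightarrow> has_dx T G G' \<Longrightarrow> has_dx T (\<lambda>t x. F t x * G t x) (\<lambda>t x. F' t x * G t x + F t x * G' t x)"
  unfolding has_dx_def by (auto intro!: derivative_eq_intros)

lemma has_dt_mult:
  "has_dt T F F' \<Longrightarrow> has_dt T G G' \<Longrightarrow> has_dt T (\<lambda>t x. F t x * G t x) (\<lambda>t x. F' t x * G t x + F t x * G' t x)"
  unfolding has_dt_def by (auto intro!: derivative_eq_intros)

lemma parabolic_add: "parabolic T k F \<Longrightarrow> parabolic T k G \<Longrightarrow> parabolic T k (\<lambda>n t x. F n t x + G n t x)"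
proof (induction k arbitrary: F G rule: less_induct)
  case (less k)
  note bc = family_bc_add[OF parabolic_bc[OF less.prems(1)] parabolic_bc[OF less.prems(2)]]
  show ?case
  proof (cases k)
    case 0 then show ?thesis using bc by simp
  next
    case (Suc j)
    obtain Fx where Fx: "\<And>n. has_dx T (F n) (Fx n)" "parabolic T j Fx" using parabolic_dx less.prems(1) Suc by blast
    obtain Gx where Gx: "\<And>n. has_dx T (G n) (Gx n)" "parabolic T j Gx" using parabolic_dx less.prems(2) Suc by blast
    note x = has_dx_add[OF Fx(1) Gx(1)] less.IH[OF _ Fx(2) Gx(2)]
    show ?thesis
    proof (cases j)
      case 0 then show ?thesis using parabolicI1[OF bc x(1)] x(2) Suc by simp
    next
      case (Suc i)
      note k = \<open>k = Suc j\<close> Suc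
      obtain Ft where Ft: "\<And>n. has_dt T (F n) (Ft n)" "parabolic T i Ft" using parabolic_dt less.prems(1) k by blast
      obtain Gt where Gt: "\<And>n. has_dt T (G n) (Gt n)" "parabolic T i Gt" using parabolic_dt less.prems(2) k by blast
      show ?thesis unfolding k
        by (rule parabolicI2[OF bc x(1) _ has_dt_add[OF Ft(1) Gt(1)] less.IH[OF _ Ft(2) Gt(2)]]) (use x(2) k in auto)
    qed
  qed
qed

lemma parabolic_mult: "parabolic T k F \<Longrightarrow> parabolic T k G \<Longrightarrow> parabolic T k (\<lambda>n t x. F n t x * G n t x)"
proof (induction k arbitrary: F G rule: less_induct)
  case (less k)
  note bc = family_bc_mult[OF parabolic_bc[OF less.prems(1)] parabolic_bc[OF less.prems(2)]]
  show ?case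
  proof (cases k)
    case 0 then show ?thesis using bc by simp
  next
    case (Suc j)
    obtain Fx where Fx: "\<And>n. has_dx T (F n) (Fx n)" "parabolic T j Fx" using parabolic_dx less.prems(1) Suc by blast
    obtain Gx where Gx: "\<And>n. has_dx T (G n) (Gx n)" "parabolic T j Gx" using parabolic_dx less.prems(2) Suc by blast
    have FG: "parabolic T j F" "parabolic T j G" using less.prems parabolic_le Suc by auto
    have x: "has_dx T (\<lambda>t x. F n t x * G n t x) (\<lambda>t x. Fx n t x * G n t x + F n t x * Gx n t x)" for n
      by (rule has_dx_mult[OF Fx(1) Gx(1)])
    have x2: "parabolic T j (\<lambda>n t x. Fx n t x * G n t x + F n t x * Gx n t x)"
      by (intro parabolic_add less.IH Fx Gx FG) (use Suc in auto)
    show ?thesis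
    proof (cases j)
      case 0 then show ?thesis using parabolicI1[OF bc x] x2 Suc by simp
    next
      case (Suc i)
      note k = \<open>k = Suc j\<close> Suc
      obtain Ft where Ft: "\<And>n. has_dt T (F n) (Ft n)" "parabolic T i Ft" using parabolic_dt less.prems(1) k by blast
      obtain Gt where Gt: "\<And>n. has_dt T (G n) (Gt n)" "parabolic T i Gt" using parabolic_dt less.prems(2) k by blast
      have FG': "parabolic T i F" "parabolic T i G" using less.prems parabolic_le k by auto
      have t: "has_dt T (\<lambda>t x. F n t x * G n t x) (\<lambda>t x. Ft n t x * G n t x + F n t x * Gt n t x)" for n
        by (rule has_dt_mult[OF Ft(1) Gt(1)])
      have t2: "parabolic T i (\<lambda>n t x. Ft n t x * G n t x + F n t x * Gt n t x)"
        by (intro parabolic_add less.IH Ft Gt FG') (use k in auto)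
      show ?thesis unfolding k
        by (rule parabolicI2[OF bc x _ t t2]) (use x2 k in auto)
    qed
  qed
qed

lemma parabolic_cmult: "parabolic T k F \<Longrightarrow> parabolic T k (\<lambda>n t x. c * F n t x)"
  by (rule parabolic_mult[OF parabolic_const])

lemma parabolic_reindex:
  assumes "parabolic T k F"
  shows "parabolic T k (\<lambda>n. F (\<sigma> n))"
  using assms
proof (induction k arbitrary: F rule: less_induct)
  case (less k)
  have bc: "family_bc T (\<lambda>n. F (\<sigma> n))" using parabolic_bc[OF less.prems] unfolding family_bc_def by blast
  show ?case
  proof (cases k)
    case 0 then show ?thesis using bc by simp
  next
    case (Suc j)
    obtain Fx where Fx: "\<And>n. has_dx T (F n) (Fx n)" "parabolic T j Fx" using parabolic_dx less.prems(1) Suc by blast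
    show ?thesis
    proof (cases j)
      case 0 then show ?thesis using parabolicI1[OF bc Fx(1)] less.IH[OF _ Fx(2)] Suc by simp
    next
      case (Suc i)
      note k = \<open>k = Suc j\<close> Suc
      obtain Ft where Ft: "\<And>n. has_dt T (F n) (Ft n)" "parabolic T i Ft" using parabolic_dt less.prems(1) k by blast
      show ?thesis unfolding k
        by (rule parabolicI2[OF bc Fx(1) _ Ft(1) less.IH[OF _ Ft(2)]]) (use less.IH[OF _ Fx(2)] k in auto)
    qed
  qed
qed

text \<open>The time derivative of iterate \<open>m + 1\<close> is expressed through data of index
  \<open>m\<close>, and iterate 0 vanishes identically. The shifted family is a switch depending on
  the index times a reindexed family; at index 0 the value \<open>F (0 - 1) = F 0\<close> is
  multiplied by zero.\<close>

lemma parabolic_shift: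
  assumes "parabolic T k F"
  shows "parabolic T k (\<lambda>n. case n of 0 \<Rightarrow> \<lambda>_ _. 0 | Suc m \<Rightarrow> F m)"
proof -
  have "parabolic T k (\<lambda>n t x. (case n of 0 \<Rightarrow> 0 | Suc m \<Rightarrow> 1) * F (n - 1) t x)"
  proof (rule parabolic_mult[OF _ parabolic_reindex[OF assms]])
    show "parabolic T k (\<lambda>n t x. (case n of 0 \<Rightarrow> 0 | Suc m \<Rightarrow> 1))"
    proof (induction k rule: less_induct)
      case (less k)
      let ?F = "\<lambda>n (t::real) (x::real). (case n of 0 \<Rightarrow> 0 :: real | Suc m \<Rightarrow> 1)"
      have bc: "family_bc T ?F" by (rule family_bcI[where B = 1]) (auto simp: split_beta split: nat.split)
      have dx: "has_dx T (?F n) (\<lambda>_ _. 0)" and dt: "has_dt T (?F n) (\<lambda>_ _. 0)" for n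
        by (auto simp: has_dx_def has_dt_def)
      consider "k = 0" | "k = 1" | j where "k = Suc (Suc j)" by (metis One_nat_def not0_implies_Suc)
      then show ?case
      proof cases
        case 1 then show ?thesis using bc by simp
      next
        case 2
        show ?thesis unfolding 2 One_nat_def by (rule parabolicI1[OF bc dx parabolic_const])
      next
        case 3
        show ?thesis unfolding 3 by (rule parabolicI2[OF bc dx parabolic_const dt parabolic_const])
      qed
    qed
  qed
  moreover have "(\<lambda>n t x. (case n of 0 \<Rightarrow> 0 | Suc m \<Rightarrow> 1) * F (n - 1) t x) = (\<lambda>n. case n of 0 \<Rightarrow> \<lambda>_ _. 0 | Suc m \<Rightarrow> F m)"
    by (auto simp: fun_eq_iff split: nat.split)
  ultimately show ?thesis by simp
qed

lemma has_dx_unique: "has_dx T F G \<Longrightarrow> has_dx T F H \<Longrightarrow> t \<in> {0..T} \<Longrightarrow> G t x = H t x"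
  unfolding has_dx_def using DERIV_unique by blast

lemma has_dt_cong: "has_dt T F G \<Longrightarrow> (\<And>t x. t \<in> {0..T} \<Longrightarrow> G t x = H t x) \<Longrightarrow> has_dt T F H"
  unfolding has_dt_def by auto

lemma has_dx_cong:
  "has_dx T F G \<Longrightarrow> (\<And>t x. t \<in> {0..T} \<Longrightarrow> F t x = F' t x) \<Longrightarrow> (\<And>t x. t \<in> {0..T} \<Longrightarrow> G t x = G' t x) \<Longrightarrow> has_dx T F' G'"
  unfolding has_dx_def by (metis ext)

text \<open>The heat equation turns two space derivatives of a mild iterate into one time derivative.\<close>
lemma parabolic_mildI:
  assumes v0: "\<And>t x. v 0 t x = 0" and vS: "\<And>n t x. v (Suc n) t x = mild T \<gamma> (F n) t x"
    and \<gamma>: "Cb_order 2 \<gamma>" and F: "parabolic T k F"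
    and Fx: "\<And>n. has_dx T (F n) (Fx n)" "parabolic T (Suc 0) Fx"
    and v: "family_bc T v" and vx: "\<And>n. has_dx T (v n) (vx n)" "parabolic T (Suc k) vx"
  shows "parabolic T (Suc (Suc k)) v"
proof -
  have vSf: "v (Suc n) = mild T \<gamma> (F n)" for n using vS by (simp add: fun_eq_iff)
  obtain \<gamma>1 \<gamma>2 where \<gamma>12: "bc \<gamma>" "bc \<gamma>1" "bc \<gamma>2" "\<And>y. (\<gamma> has_real_derivative \<gamma>1 y) (at y)"
    "\<And>y. (\<gamma>1 has_real_derivative \<gamma>2 y) (at y)"
    using \<gamma> by (auto simp: numeral_2_eq_2)
  obtain Fxx where Fxx: "\<And>n. has_dx T (Fx n) (Fxx n)" "parabolic T 0 Fxx" using parabolic_dx[OF Fx(2)] by blast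
  obtain vxx where vxx: "\<And>n. has_dx T (vx n) (vxx n)" "parabolic T k vxx" using parabolic_dx[OF vx(2)] by blast
  note st = family_bc_strip[OF parabolic_bc[OF F]] family_bc_strip[OF parabolic_bc[OF Fx(2)]] family_bc_strip[OF parabolic_bc[OF Fxx(2)]]
  \<comment> \<open>The heat equation solved for the time derivative. Iterate 0 is zero and not a
    mild function, hence the case distinction; \<open>F m\<close> belongs to the preceding
    iterate.\<close>
  let ?vt = "\<lambda>n. case n of 0 \<Rightarrow> (\<lambda>_ _. 0) | Suc m \<Rightarrow> (\<lambda>t x. (-1 / 2) * vxx (Suc m) t x + (-1) * F m t x)"
  have "has_dt T (v n) (?vt n)" for n
  proof (cases n)
    case 0
    have "v 0 = (\<lambda>_ _. 0)" using v0 by (simp add: fun_eq_iff)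
    then show ?thesis using 0 by (simp add: has_dt_def)
  next
    case (Suc m)
    \<comment> \<open>\<open>vx\<close> and \<open>vxx\<close> are arbitrary witnesses; uniqueness
      of derivatives identifies them on the strip with the mild functions that occur in the heat
      equation.\<close>
    have d1: "has_dx T (v n) (mild T \<gamma>1 (Fx m))"
      unfolding Suc vSf by (rule has_dx_mild) (use \<gamma>12 st Fx in auto)
    have d2: "has_dx T (mild T \<gamma>1 (Fx m)) (mild T \<gamma>2 (Fxx m))"
      by (rule has_dx_mild) (use \<gamma>12 st Fxx in auto)
    have e1: "vx n t x = mild T \<gamma>1 (Fx m) t x" if "t \<in> {0..T}" for t x
      using has_dx_unique[OF vx(1) d1 that] .
    have "has_dx T (vx n) (mild T \<gamma>2 (Fxx m))"
      by (rule has_dx_cong[OF d2]) (use e1 in auto)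
    then have e2: "vxx n t x = mild T \<gamma>2 (Fxx m) t x" if "t \<in> {0..T}" for t x
      using has_dx_unique[OF vxx(1)] that by blast
    have "has_dt T (v n) (\<lambda>t x. - (1 / 2 * mild T \<gamma>2 (Fxx m) t x + F m t x))"
      unfolding Suc vSf by (rule has_dt_mild[OF \<gamma>12(1,2,3) st(1,2,3) \<gamma>12(4,5) Fx(1) Fxx(1)])
    then show ?thesis by (rule has_dt_cong) (use e2 Suc in auto)
  qed
  moreover have "parabolic T k ?vt"
    by (rule parabolic_shift) (intro parabolic_add parabolic_cmult parabolic_reindex[OF vxx(2)] F)
  ultimately show ?thesis
    by (rule parabolicI2[OF v vx])
qed

text \<open>The coefficients carry the iteration index because they arise by differentiating a
  nonlinear iteration, where the coefficient is the derivative of the driver at the current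
  iterate.\<close>

fun linear_picard :: "real \<Rightarrow> (real \<Rightarrow> real) \<Rightarrow> (nat \<Rightarrow> real \<Rightarrow> real \<Rightarrow> real) \<Rightarrow> (nat \<Rightarrow> real \<Rightarrow> real \<Rightarrow> real) \<Rightarrow>
    nat \<Rightarrow> real \<Rightarrow> real \<Rightarrow> real" where
  "linear_picard T \<gamma> a b 0 = (\<lambda>_ _. 0)"
| "linear_picard T \<gamma> a b (Suc n) = mild T \<gamma> (\<lambda>t x. a n t x * linear_picard T \<gamma> a b n t x + b n t x)"

section \<open>Bounds for linear Picard iterates, uniform in the iterate\<close>

lemma has_integral_exp_weight:
  fixes \<beta> t T :: real
  assumes "0 < \<beta>" "t \<le> T"
  shows "((\<lambda>s. exp (\<beta> * (T - s))) has_integral (exp (\<beta> * (T - t)) - 1) / \<beta>) {t..T}"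
proof -
  have "((\<lambda>s. exp (\<beta> * (T - s))) has_integral (- exp (\<beta> * (T - T)) / \<beta> - (- exp (\<beta> * (T - t)) / \<beta>))) {t..T}"
    by (rule fundamental_theorem_of_calculus[OF assms(2)])
      (use assms in \<open>auto intro!: derivative_eq_intros simp: has_real_derivative_iff_has_vector_derivative[symmetric]\<close>)
  then show ?thesis by (simp add: diff_divide_distrib)
qed

text \<open>A bound of the form \<open>R * exp (\<beta> * (T - t))\<close> reproduces itself: the
  source is at most \<open>\<beta>\<close> times it, integration over the remaining time divides by
  \<open>\<beta>\<close> and subtracts \<open>R\<close>, and the terminal value, at most
  \<open>R\<close>, fills the gap.\<close>

lemma linear_picard_bc:
  assumes \<gamma>: "bc \<gamma>" and a: "family_bc T a" and b: "family_bc T b"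
  shows "family_bc T (linear_picard T \<gamma> a b)"
proof -
  let ?v = "linear_picard T \<gamma> a b"
  obtain G where G: "\<And>y. \<bar>\<gamma> y\<bar> \<le> G" using \<gamma> unfolding bc_def by blast
  obtain A where A: "0 \<le> A" "\<And>n t x. t \<in> {0..T} \<Longrightarrow> \<bar>a n t x\<bar> \<le> A" using family_bc_bound[OF a] by blast
  obtain B where B: "0 \<le> B" "\<And>n t x. t \<in> {0..T} \<Longrightarrow> \<bar>b n t x\<bar> \<le> B" using family_bc_bound[OF b] by blast
  \<comment> \<open>\<open>A\<close> pays for the coefficient and \<open>B\<close> for the
    inhomogeneity, which is absorbed because \<open>R \<ge> 1\<close> makes the weighted bound at
    least 1. The extra 1 keeps \<open>\<beta>\<close> positive.\<close>
  define \<beta> where "\<beta> = A + B + 1"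
  define R where "R = max G 1"
  have \<beta>: "0 < \<beta>" "1 \<le> R" "G \<le> R" using A B by (auto simp: \<beta>_def R_def)
  have *: "strip_bc T (?v n) \<and> (\<forall>t\<in>{0..T}. \<forall>x. \<bar>?v n t x\<bar> \<le> R * exp (\<beta> * (T - t)))" for n
  proof (induction n)
    case 0
    then show ?case using family_bc_strip[OF family_bc_const[of T 0]] \<beta> by auto
  next
    case (Suc n)
    let ?F = "\<lambda>t x. a n t x * ?v n t x + b n t x"
    have F: "strip_bc T ?F"
    proof -
      have "family_bc T (\<lambda>_. ?v n)" using Suc unfolding strip_bc_def family_bc_def by blast
      then have "family_bc T (\<lambda>m t x. a m t x * ?v n t x + b m t x)"
        by (intro family_bc_add family_bc_mult a b)
      from family_bc_strip[OF this, of n] show ?thesis .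
    qed
    have "\<bar>mild T \<gamma> ?F t x\<bar> \<le> R * exp (\<beta> * (T - t))" if t: "t \<in> {0..T}" for t x
    proof -
      have "\<bar>mild T \<gamma> ?F t x\<bar> \<le> G + \<beta> * R * ((exp (\<beta> * (T - t)) - 1) / \<beta>)"
      proof (rule mild_bound[OF \<gamma> G F t, where b = "\<lambda>s. \<beta> * R * exp (\<beta> * (T - s))"])
        fix s y assume s: "s \<in> {t..T}"
        then have s': "s \<in> {0..T}" using t by auto
        have "\<bar>a n s y * ?v n s y + b n s y\<bar> \<le> A * (R * exp (\<beta> * (T - s))) + B"
          using A(2)[OF s', of n y] B(2)[OF s', of n y] Suc s' A(1)
          by (intro order_trans[OF abs_triangle_ineq] add_mono) (auto simp: abs_mult intro!: mult_mono)
        also have "B \<le> B * (R * exp (\<beta> * (T - s)))"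
        proof -
          have "1 \<le> exp (\<beta> * (T - s))" using s \<beta> by simp
          then have "1 * 1 \<le> R * exp (\<beta> * (T - s))" using \<beta> by (intro mult_mono) auto
          then show ?thesis using B(1) mult_left_mono[of 1 _ B] by simp
        qed
        also have "A * (R * exp (\<beta> * (T - s))) + B * (R * exp (\<beta> * (T - s))) \<le> \<beta> * R * exp (\<beta> * (T - s))"
          using \<beta> by (simp add: \<beta>_def algebra_simps)
        finally show "\<bar>a n s y * ?v n s y + b n s y\<bar> \<le> \<beta> * R * exp (\<beta> * (T - s))" by simp
      next
        show "((\<lambda>s. \<beta> * R * exp (\<beta> * (T - s))) has_integral \<beta> * R * ((exp (\<beta> * (T - t)) - 1) / \<beta>)) {t..T}"
          using t \<beta> by (intro has_integral_mult_right has_integral_exp_weight) auto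
      qed
      also have "\<dots> = G + R * (exp (\<beta> * (T - t)) - 1)" using \<beta> by simp
      also have "\<dots> \<le> R * exp (\<beta> * (T - t))" using \<beta> by (simp add: right_diff_distrib)
      finally show ?thesis .
    qed
    then show ?case using strip_bc_mild[OF \<gamma> F] by simp
  qed
  show ?thesis
  proof (rule family_bcI)
    show "continuous_on ({0..T} \<times> UNIV) (\<lambda>(t, x). ?v n t x)" for n using * unfolding strip_bc_def by blast
    show "\<bar>?v n t x\<bar> \<le> R * exp (\<beta> * T)" if t: "t \<in> {0..T}" for n t x
    proof -
      have "\<bar>?v n t x\<bar> \<le> R * exp (\<beta> * (T - t))" using * t by blast
      also have "\<dots> \<le> R * exp (\<beta> * T)" using \<beta> t by (intro mult_left_mono) auto
      finally show ?thesis .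
    qed
  qed
qed

text \<open>
  The space derivative of a linear Picard iterate is itself a linear Picard iterate, with the same
  coefficient \<open>a\<close>; this bootstraps boundedness to smoothness of any order.
\<close>
lemma linear_picard_parabolic:
  assumes "Cb_order k \<gamma>" "parabolic T k a" "parabolic T k b"
  shows "parabolic T k (linear_picard T \<gamma> a b)"
  using assms
proof (induction k arbitrary: \<gamma> b rule: less_induct)
  case (less k)
  let ?v = "linear_picard T \<gamma> a b"
  have v: "family_bc T ?v"
    by (rule linear_picard_bc) (use less.prems Cb_order_bc parabolic_bc in auto)
  show ?case
  proof (cases k)
    case 0 then show ?thesis using v by simp
  next
    case (Suc j)
    obtain ax where ax: "\<And>n. has_dx T (a n) (ax n)" "parabolic T j ax" using parabolic_dx less.prems(2) Suc by blast
    obtain bx where bx: "\<And>n. has_dx T (b n) (bx n)" "parabolic T j bx" using parabolic_dx less.prems(3) Suc by blast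
    obtain \<gamma>' where \<gamma>': "bc \<gamma>" "\<And>y. (\<gamma> has_real_derivative \<gamma>' y) (at y)" "Cb_order j \<gamma>'"
      using less.prems(1) Suc by auto
    have j: "Cb_order j \<gamma>" "parabolic T j a" "parabolic T j b"
      using less.prems Suc Cb_order_Suc parabolic_Suc by auto
    have vj: "parabolic T j ?v" by (rule less.IH) (use j Suc in auto)
    \<comment> \<open>The derivative of \<open>a * v + b\<close> is
      \<open>a * v_x + (a_x * v + b_x)\<close>: the coefficient survives, and everything else
      becomes an inhomogeneity of order \<open>j\<close>, for which the induction hypothesis on
      \<open>v\<close> is enough.\<close>
    define b' where "b' = (\<lambda>n t x. ax n t x * ?v n t x + bx n t x)"
    let ?w = "linear_picard T \<gamma>' a b'"
    have b': "parabolic T j b'" unfolding b'_def by (intro parabolic_add parabolic_mult ax bx vj)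
    have w: "parabolic T j ?w" by (rule less.IH) (use \<gamma>' j b' Suc in auto)
    define F where "F = (\<lambda>n t x. a n t x * ?v n t x + b n t x)"
    define Fx where "Fx = (\<lambda>n t x. a n t x * ?w n t x + b' n t x)"
    have F: "parabolic T j F" unfolding F_def by (intro parabolic_add parabolic_mult j vj)
    have Fx: "parabolic T j Fx" unfolding Fx_def by (intro parabolic_add parabolic_mult j w b')
    have dF: "has_dx T (F n) (Fx n)" if "has_dx T (?v n) (?w n)" for n
    proof -
      have "has_dx T (F n) (\<lambda>t x. (ax n t x * ?v n t x + a n t x * ?w n t x) + bx n t x)"
        unfolding F_def by (intro has_dx_add has_dx_mult ax bx that)
      then show ?thesis by (rule has_dx_cong) (auto simp: Fx_def b'_def)
    qed
    have dv: "has_dx T (?v n) (?w n)" for n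
    proof (induction n)
      case 0 then show ?case by (simp add: has_dx_def)
    next
      case (Suc n)
      have "has_dx T (mild T \<gamma> (F n)) (mild T \<gamma>' (Fx n))"
        by (rule has_dx_mild)
          (use \<gamma>' Cb_order_bc dF[OF Suc] family_bc_strip parabolic_bc F Fx in blast)+
      then show ?case by (simp add: F_def Fx_def)
    qed
    show ?thesis
    proof (cases j)
      case 0
      then show ?thesis using parabolicI1[OF v dv] w \<open>k = Suc j\<close> by simp
    next
      case (Suc i)
      have "parabolic T (Suc (Suc i)) ?v"
      proof (rule parabolic_mildI[where \<gamma> = \<gamma> and F = F and Fx = Fx and vx = ?w])
        have "Cb_order (Suc (Suc i)) \<gamma>" using less.prems(1) \<open>k = Suc j\<close> Suc by simp
        then show "Cb_order 2 \<gamma>" unfolding numeral_2_eq_2 by (auto intro: Cb_order_bc)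
        show "parabolic T i F" "parabolic T (Suc 0) Fx" using F Fx Suc parabolic_le by auto
      qed (use dF dv v w Suc in \<open>auto simp: F_def\<close>)
      then show ?thesis using \<open>k = Suc j\<close> Suc by simp
    qed
  qed
qed

section \<open>Semilinear Picard iterates and the local quadrature error\<close>

lemma Cb_imp_Cb_order:
  assumes "Cb m g" "i + k \<le> m"
  shows "Cb_order k ((deriv ^^ i) g)"
  using assms(2)
proof (induction k arbitrary: i)
  case 0
  then show ?case using assms(1) unfolding Cb_def bounded_iff by (auto simp: bc_def)
next
  case (Suc k)
  have "((deriv ^^ i) g has_real_derivative (deriv ^^ Suc i) g y) (at y)" for y
  proof -
    have "(deriv ^^ i) g field_differentiable at y" using assms(1) Suc.prems unfolding Cb_def by auto
    then show ?thesis by (simp add: field_differentiable_derivI)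
  qed
  moreover have "Cb_order k ((deriv ^^ Suc i) g)" by (rule Suc.IH) (use Suc.prems in simp)
  moreover have "bc ((deriv ^^ i) g)" using assms(1) Suc.prems unfolding Cb_def bc_def bounded_iff by auto
  ultimately show ?case by auto
qed

definition smooth_strip :: "nat \<Rightarrow> real \<Rightarrow> (nat \<Rightarrow> nat \<Rightarrow> real \<Rightarrow> real \<Rightarrow> real) \<Rightarrow> bool" where
  "smooth_strip m T D \<longleftrightarrow>
     (\<forall>i j. i + j < m \<longrightarrow> has_dt T (D i j) (D (Suc i) j) \<and> has_dx T (D i j) (D i (Suc j))) \<and>
     (\<forall>i j. i + j \<le> m \<longrightarrow> strip_bc T (D i j))"

lemma Cb_strip_imp_smooth_strip:
  assumes "Cb_strip m T f"
  obtains D where "smooth_strip m T D" "D 0 0 = f"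
proof -
  obtain D where D0: "\<And>t y. t \<in> {0..T} \<Longrightarrow> D 0 0 t y = f t y"
    and der: "\<And>i j t y. i + j < m \<Longrightarrow> t \<in> {0..T} \<Longrightarrow>
           ((\<lambda>s. D i j s y) has_real_derivative D (Suc i) j t y) (at t within {0..T}) \<and>
           (D i j t has_real_derivative D i (Suc j) t y) (at y)"
    and bd: "\<And>i j. i + j \<le> m \<Longrightarrow> continuous_on ({0..T} \<times> UNIV) (\<lambda>(t, y). D i j t y) \<and>
           bounded ((\<lambda>(t, y). D i j t y) ` ({0..T} \<times> UNIV))"
    using assms unfolding Cb_strip_def by blast
  \<comment> \<open>\<open>Cb_strip\<close> identifies \<open>D 0 0\<close> with \<open>f\<close> on
    the strip only. The modification makes them equal as functions, so that iterates built from one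
    can be rewritten into iterates built from the other.\<close>
  define E where "E i j = (if i = 0 \<and> j = 0 then f else D i j)" for i j
  have ED: "E i j t y = D i j t y" if "t \<in> {0..T}" for i j t y using D0[OF that] by (auto simp: E_def)
  have "smooth_strip m T E"
    unfolding smooth_strip_def
  proof (intro conjI allI impI)
    fix i j assume ij: "i + j < m"
    show "has_dt T (E i j) (E (Suc i) j)"
      unfolding has_dt_def
    proof (intro ballI allI)
      fix t x assume t: "t \<in> {0..T}"
      show "((\<lambda>s. E i j s x) has_real_derivative E (Suc i) j t x) (at t within {0..T})"
        unfolding ED[OF t]
        by (rule has_field_derivative_transform_within[of "\<lambda>s. D i j s x" _ _ _ 1]) (use der[OF ij t] ED t in auto)
    qed
    have "has_dx T (D i j) (D i (Suc j))" using der[OF ij] unfolding has_dx_def by blast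
    then show "has_dx T (E i j) (E i (Suc j))" by (rule has_dx_cong) (use ED in auto)
  next
    fix i j assume ij: "i + j \<le> m"
    have "continuous_on ({0..T} \<times> UNIV) (\<lambda>(t, y). E i j t y)"
      by (rule continuous_on_eq[OF conjunct1[OF bd[OF ij]]]) (use ED in auto)
    moreover obtain B where "\<And>t y. t \<in> {0..T} \<Longrightarrow> \<bar>D i j t y\<bar> \<le> B"
      using conjunct2[OF bd[OF ij]] unfolding bounded_iff by force
    ultimately show "strip_bc T (E i j)" by (intro strip_bcI[where B = B]) (use ED in auto)
  qed
  then show ?thesis using that[of E] by (simp add: E_def)
qed

text \<open>The induction runs over all \<open>D i j\<close> at once since the chain rule raises the
  indices. A time derivative spends two orders of \<open>k\<close> but adds only one to
  \<open>i\<close> or \<open>j\<close>, so \<open>i + j + k \<le> m\<close> is preserved.\<close>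

lemma parabolic_compose:
  assumes D: "smooth_strip m T D" and "parabolic T k u" "i + j + k \<le> m"
  shows "parabolic T k (\<lambda>n t x. D i j t (u n t x))"
  using assms(2,3)
proof (induction k arbitrary: i j rule: less_induct)
  case (less k)
  have sb: "strip_bc T (D i j)" using D less.prems unfolding smooth_strip_def by auto
  have u: "family_bc T u" using parabolic_bc less.prems(1) by blast
  obtain B where B: "\<And>t x. t \<in> {0..T} \<Longrightarrow> \<bar>D i j t x\<bar> \<le> B" using strip_bc_bound[OF sb] by blast
  have bc: "family_bc T (\<lambda>n t x. D i j t (u n t x))"
  proof (rule family_bcI)
    show "continuous_on ({0..T} \<times> UNIV) (\<lambda>(t, x). D i j t (u n t x))" for n
      unfolding split_beta by (rule strip_bc_comp[OF sb]) (auto intro!: continuous_intros family_bc_cont[OF u])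
  qed (use B in auto)
  show ?case
  proof (cases k)
    case 0 then show ?thesis using bc by simp
  next
    case (Suc l)
    obtain ux where ux: "\<And>n. has_dx T (u n) (ux n)" "parabolic T l ux" using parabolic_dx less.prems(1) Suc by blast
    have ul: "parabolic T l u" using less.prems Suc parabolic_Suc by blast
    have Dx: "has_dx T (D i j) (D i (Suc j))" and Dt: "has_dt T (D i j) (D (Suc i) j)"
      and sx: "strip_bc T (D i (Suc j))"
      using D less.prems Suc unfolding smooth_strip_def by auto
    have dx: "has_dx T (\<lambda>t x. D i j t (u n t x)) (\<lambda>t x. D i (Suc j) t (u n t x) * ux n t x)" for n
      unfolding has_dx_def
    proof (intro ballI allI)
      fix t x assume t: "t \<in> {0..T}"
      show "((\<lambda>x. D i j t (u n t x)) has_real_derivative D i (Suc j) t (u n t x) * ux n t x) (at x)"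
        by (rule DERIV_chain2) (use Dx ux(1)[of n] t in \<open>auto simp: has_dx_def\<close>)
    qed
    have dx2: "parabolic T l (\<lambda>n t x. D i (Suc j) t (u n t x) * ux n t x)"
      by (intro parabolic_mult less.IH ul ux) (use less.prems Suc in auto)
    show ?thesis
    proof (cases l)
      case 0 then show ?thesis using parabolicI1[OF bc dx] dx2 Suc by simp
    next
      case (Suc p)
      note k = \<open>k = Suc l\<close> Suc
      obtain ut where ut: "\<And>n. has_dt T (u n) (ut n)" "parabolic T p ut" using parabolic_dt less.prems(1) k by blast
      have up: "parabolic T p u" using ul k parabolic_Suc by blast
      have dt: "has_dt T (\<lambda>t x. D i j t (u n t x)) (\<lambda>t x. D (Suc i) j t (u n t x) + D i (Suc j) t (u n t x) * ut n t x)" for n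
        unfolding has_dt_def
      proof (intro ballI allI)
        fix t x assume t: "t \<in> {0..T}"
        show "((\<lambda>t. D i j t (u n t x)) has_real_derivative D (Suc i) j t (u n t x) + D i (Suc j) t (u n t x) * ut n t x) (at t within {0..T})"
          by (rule chain_strip[OF Dt Dx sx t]) (use ut(1)[of n] t in \<open>auto simp: has_dt_def\<close>)
      qed
      have dt2: "parabolic T p (\<lambda>n t x. D (Suc i) j t (u n t x) + D i (Suc j) t (u n t x) * ut n t x)"
        by (intro parabolic_add parabolic_mult less.IH up ut) (use less.prems k in auto)
      show ?thesis unfolding k
        by (rule parabolicI2[OF bc dx _ dt dt2]) (use dx2 k in auto)
    qed
  qed
qed

fun picard :: "real \<Rightarrow> (real \<Rightarrow> real \<Rightarrow> real) \<Rightarrow> (real \<Rightarrow> real) \<Rightarrow> nat \<Rightarrow> real \<Rightarrow> real \<Rightarrow> real" where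
  "picard T f g 0 = (\<lambda>_ _. 0)"
| "picard T f g (Suc n) = mild T g (\<lambda>t x. f t (picard T f g n t x))"

text \<open>The driver is bounded, so every iterate after the first step obeys the crude bound
  \<open>G + T * C\<close>, independently of the size of its predecessor.\<close>

lemma picard_bc:
  assumes f: "strip_bc T f" and g: "bc g"
  shows "family_bc T (picard T f g)"
proof -
  let ?u = "picard T f g"
  obtain C where C: "\<And>t x. t \<in> {0..T} \<Longrightarrow> \<bar>f t x\<bar> \<le> C" using strip_bc_bound[OF f] by blast
  obtain G where G: "\<And>y. \<bar>g y\<bar> \<le> G" using g unfolding bc_def by blast
  have sb: "strip_bc T (?u n)" for n
  proof (induction n)
    case 0 show ?case using strip_bc_const[of "\<lambda>_. 0" 0 T] by simp
  next
    case (Suc n) then show ?case using strip_bc_mild[OF g strip_bc_compose[OF f]] by simp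
  qed
  have "\<bar>?u n t x\<bar> \<le> G + T * C" if t: "t \<in> {0..T}" for n t x
  proof (cases n)
    case 0
    have "0 \<le> G" "0 \<le> C" using G[of 0] C[OF t, of 0] by linarith+
    then show ?thesis using 0 t by simp
  next
    case (Suc k)
    have "\<bar>?u n t x\<bar> \<le> G + (T - t) * C"
      unfolding Suc picard.simps
      by (rule mild_bound[OF g G strip_bc_compose[OF f sb] t, where b = "\<lambda>_. C"])
        (use C t has_integral_const_real[of C t T] in auto)
    also have "\<dots> \<le> G + T * C" using t C[OF t, of 0] by (auto intro!: mult_right_mono)
    finally show ?thesis .
  qed
  then show ?thesis using sb unfolding strip_bc_def by (intro family_bcI) auto
qed

text \<open>The space derivative of the iteration is the linear Picard iteration with terminal value
  \<open>g'\<close>, coefficient \<open>D 0 1 t (u n t x)\<close> and no inhomogeneity. Order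
  \<open>j\<close> of the iterates gives order \<open>j\<close> of this coefficient, hence of the
  derivative, hence order \<open>j + 1\<close> of the iterates.\<close>

lemma picard_parabolic:
  assumes D: "smooth_strip m T D" and "Cb_order k g" "k \<le> m"
  shows "parabolic T k (picard T (D 0 0) g)"
  using assms(2,3)
proof (induction k)
  case 0
  then show ?case using picard_bc D unfolding smooth_strip_def by auto
next
  case (Suc j)
  let ?u = "picard T (D 0 0) g"
  have u: "parabolic T j ?u" using Suc Cb_order_Suc by auto
  have m: "Suc j \<le> m" using Suc.prems by simp
  define a where "a = (\<lambda>n t x. D 0 1 t (?u n t x))"
  define F where "F = (\<lambda>n t x. D 0 0 t (?u n t x))"
  have a: "parabolic T j a" unfolding a_def by (rule parabolic_compose[OF D u]) (use m in auto)
  have F: "parabolic T j F" unfolding F_def by (rule parabolic_compose[OF D u]) (use m in auto)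
  obtain g' where g': "bc g" "\<And>y. (g has_real_derivative g' y) (at y)" "Cb_order j g'"
    using Suc.prems(1) by auto
  let ?w = "linear_picard T g' a (\<lambda>_ _ _. 0)"
  have w: "parabolic T j ?w" by (rule linear_picard_parabolic[OF g'(3) a parabolic_const])
  define Fx where "Fx = (\<lambda>n t x. a n t x * ?w n t x)"
  have Fx: "parabolic T j Fx" unfolding Fx_def by (rule parabolic_mult[OF a w])
  have D0: "has_dx T (D 0 0) (D 0 1)" using D m unfolding smooth_strip_def by auto
  have dF: "has_dx T (F n) (Fx n)" if "has_dx T (?u n) (?w n)" for n
    unfolding has_dx_def F_def Fx_def a_def
  proof (intro ballI allI)
    fix t x assume t: "t \<in> {0..T}"
    show "((\<lambda>x. D 0 0 t (?u n t x)) has_real_derivative D 0 1 t (?u n t x) * linear_picard T g' (\<lambda>n t x. D 0 1 t (?u n t x)) (\<lambda>_ _ _. 0) n t x) (at x)"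
      by (rule DERIV_chain2) (use D0 that t in \<open>auto simp: has_dx_def a_def\<close>)
  qed
  have du: "has_dx T (?u n) (?w n)" for n
  proof (induction n)
    case 0 then show ?case by (simp add: has_dx_def)
  next
    case (Suc n)
    have "has_dx T (mild T g (F n)) (mild T g' (Fx n))"
      by (rule has_dx_mild) (use g' Cb_order_bc dF[OF Suc] family_bc_strip parabolic_bc F Fx in blast)+
    then show ?case by (simp add: F_def Fx_def)
  qed
  show ?case
  proof (cases j)
    case 0
    then show ?thesis using parabolicI1[OF parabolic_bc[OF u] du] w by simp
  next
    case (Suc i)
    have "parabolic T (Suc (Suc i)) ?u"
    proof (rule parabolic_mildI[where \<gamma> = g and F = F and Fx = Fx and vx = ?w])
      have "Cb_order (Suc (Suc i)) g" using Suc.prems(1) Suc by simp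
      then show "Cb_order 2 g" unfolding numeral_2_eq_2 by (auto intro: Cb_order_bc)
      show "parabolic T i F" "parabolic T (Suc 0) Fx" using F Fx Suc parabolic_le by auto
    qed (use dF du parabolic_bc[OF u] w Suc in \<open>auto simp: F_def\<close>)
    then show ?thesis using Suc by simp
  qed
qed

section \<open>Taylor expansion along the heat flow and the error of the quadrature rule\<close>

lemma has_integral_power_shift:
  assumes "t \<le> s"
  shows "((\<lambda>r. (r - t) ^ i) has_integral (s - t) ^ Suc i / real (Suc i)) {t..s}"
proof -
  have "((\<lambda>r. (r - t) ^ i) has_integral ((s - t) ^ Suc i / real (Suc i) - (t - t) ^ Suc i / real (Suc i))) {t..s}"
    by (rule fundamental_theorem_of_calculus[OF assms])
      (auto intro!: derivative_eq_intros simp: has_real_derivative_iff_has_vector_derivative[symmetric] simp del: power_Suc)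
  then show ?thesis by simp
qed

text \<open>
  Along the heat flow the time derivative of \<open>F\<close> is governed by \<open>F\<^sub>t + F\<^sub>x\<^sub>x / 2\<close>, which is of the same
  kind; iterating gives a Taylor expansion.
\<close>
lemma heat_taylor:
  assumes "parabolic T (2 * l) F"
  shows "\<exists>C\<ge>0. \<forall>n. \<forall>t\<in>{0..T}. \<forall>x. \<exists>c. \<forall>s\<in>{t..T}.
    \<bar>heat (s - t) (F n s) x - (\<Sum>i<l. c i * (s - t) ^ i)\<bar> \<le> C * (s - t) ^ l"
  using assms
proof (induction l arbitrary: F)
  case 0
  then have F: "family_bc T F" using parabolic_bc by blast
  obtain B where B: "0 \<le> B" "\<And>n t x. t \<in> {0..T} \<Longrightarrow> \<bar>F n t x\<bar> \<le> B" using family_bc_bound[OF F] by blast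
  have "\<bar>heat (s - t) (F n s) x\<bar> \<le> B" if "t \<in> {0..T}" "s \<in> {t..T}" for n t s x
    by (rule heat_bound[OF strip_bc_slice[OF family_bc_strip[OF F]]]) (use B that in auto)
  then show ?case using B(1) by (intro exI[of _ B]) auto
next
  case (Suc l)
  have p: "parabolic T (Suc (Suc (2 * l))) F" using Suc.prems by simp
  obtain Fx where Fx: "\<And>n. has_dx T (F n) (Fx n)" "parabolic T (Suc (2 * l)) Fx" using parabolic_dx[OF p] by blast
  obtain Fxx where Fxx: "\<And>n. has_dx T (Fx n) (Fxx n)" "parabolic T (2 * l) Fxx" using parabolic_dx[OF Fx(2)] by blast
  obtain Ft where Ft: "\<And>n. has_dt T (F n) (Ft n)" "parabolic T (2 * l) Ft" using parabolic_dt[OF p] by blast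
  define G where "G = (\<lambda>n t x. Ft n t x + 1 / 2 * Fxx n t x)"
  have G: "parabolic T (2 * l) G" unfolding G_def by (intro parabolic_add parabolic_cmult Ft Fxx)
  obtain C where C: "0 \<le> C" "\<And>n t x. t \<in> {0..T} \<Longrightarrow> \<exists>c. \<forall>s\<in>{t..T}.
      \<bar>heat (s - t) (G n s) x - (\<Sum>i<l. c i * (s - t) ^ i)\<bar> \<le> C * (s - t) ^ l"
    using Suc.IH[OF G] by blast
  have "\<exists>c. \<forall>s\<in>{t..T}. \<bar>heat (s - t) (F n s) x - (\<Sum>i<Suc l. c i * (s - t) ^ i)\<bar> \<le> C * (s - t) ^ Suc l"
    if t: "t \<in> {0..T}" for n t x
  proof -
    obtain c where c: "\<And>s. s \<in> {t..T} \<Longrightarrow> \<bar>heat (s - t) (G n s) x - (\<Sum>i<l. c i * (s - t) ^ i)\<bar> \<le> C * (s - t) ^ l"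
      using C(2)[OF t] by blast
    \<comment> \<open>Termwise integration of the expansion of \<open>G\<close>, with the value at
      the starting time as constant term.\<close>
    define d where "d i = (case i of 0 \<Rightarrow> F n t x | Suc j \<Rightarrow> c j / real (Suc j))" for i
    have "\<bar>heat (s - t) (F n s) x - (\<Sum>i<Suc l. d i * (s - t) ^ i)\<bar> \<le> C * (s - t) ^ Suc l" if s: "s \<in> {t..T}" for s
    proof -
      note st = family_bc_strip[OF parabolic_bc]
      have i1: "((\<lambda>r. heat (r - t) (G n r) x) has_integral heat (s - t) (F n s) x - F n t x) {t..s}"
        unfolding G_def
        by (rule heat_dynkin[OF st[OF p] Ft(1) st[OF Ft(2)] Fx(1) st[OF Fx(2)] Fxx(1) st[OF Fxx(2)]]) (use s t in auto)
      have i2: "((\<lambda>r. \<Sum>i<l. c i * (r - t) ^ i) has_integral (\<Sum>i<l. c i * ((s - t) ^ Suc i / real (Suc i)))) {t..s}"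
        by (intro has_integral_sum has_integral_mult_right has_integral_power_shift) (use s in auto)
      \<comment> \<open>Bounding the remainder under the integral by its largest value, at
        \<open>r = s\<close>, costs the factor \<open>s - t\<close> and leaves the constant
        \<open>C\<close> unchanged through the induction.\<close>
      have "norm ((heat (s - t) (F n s) x - F n t x) - (\<Sum>i<l. c i * ((s - t) ^ Suc i / real (Suc i)))) \<le> C * (s - t) ^ l * measure lborel {t..s}"
      proof (rule has_integral_bound_real[OF _ finite.emptyI has_integral_diff[OF i1 i2]])
        show "0 \<le> C * (s - t) ^ l" using C(1) s by auto
        show "norm (heat (r - t) (G n r) x - (\<Sum>i<l. c i * (r - t) ^ i)) \<le> C * (s - t) ^ l" if "r \<in> {t..s} - {}" for r
        proof -
          have "\<bar>heat (r - t) (G n r) x - (\<Sum>i<l. c i * (r - t) ^ i)\<bar> \<le> C * (r - t) ^ l" by (rule c) (use that s in auto)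
          also have "\<dots> \<le> C * (s - t) ^ l" using that C(1) by (intro mult_left_mono power_mono) auto
          finally show ?thesis by simp
        qed
      qed
      moreover have "(\<Sum>i<Suc l. d i * (s - t) ^ i) = F n t x + (\<Sum>i<l. c i * ((s - t) ^ Suc i / real (Suc i)))"
        unfolding sum.lessThan_Suc_shift by (simp add: d_def)
      ultimately show ?thesis using s by (simp add: algebra_simps)
    qed
    then show ?thesis by blast
  qed
  then show ?case using C(1) by blast
qed

text \<open>This is the source of exactness: \<open>interpolation_weights\<close> quantifies over
  every interpolant, so it is enough to exhibit a polynomial as an interpolant of its own nodal
  values. The cap 3 is the degree of the spline pieces.\<close>

lemma step_interpolant_poly:
  fixes p :: "real poly"
  assumes "degree p \<le> min K 3"
  shows "step_interpolant K a h (\<lambda>j. poly p (a + real j * h)) (poly p)"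
proof (cases "K \<le> 2")
  case True
  then show ?thesis using assms by (auto simp: step_interpolant_def intro!: exI[of _ p])
next
  case False
  let ?I = "{a..a + real K * h}"
  have d: "(poly q has_real_derivative poly (pderiv q) x) (at x within A)" for q x A
    by (rule has_field_derivative_at_within[OF poly_DERIV])
  have "\<exists>q::real poly. degree q \<le> 3 \<and> (\<forall>x\<in>{a + real j * h..a + real (Suc j) * h}. poly p x = poly q x)" for j
    using assms by (auto intro!: exI[of _ p])
  moreover have "continuous_on ?I (poly (pderiv (pderiv p)))" by (intro continuous_intros)
  moreover have "\<exists>S3. (\<forall>\<^sub>F x in nhds q. (poly (pderiv (pderiv p)) has_real_derivative S3 x) (at x)) \<and> isCont S3 q" for q
    by (intro exI[of _ "poly (pderiv (pderiv (pderiv p)))"] conjI always_eventually allI poly_DERIV) (rule poly_isCont)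
  ultimately have "not_a_knot_spline K a h (poly p)"
    unfolding not_a_knot_spline_def using d by blast
  then show ?thesis using False by (simp add: step_interpolant_def)
qed

text \<open>The rule is exact on the Taylor polynomial, so only the remainder matters, once under
  the integral and once at the nodes. These two contributions are the \<open>1\<close> and the sum
  of absolute weights in the constant.\<close>

lemma quadrature_error:
  assumes w: "interpolation_weights K \<gamma>" and h: "0 < h" and C: "0 \<le> C"
    and q: "q = min K 3"
    and \<phi>: "\<phi> integrable_on {t..t + real K * h}"
    and bnd: "\<And>r. r \<in> {t..t + real K * h} \<Longrightarrow> \<bar>\<phi> r - (\<Sum>i<Suc q. c i * (r - t) ^ i)\<bar> \<le> C * (r - t) ^ Suc q"
  shows "\<bar>integral {t..t + real K * h} \<phi> - h * real K * (\<Sum>j\<le>K. \<gamma> j * \<phi> (t + real j * h))\<bar>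
    \<le> C * (1 + (\<Sum>j\<le>K. \<bar>\<gamma> j\<bar>)) * real K ^ (q + 2) * h ^ (q + 2)"
proof -
  define p0 where "p0 = (\<Sum>i<Suc q. monom (c i) i)"
  define p where "p = pcompose p0 [:- t, 1:]"
  have pp: "poly p r = (\<Sum>i<Suc q. c i * (r - t) ^ i)" for r
    by (simp add: p_def poly_pcompose p0_def poly_sum poly_monom del: sum.lessThan_Suc)
  have "degree p0 \<le> q"
    unfolding p0_def by (rule degree_sum_le) (auto intro: order_trans[OF degree_monom_le])
  then have dp: "degree p \<le> min K 3" unfolding p_def by (simp add: degree_pcompose q)
  have I: "(poly p has_integral h * real K * (\<Sum>j\<le>K. \<gamma> j * poly p (t + real j * h))) {t..t + real K * h}"
    using w h step_interpolant_poly[OF dp, of t h] unfolding interpolation_weights_def by blast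
  \<comment> \<open>The largest possible remainder on the whole step; multiplied by the length
    \<open>real K * h\<close> it gives the exponent \<open>q + 2\<close>.\<close>
  define e where "e = C * (real K * h) ^ Suc q"
  have e: "0 \<le> e" using C h by (simp add: e_def)
  have be: "\<bar>\<phi> r - poly p r\<bar> \<le> e" if "r \<in> {t..t + real K * h}" for r
  proof -
    have "\<bar>\<phi> r - poly p r\<bar> \<le> C * (r - t) ^ Suc q" unfolding pp by (rule bnd[OF that])
    also have "\<dots> \<le> e" unfolding e_def using that C by (intro mult_left_mono power_mono) auto
    finally show ?thesis .
  qed
  have 1: "\<bar>integral {t..t + real K * h} \<phi> - h * real K * (\<Sum>j\<le>K. \<gamma> j * poly p (t + real j * h))\<bar> \<le> e * (real K * h)"
  proof -
    have "norm (integral {t..t + real K * h} \<phi> - h * real K * (\<Sum>j\<le>K. \<gamma> j * poly p (t + real j * h))) \<le> e * measure lborel {t..t + real K * h}"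
      by (rule has_integral_bound_real[OF e finite.emptyI has_integral_diff[OF integrable_integral[OF \<phi>] I]]) (use be in auto)
    then show ?thesis using h by simp
  qed
  have 2: "\<bar>(\<Sum>j\<le>K. \<gamma> j * poly p (t + real j * h)) - (\<Sum>j\<le>K. \<gamma> j * \<phi> (t + real j * h))\<bar> \<le> (\<Sum>j\<le>K. \<bar>\<gamma> j\<bar>) * e"
  proof -
    have "\<bar>(\<Sum>j\<le>K. \<gamma> j * poly p (t + real j * h)) - (\<Sum>j\<le>K. \<gamma> j * \<phi> (t + real j * h))\<bar>
        \<le> (\<Sum>j\<le>K. \<bar>\<gamma> j * (poly p (t + real j * h) - \<phi> (t + real j * h))\<bar>)"
      unfolding sum_subtractf[symmetric] right_diff_distrib[symmetric] by (rule sum_abs)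
    also have "\<dots> \<le> (\<Sum>j\<le>K. \<bar>\<gamma> j\<bar> * e)"
    proof (rule sum_mono)
      fix j assume "j \<in> {..K}"
      then have "t + real j * h \<in> {t..t + real K * h}" using h by auto
      from be[OF this] show "\<bar>\<gamma> j * (poly p (t + real j * h) - \<phi> (t + real j * h))\<bar> \<le> \<bar>\<gamma> j\<bar> * e"
        by (simp add: abs_mult abs_minus_commute mult_left_mono)
    qed
    finally show ?thesis by (simp add: sum_distrib_right)
  qed
  have "\<bar>h * real K * ((\<Sum>j\<le>K. \<gamma> j * poly p (t + real j * h)) - (\<Sum>j\<le>K. \<gamma> j * \<phi> (t + real j * h)))\<bar> \<le> h * real K * ((\<Sum>j\<le>K. \<bar>\<gamma> j\<bar>) * e)"
    using 2 h by (simp add: abs_mult mult_left_mono)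
  then have "\<bar>integral {t..t + real K * h} \<phi> - h * real K * (\<Sum>j\<le>K. \<gamma> j * \<phi> (t + real j * h))\<bar>
      \<le> e * (real K * h) + h * real K * ((\<Sum>j\<le>K. \<bar>\<gamma> j\<bar>) * e)"
    using 1 unfolding right_diff_distrib by linarith
  also have "\<dots> = C * (1 + (\<Sum>j\<le>K. \<bar>\<gamma> j\<bar>)) * real K ^ (q + 2) * h ^ (q + 2)"
    unfolding e_def by (simp add: power_mult_distrib algebra_simps)
  finally show ?thesis .
qed

text \<open>Iterate \<open>n + 1\<close> solves a linear equation with source \<open>F n\<close>, so
  by Dynkin's formula its increment along the heat flow is exactly the time integral of the averaged
  source, and the scheme replaces that integral by the quadrature rule.\<close>

lemma picard_local_error:
  assumes D: "smooth_strip 8 T D" and g: "Cb_order 8 g" and w: "interpolation_weights K \<gamma>"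
  defines "u \<equiv> picard T (D 0 0) g"
  shows "\<exists>C\<ge>0. \<forall>n t x h. 0 < h \<longrightarrow> 0 \<le> t \<longrightarrow> t + real K * h \<le> T \<longrightarrow>
    \<bar>u (Suc n) t x - heat (real K * h) (u (Suc n) (t + real K * h)) x
      - h * real K * (\<Sum>j\<le>K. \<gamma> j * heat (real j * h) (\<lambda>y. D 0 0 (t + real j * h) (u n (t + real j * h) y)) x)\<bar>
    \<le> C * h ^ (min K 3 + 2)"
proof -
  define q where "q = min K 3"
  define F where "F = (\<lambda>n t x. D 0 0 t (u n t x))"
  have u: "parabolic T 8 u" unfolding u_def by (rule picard_parabolic[OF D g]) simp
  have F: "parabolic T 8 F" unfolding F_def by (rule parabolic_compose[OF D u]) simp
  \<comment> \<open>The origin of the number 8: an expansion of order \<open>q + 1\<close>, with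
    \<open>q\<close> at most 3, takes \<open>2 * (q + 1)\<close> parabolic orders.\<close>
  have "parabolic T (2 * Suc q) F" by (rule parabolic_le[OF F]) (auto simp: q_def)
  from heat_taylor[OF this] obtain C where C: "0 \<le> C" "\<And>n t x. t \<in> {0..T} \<Longrightarrow> \<exists>c. \<forall>s\<in>{t..T}.
      \<bar>heat (s - t) (F n s) x - (\<Sum>i<Suc q. c i * (s - t) ^ i)\<bar> \<le> C * (s - t) ^ Suc q" by blast
  define C' where "C' = C * (1 + (\<Sum>j\<le>K. \<bar>\<gamma> j\<bar>)) * real K ^ (q + 2)"
  have F2: "parabolic T (Suc (Suc 0)) F" by (rule parabolic_le[OF F]) simp
  obtain Fx where Fx: "\<And>n. has_dx T (F n) (Fx n)" "parabolic T (Suc 0) Fx" using parabolic_dx[OF F2] by blast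
  obtain Fxx where Fxx: "\<And>n. has_dx T (Fx n) (Fxx n)" "parabolic T 0 Fxx" using parabolic_dx[OF Fx(2)] by blast
  have "Cb_order (Suc 7) g" using g by simp
  then obtain g1 where g1: "bc g" "\<And>y. (g has_real_derivative g1 y) (at y)" "Cb_order 7 g1"
    unfolding Cb_order.simps by blast
  then have "Cb_order (Suc 6) g1" by simp
  then obtain g2 where g2: "bc g1" "\<And>y. (g1 has_real_derivative g2 y) (at y)" "Cb_order 6 g2"
    unfolding Cb_order.simps by blast
  note g12 = g1(1) g2(1) Cb_order_bc[OF g2(3)] g1(2) g2(2)
  note st = family_bc_strip[OF parabolic_bc]
  note stF = st[OF F] st[OF Fx(2)] st[OF Fxx(2)]
  have "\<bar>u (Suc n) t x - heat (real K * h) (u (Suc n) (t + real K * h)) x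
      - h * real K * (\<Sum>j\<le>K. \<gamma> j * heat (real j * h) (F n (t + real j * h)) x)\<bar> \<le> C' * h ^ (q + 2)"
    if h: "0 < h" "0 \<le> t" "t + real K * h \<le> T" for n t x h
  proof -
    have uS: "u (Suc n) = mild T g (F n)" by (simp add: u_def F_def)
    let ?s = "t + real K * h"
    have Kh: "0 \<le> real K * h" using h by simp
    then have ts: "t \<le> ?s" by linarith
    have "t \<le> T" using h(3) Kh by linarith
    then have t: "t \<in> {0..T}" using h by simp
    have bm: "strip_bc T (mild T g2 (Fxx n))" by (rule strip_bc_mild[OF g12(3) stF(3)])
    \<comment> \<open>In the integrand the time derivative from the heat equation meets half the
      second space derivative, and only \<open>- F n\<close> is left.\<close>
    have "((\<lambda>r. heat (r - t) (\<lambda>y. - (1 / 2 * mild T g2 (Fxx n) r y + F n r y) + 1 / 2 * mild T g2 (Fxx n) r y) x)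
        has_integral heat (?s - t) (mild T g (F n) ?s) x - mild T g (F n) t x) {t..?s}"
    proof (rule heat_dynkin[where Fx = "mild T g1 (Fx n)"])
      show "has_dt T (mild T g (F n)) (\<lambda>t x. - (1 / 2 * mild T g2 (Fxx n) t x + F n t x))"
        by (rule has_dt_mild[OF g12(1,2,3) stF g12(4,5) Fx(1) Fxx(1)])
      show "has_dx T (mild T g (F n)) (mild T g1 (Fx n))"
        by (rule has_dx_mild[OF g12(1) stF(1) g12(2) stF(2) g12(4) Fx(1)])
      show "has_dx T (mild T g1 (Fx n)) (mild T g2 (Fxx n))"
        by (rule has_dx_mild[OF g12(2) stF(2) g12(3) stF(3) g12(5) Fxx(1)])
      have "strip_bc T (\<lambda>t x. (-1 / 2) * mild T g2 (Fxx n) t x + (-1) * F n t x)"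
        by (intro strip_bc_add strip_bc_cmult bm stF)
      then show "strip_bc T (\<lambda>t x. - (1 / 2 * mild T g2 (Fxx n) t x + F n t x))"
        by (simp add: algebra_simps)
    qed (use h ts in \<open>auto intro!: strip_bc_mild g12 stF\<close>)
    then have "((\<lambda>r. (-1) * heat (r - t) (F n r) x) has_integral heat (?s - t) (mild T g (F n) ?s) x - mild T g (F n) t x) {t..?s}"
      unfolding heat_cmult[symmetric] by simp
    from has_integral_mult_right[OF this, of "-1"]
    have "((\<lambda>r. heat (r - t) (F n r) x) has_integral u (Suc n) t x - heat (real K * h) (u (Suc n) ?s) x) {t..?s}"
      by (simp add: uS)
    then have I: "integral {t..?s} (\<lambda>r. heat (r - t) (F n r) x) = u (Suc n) t x - heat (real K * h) (u (Suc n) ?s) x"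
      "(\<lambda>r. heat (r - t) (F n r) x) integrable_on {t..?s}" by auto
    obtain c where c: "\<And>s. s \<in> {t..T} \<Longrightarrow> \<bar>heat (s - t) (F n s) x - (\<Sum>i<Suc q. c i * (s - t) ^ i)\<bar> \<le> C * (s - t) ^ Suc q"
      using C(2)[OF t] by blast
    have "\<bar>integral {t..?s} (\<lambda>r. heat (r - t) (F n r) x) - h * real K * (\<Sum>j\<le>K. \<gamma> j * heat (t + real j * h - t) (F n (t + real j * h)) x)\<bar>
        \<le> C * (1 + (\<Sum>j\<le>K. \<bar>\<gamma> j\<bar>)) * real K ^ (q + 2) * h ^ (q + 2)"
      by (rule quadrature_error[OF w h(1) C(1) q_def I(2), where c = c]) (use c h in auto)
    then show ?thesis unfolding I(1) C'_def by simp
  qed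
  moreover have "0 \<le> C'" unfolding C'_def using C(1) by (intro mult_nonneg_nonneg add_nonneg_nonneg sum_nonneg) auto
  ultimately show ?thesis unfolding F_def q_def by (intro exI[of _ C']) blast
qed

section \<open>Brownian motion and the backward equation\<close>

context brownian_basis
begin

section \<open>Independence of increments and the Markov property\<close>

lemma space_filtration: "t \<in> {0..T} \<Longrightarrow> space (F t) = space M"
  using filtration_subalgebra unfolding subalgebra_def by blast

lemma sets_filtration_M: "t \<in> {0..T} \<Longrightarrow> A \<in> sets (F t) \<Longrightarrow> A \<in> sets M"
  using filtration_subalgebra unfolding subalgebra_def by blast

lemma filtration_borel_M: "t \<in> {0..T} \<Longrightarrow> X \<in> borel_measurable (F t) \<Longrightarrow> X \<in> borel_measurable M"
  using measurable_from_subalg[OF filtration_subalgebra] by blast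

lemma filtration_borel_mono:
  assumes "0 \<le> s" "s \<le> t" "t \<le> T" "X \<in> borel_measurable (F s)"
  shows "X \<in> borel_measurable (F t)"
proof (rule measurable_from_subalg[OF _ assms(4)])
  show "subalgebra (F t) (F s)"
    unfolding subalgebra_def using assms filtration_mono space_filtration[of s] space_filtration[of t] by auto
qed

lemma brownian_adapted:
  assumes t: "t \<in> {0..T}"
  shows "W t \<in> borel_measurable (F t)"
proof (rule measurableI)
  fix B :: "real set" assume B: "B \<in> sets borel"
  have "W t -` B \<inter> space M \<in> sets (F t)"
    unfolding filtration_generated[OF t] by (rule sigma_sets.Basic) (use t B in auto)
  then show "W t -` B \<inter> space (F t) \<in> sets (F t)" using space_filtration[OF t] by simp
qed simp

text \<open>\<open>indep_var\<close> wants both variables in one value type, so the increment is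
  sent by a Borel map \<open>v\<close> into the value space of \<open>X\<close>. Independence is
  inherited because the generated algebras only become smaller.\<close>

lemma indep_var_increment:
  assumes st: "0 \<le> s" "s < t" "t \<le> T" and X: "X \<in> measurable (F s) N" and v: "v \<in> measurable borel N"
  shows "indep_var N X N (\<lambda>\<omega>. v (W t \<omega> - W s \<omega>))"
proof -
  have s: "s \<in> {0..T}" "t \<in> {0..T}" using st by auto
  let ?V = "\<lambda>\<omega>. W t \<omega> - W s \<omega>"
  have "W s \<in> borel_measurable M" "W t \<in> borel_measurable M"
    using brownian_adapted filtration_borel_M s by blast+
  then have V: "?V \<in> borel_measurable M" by simp
  have "indep_set (sigma_sets (space M) {X -` A \<inter> space M | A. A \<in> sets N})
      (sigma_sets (space M) {(\<lambda>\<omega>. v (?V \<omega>)) -` A \<inter> space M | A. A \<in> sets N})"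
    unfolding indep_set_def
  proof (rule indep_sets_mono_sets[OF brownian_independent[OF st, unfolded indep_set_def]])
    have 1: "sigma_sets (space M) {X -` A \<inter> space M | A. A \<in> sets N} \<subseteq> sets (F s)"
    proof -
      have "{X -` A \<inter> space M | A. A \<in> sets N} \<subseteq> sets (F s)"
        using measurable_sets[OF X] space_filtration[OF s(1)] by auto
      from sets.sigma_sets_subset[OF this] show ?thesis using space_filtration[OF s(1)] by simp
    qed
    have 2: "sigma_sets (space M) {(\<lambda>\<omega>. v (?V \<omega>)) -` A \<inter> space M | A. A \<in> sets N}
        \<subseteq> sets (vimage_algebra (space M) ?V borel)"
    proof -
      have "{(\<lambda>\<omega>. v (?V \<omega>)) -` A \<inter> space M | A. A \<in> sets N} \<subseteq> sets (vimage_algebra (space M) ?V borel)"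
      proof safe
        fix A assume A: "A \<in> sets N"
        have "v -` A \<in> sets borel" using measurable_sets[OF v A] by simp
        from in_vimage_algebra[OF this, of ?V "space M"]
        show "(\<lambda>\<omega>. v (?V \<omega>)) -` A \<inter> space M \<in> sets (vimage_algebra (space M) ?V borel)"
          by (simp add: vimage_def)
      qed
      from sets.sigma_sets_subset[OF this] show ?thesis by simp
    qed
    show "case_bool (sigma_sets (space M) {X -` A \<inter> space M | A. A \<in> sets N})
        (sigma_sets (space M) {(\<lambda>\<omega>. v (?V \<omega>)) -` A \<inter> space M | A. A \<in> sets N}) i
      \<subseteq> case_bool (sets (F s)) (sets (vimage_algebra (space M) ?V borel)) i" for i
      using 1 2 by (cases i) auto
  qed
  moreover have "random_variable N X"
    using measurable_from_subalg[OF filtration_subalgebra[OF s(1)] X] .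
  moreover have "random_variable N (\<lambda>\<omega>. v (?V \<omega>))" by (rule measurable_compose[OF V v])
  ultimately show ?thesis unfolding indep_var_eq by blast
qed

lemma expectation_increment:
  assumes st: "0 \<le> s" "s < t" "t \<le> T" and G: "continuous_on UNIV G"
  shows "(\<integral>\<omega>. G (w + (W t \<omega> - W s \<omega>)) \<partial>M) = heat (t - s) G w"
proof -
  have [measurable]: "G \<in> borel_measurable borel" using G by (rule borel_measurable_continuous_onI)
  have "distributed M lborel (\<lambda>\<omega>. (W t \<omega> - W s \<omega> - 0) / sqrt (t - s)) std_normal_density"
    using brownian_normal[OF st] st by (subst (asm) normal_standard_normal_convert) auto
  then have Z: "distributed M lborel (\<lambda>\<omega>. (W t \<omega> - W s \<omega>) / sqrt (t - s)) std_normal_density" by simp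
  have "(\<integral>\<omega>. G (w + (W t \<omega> - W s \<omega>)) \<partial>M) = (\<integral>\<omega>. G (w + sqrt (t - s) * ((W t \<omega> - W s \<omega>) / sqrt (t - s))) \<partial>M)"
    using st by simp
  also have "\<dots> = (\<integral>z. std_normal_density z * G (w + sqrt (t - s) * z) \<partial>lborel)"
    by (rule distributed_integral[OF Z, symmetric]) auto
  also have "\<dots> = heat (t - s) G w"
    unfolding heat_def by (subst integral_gauss) auto
  finally show ?thesis .
qed

lemma brownian_comp_measurable:
  assumes "t \<in> {0..T}" "bc G"
  shows "(\<lambda>\<omega>. G (W t \<omega>)) \<in> borel_measurable (F t)"
  by (rule measurable_compose[OF brownian_adapted[OF assms(1)] bc_borel_measurable[OF assms(2)]])

text \<open>\<open>W s\<close> is \<open>W t\<close> plus an increment independent of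
  \<open>F t\<close>. The joint law of the pair of the indicator of \<open>A\<close> and
  \<open>W t\<close> with this increment is therefore a product, and Fubini integrates the increment
  out first, which produces the heat average.\<close>

lemma markov_integral:
  assumes ts: "0 \<le> t" "t \<le> s" "s \<le> T" and A: "A \<in> sets (F t)" and G: "bc G"
  shows "(\<integral>\<omega>. indicator A \<omega> * G (W s \<omega>) \<partial>M) = (\<integral>\<omega>. indicator A \<omega> * heat (s - t) G (W t \<omega>) \<partial>M)"
proof (cases "s = t")
  case False
  with ts have st: "0 \<le> t" "t < s" "s \<le> T" by auto
  have tT: "t \<in> {0..T}" "s \<in> {0..T}" using ts by auto
  obtain B where B: "continuous_on UNIV G" "\<And>y. \<bar>G y\<bar> \<le> B" using bcE[OF G] by blast
  have [measurable]: "G \<in> borel_measurable borel" using B(1) by (rule borel_measurable_continuous_onI)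
  define X where "X \<omega> = (indicator A \<omega> :: real, W t \<omega>)" for \<omega>
  \<comment> \<open>The component 0 is padding that gives \<open>V\<close> the same value type as
    \<open>X\<close>.\<close>
  define V where "V \<omega> = (W s \<omega> - W t \<omega>, 0 :: real)" for \<omega>
  have X: "X \<in> measurable (F t) (borel \<Otimes>\<^sub>M borel)"
    unfolding X_def using A brownian_adapted[OF tT(1)] by measurable
  have ind: "indep_var (borel \<Otimes>\<^sub>M borel) X (borel \<Otimes>\<^sub>M borel) V"
    unfolding V_def by (rule indep_var_increment[OF st X, of "\<lambda>x. (x, 0)"]) measurable
  note rv[measurable] = indep_var_rv1[OF ind] indep_var_rv2[OF ind]
  have deq: "distr M (borel \<Otimes>\<^sub>M borel) X \<Otimes>\<^sub>M distr M (borel \<Otimes>\<^sub>M borel) V = distr M ((borel \<Otimes>\<^sub>M borel) \<Otimes>\<^sub>M (borel \<Otimes>\<^sub>M borel)) (\<lambda>\<omega>. (X \<omega>, V \<omega>))"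
    using ind unfolding indep_var_distribution_eq by blast
  interpret DX: prob_space "distr M (borel \<Otimes>\<^sub>M borel) X" by (rule prob_space_distr) simp
  interpret DV: prob_space "distr M (borel \<Otimes>\<^sub>M borel) V" by (rule prob_space_distr) simp
  interpret P: pair_prob_space "distr M (borel \<Otimes>\<^sub>M borel) X" "distr M (borel \<Otimes>\<^sub>M borel) V" ..
  \<comment> \<open>Testing whether the first coordinate equals 1 recovers the event
    \<open>A\<close> and keeps the integrand bounded on the whole product space.\<close>
  define \<phi> where "\<phi> p = indicator {1} (fst (fst p)) * G (snd (fst p) + fst (snd p))" for p :: "(real \<times> real) \<times> (real \<times> real)"
  have [measurable]: "\<phi> \<in> borel_measurable ((borel \<Otimes>\<^sub>M borel) \<Otimes>\<^sub>M (borel \<Otimes>\<^sub>M borel))"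
    unfolding \<phi>_def by measurable
  have B0: "0 \<le> B" using B(2)[of 0] by linarith
  have \<phi>B: "\<bar>\<phi> p\<bar> \<le> B" for p unfolding \<phi>_def using B(2) B0 by (auto simp: indicator_def)
  have int: "integrable (distr M (borel \<Otimes>\<^sub>M borel) X \<Otimes>\<^sub>M distr M (borel \<Otimes>\<^sub>M borel) V) \<phi>"
    by (rule P.integrable_const_bound[where B = B]) (use \<phi>B in auto)
  have "(\<integral>\<omega>. indicator A \<omega> * G (W s \<omega>) \<partial>M) = (\<integral>\<omega>. \<phi> (X \<omega>, V \<omega>) \<partial>M)"
    by (rule Bochner_Integration.integral_cong) (auto simp: \<phi>_def X_def V_def indicator_def)
  also have "\<dots> = integral\<^sup>L (distr M (borel \<Otimes>\<^sub>M borel) X \<Otimes>\<^sub>M distr M (borel \<Otimes>\<^sub>M borel) V) \<phi>"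
    unfolding deq by (rule integral_distr[symmetric]) measurable
  also have "\<dots> = (\<integral>x. (\<integral>v. \<phi> (x, v) \<partial>distr M (borel \<Otimes>\<^sub>M borel) V) \<partial>distr M (borel \<Otimes>\<^sub>M borel) X)"
    by (rule P.integral_fst'[OF int, symmetric])
  also have "\<dots> = (\<integral>x. indicator {1} (fst x) * heat (s - t) G (snd x) \<partial>distr M (borel \<Otimes>\<^sub>M borel) X)"
  proof (rule Bochner_Integration.integral_cong[OF refl])
    fix x
    have "(\<integral>v. \<phi> (x, v) \<partial>distr M (borel \<Otimes>\<^sub>M borel) V) = (\<integral>\<omega>. \<phi> (x, V \<omega>) \<partial>M)"
    proof (rule integral_distr[OF rv(2)])
      show "(\<lambda>v. \<phi> (x, v)) \<in> borel_measurable (borel \<Otimes>\<^sub>M borel)"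
        by (rule measurable_Pair2[where ?M1.0 = "borel \<Otimes>\<^sub>M borel"]) (simp_all add: space_pair_measure)
    qed
    also have "\<dots> = indicator {1} (fst x) * heat (s - t) G (snd x)"
      unfolding \<phi>_def using expectation_increment[OF st B(1), of "snd x"] by (simp add: V_def)
    finally show "(\<integral>v. \<phi> (x, v) \<partial>distr M (borel \<Otimes>\<^sub>M borel) V) = indicator {1} (fst x) * heat (s - t) G (snd x)" .
  qed
  also have "\<dots> = (\<integral>\<omega>. indicator {1} (fst (X \<omega>)) * heat (s - t) G (snd (X \<omega>)) \<partial>M)"
  proof (rule integral_distr)
    have hm: "heat (s - t) G \<in> borel_measurable borel" by (rule bc_borel_measurable[OF bc_heat[OF G]])
    show "(\<lambda>x::real \<times> real. indicator {1} (fst x) * heat (s - t) G (snd x)) \<in> borel_measurable (borel \<Otimes>\<^sub>M borel)"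
      by (intro borel_measurable_times measurable_compose[OF measurable_snd hm]
          measurable_compose[OF measurable_fst borel_measurable_indicator]) simp
  qed (rule rv(1))
  also have "\<dots> = (\<integral>\<omega>. indicator A \<omega> * heat (s - t) G (W t \<omega>) \<partial>M)"
    by (rule Bochner_Integration.integral_cong) (auto simp: X_def indicator_def)
  finally show ?thesis .
qed simp

section \<open>Conditional expectations of Brownian functionals\<close>

lemma finite_measure_subalgebra_filtration: "t \<in> {0..T} \<Longrightarrow> finite_measure_subalgebra M (F t)"
  by unfold_locales (rule filtration_subalgebra)

lemma integrable_bc_comp:
  assumes "bc \<phi>" "integrable M V"
  shows "integrable M (\<lambda>\<omega>. \<phi> (V \<omega>) :: real)"
proof -
  obtain B where B: "continuous_on UNIV \<phi>" "\<And>y. \<bar>\<phi> y\<bar> \<le> B" using bcE[OF assms(1)] by blast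
  have "(\<lambda>\<omega>. \<phi> (V \<omega>)) \<in> borel_measurable M"
    using measurable_compose[OF borel_measurable_integrable[OF assms(2)] borel_measurable_continuous_onI[OF B(1)]] .
  then show ?thesis by (rule integrable_const_bound[rotated, where B = B]) (use B in auto)
qed

lemma integrable_bc_brownian:
  assumes "t \<in> {0..T}" "bc G"
  shows "integrable M (\<lambda>\<omega>. G (W t \<omega>))"
proof -
  obtain B where B: "\<And>y. \<bar>G y\<bar> \<le> B" using assms(2) unfolding bc_def by blast
  show ?thesis
    by (rule integrable_const_bound[where B = B])
      (use B filtration_borel_M[OF assms(1) brownian_comp_measurable[OF assms]] in auto)
qed

lemma cond_exp_brownian:
  assumes ts: "0 \<le> t" "t \<le> s" "s \<le> T" and G: "bc G"
  shows "AE \<omega> in M. real_cond_exp M (F t) (\<lambda>\<omega>. G (W s \<omega>)) \<omega> = heat (s - t) G (W t \<omega>)"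
proof -
  have tT: "t \<in> {0..T}" "s \<in> {0..T}" using ts by auto
  interpret S: finite_measure_subalgebra M "F t" by (rule finite_measure_subalgebra_filtration[OF tT(1)])
  show ?thesis
  proof (rule S.real_cond_exp_charact)
    show "(LINT \<omega>:A|M. G (W s \<omega>)) = (LINT \<omega>:A|M. heat (s - t) G (W t \<omega>))" if "A \<in> sets (F t)" for A
      using markov_integral[OF ts that G] by (simp add: set_lebesgue_integral_def)
    show "integrable M (\<lambda>\<omega>. G (W s \<omega>))" by (rule integrable_bc_brownian[OF tT(2) G])
    show "integrable M (\<lambda>\<omega>. heat (s - t) G (W t \<omega>))" by (rule integrable_bc_brownian[OF tT(1) bc_heat[OF G]])
    show "(\<lambda>\<omega>. heat (s - t) G (W t \<omega>)) \<in> borel_measurable (F t)" by (rule brownian_comp_measurable[OF tT(1) bc_heat[OF G]])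
  qed
qed

text \<open>Monotonicity applied to \<open>X\<close> and \<open>- X\<close> against the absolute
  value. This contraction in \<open>L^1\<close> is what makes the scheme stable.\<close>

lemma expectation_cond_exp_abs_le:
  assumes "t \<in> {0..T}" "integrable M X"
  shows "(\<integral>\<omega>. \<bar>real_cond_exp M (F t) X \<omega>\<bar> \<partial>M) \<le> (\<integral>\<omega>. \<bar>X \<omega>\<bar> \<partial>M)"
proof -
  interpret S: finite_measure_subalgebra M "F t" by (rule finite_measure_subalgebra_filtration[OF assms(1)])
  have ab: "integrable M (\<lambda>\<omega>. \<bar>X \<omega>\<bar>)" using assms(2) by simp
  have "AE \<omega> in M. real_cond_exp M (F t) X \<omega> \<le> real_cond_exp M (F t) (\<lambda>\<omega>. \<bar>X \<omega>\<bar>) \<omega>"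
    by (rule S.real_cond_exp_mono) (use assms ab in auto)
  moreover have "AE \<omega> in M. real_cond_exp M (F t) (\<lambda>\<omega>. (-1) * X \<omega>) \<omega> \<le> real_cond_exp M (F t) (\<lambda>\<omega>. \<bar>X \<omega>\<bar>) \<omega>"
    by (rule S.real_cond_exp_mono) (use assms ab in auto)
  moreover have "AE \<omega> in M. real_cond_exp M (F t) (\<lambda>\<omega>. (-1) * X \<omega>) \<omega> = (-1) * real_cond_exp M (F t) X \<omega>"
    by (rule S.real_cond_exp_cmult[OF assms(2)])
  ultimately have "AE \<omega> in M. \<bar>real_cond_exp M (F t) X \<omega>\<bar> \<le> real_cond_exp M (F t) (\<lambda>\<omega>. \<bar>X \<omega>\<bar>) \<omega>"
    by eventually_elim auto
  then have "(\<integral>\<omega>. \<bar>real_cond_exp M (F t) X \<omega>\<bar> \<partial>M) \<le> (\<integral>\<omega>. real_cond_exp M (F t) (\<lambda>\<omega>. \<bar>X \<omega>\<bar>) \<omega> \<partial>M)"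
    by (intro integral_mono_AE) (use S.real_cond_exp_int(1)[OF assms(2)] S.real_cond_exp_int(1)[OF ab] in auto)
  also have "\<dots> = (\<integral>\<omega>. \<bar>X \<omega>\<bar> \<partial>M)" by (rule S.real_cond_exp_int(2)[OF ab])
  finally show ?thesis .
qed

section \<open>Ito integrals have mean zero on events of the past\<close>

lemma increment_integral_zero:
  assumes st: "0 \<le> s" "s \<le> t" "t \<le> T" and U: "U \<in> borel_measurable (F s)" "\<And>\<omega>. \<omega> \<in> space M \<Longrightarrow> \<bar>U \<omega>\<bar> \<le> B"
  shows "integrable M (\<lambda>\<omega>. U \<omega> * (W t \<omega> - W s \<omega>))" "(\<integral>\<omega>. U \<omega> * (W t \<omega> - W s \<omega>) \<partial>M) = 0"
proof -
  have sT: "s \<in> {0..T}" using st by auto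
  have *: "integrable M (\<lambda>\<omega>. U \<omega> * (W t \<omega> - W s \<omega>)) \<and> (\<integral>\<omega>. U \<omega> * (W t \<omega> - W s \<omega>) \<partial>M) = 0"
  proof (cases "s = t")
    case False
    with st have st': "0 \<le> s" "s < t" "t \<le> T" by auto
    have iU: "integrable M U"
      by (rule integrable_const_bound[where B = B]) (use U filtration_borel_M[OF sT] in auto)
    have N: "distributed M lborel (\<lambda>\<omega>. W t \<omega> - W s \<omega>) (normal_density 0 (sqrt (t - s)))"
      by (rule brownian_normal[OF st'])
    have iV: "integrable M (\<lambda>\<omega>. W t \<omega> - W s \<omega>)"
      using integrable_normal_moment[of "sqrt (t - s)" 0 1] st'
        distributed_integrable[OF N, of "\<lambda>x. x"] by auto
    have eV: "(\<integral>\<omega>. W t \<omega> - W s \<omega> \<partial>M) = 0"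
      by (rule normal_distributed_expectation[OF _ N]) (use st' in auto)
    have ind: "indep_var borel U borel (\<lambda>\<omega>. W t \<omega> - W s \<omega>)"
      using indep_var_increment[OF st' U(1), of "\<lambda>x. x"] by simp
    show ?thesis
      using indep_var_integrable[OF ind iU iV] indep_var_lebesgue_integral[OF ind iU iV] eV by simp
  qed simp
  then show "integrable M (\<lambda>\<omega>. U \<omega> * (W t \<omega> - W s \<omega>))" "(\<integral>\<omega>. U \<omega> * (W t \<omega> - W s \<omega>) \<partial>M) = 0" by auto
qed

lemma simple_ito_integral_zero:
  assumes J: "simple_ito_integral F W t T H J" and t: "t \<in> {0..T}" and A: "A \<in> sets (F t)"
  shows "integrable M J" "(\<integral>\<omega>. indicator A \<omega> * J \<omega> \<partial>M) = 0"
proof -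
  obtain n \<tau> \<xi> where \<tau>: "\<tau> 0 = t" "\<tau> n = T" "\<And>k. k < n \<Longrightarrow> \<tau> k \<le> \<tau> (Suc k)"
    and \<xi>: "\<And>k. k < n \<Longrightarrow> \<xi> k \<in> borel_measurable (F (\<tau> k)) \<and> bounded (\<xi> k ` space (F (\<tau> k)))"
    and JJ: "J = (\<lambda>\<omega>. \<Sum>k<n. \<xi> k \<omega> * (W (\<tau> (Suc k)) \<omega> - W (\<tau> k) \<omega>))"
    using J unfolding simple_ito_integral_def by blast
  have lo: "k \<le> n \<Longrightarrow> t \<le> \<tau> k" for k
  proof (induction k)
    case (Suc k) then show ?case using \<tau>(3)[of k] by auto
  qed (simp add: \<tau>)
  have hi: "k \<le> n \<Longrightarrow> \<tau> k \<le> T" for k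
  proof (induction k rule: inc_induct)
    case (step k) then show ?case using \<tau>(3)[of k] by auto
  qed (simp add: \<tau>)
  \<comment> \<open>The factor \<open>c\<close> serves twice: the constant 1 gives integrability,
    the indicator of \<open>A\<close> gives the mean. As \<open>t \<le> \<tau> k\<close>, it joins
    \<open>\<xi> k\<close> in a factor known before the increment.\<close>
  have summand: "integrable M (\<lambda>\<omega>. c \<omega> * \<xi> k \<omega> * (W (\<tau> (Suc k)) \<omega> - W (\<tau> k) \<omega>))
      \<and> (\<integral>\<omega>. c \<omega> * \<xi> k \<omega> * (W (\<tau> (Suc k)) \<omega> - W (\<tau> k) \<omega>) \<partial>M) = 0"
    if k: "k < n" and c: "c \<in> borel_measurable (F t)" "\<And>\<omega>. \<bar>c \<omega>\<bar> \<le> 1" for k and c :: "'a \<Rightarrow> real"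
  proof -
    have kk: "0 \<le> t" "t \<le> \<tau> k" "\<tau> k \<le> \<tau> (Suc k)" "\<tau> (Suc k) \<le> T" "\<tau> k \<le> T"
      using lo[of k] hi[of k] hi[of "Suc k"] \<tau>(3)[OF k] k t by auto
    then have kT: "\<tau> k \<in> {0..T}" by auto
    obtain B where B: "\<And>\<omega>. \<omega> \<in> space M \<Longrightarrow> \<bar>\<xi> k \<omega>\<bar> \<le> B"
      using \<xi>[OF k] space_filtration[OF kT] unfolding bounded_iff by auto
    have "c \<in> borel_measurable (F (\<tau> k))" by (rule filtration_borel_mono[OF _ _ _ c(1)]) (use kk in auto)
    then have m: "(\<lambda>\<omega>. c \<omega> * \<xi> k \<omega>) \<in> borel_measurable (F (\<tau> k))" using \<xi>[OF k] by auto
    have b: "\<bar>c \<omega> * \<xi> k \<omega>\<bar> \<le> B" if "\<omega> \<in> space M" for \<omega>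
      using mult_mono[OF c(2)[of \<omega>] B[OF that]] by (simp add: abs_mult)
    show ?thesis using increment_integral_zero[OF _ kk(3,4) m b] kk by auto
  qed
  have "integrable M (\<lambda>\<omega>. 1 * \<xi> k \<omega> * (W (\<tau> (Suc k)) \<omega> - W (\<tau> k) \<omega>))" if "k < n" for k
    using summand[OF that, of "\<lambda>_. 1"] by simp
  then show "integrable M J" unfolding JJ by (intro Bochner_Integration.integrable_sum) auto
  have ind: "(indicator A :: 'a \<Rightarrow> real) \<in> borel_measurable (F t)" using A by simp
  have "(\<integral>\<omega>. indicator A \<omega> * J \<omega> \<partial>M) = (\<integral>\<omega>. (\<Sum>k<n. indicator A \<omega> * \<xi> k \<omega> * (W (\<tau> (Suc k)) \<omega> - W (\<tau> k) \<omega>)) \<partial>M)"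
    unfolding JJ by (simp add: sum_distrib_left mult.assoc)
  also have "\<dots> = (\<Sum>k<n. (\<integral>\<omega>. indicator A \<omega> * \<xi> k \<omega> * (W (\<tau> (Suc k)) \<omega> - W (\<tau> k) \<omega>) \<partial>M))"
    by (rule Bochner_Integration.integral_sum) (use summand[OF _ ind] in \<open>auto simp: indicator_def\<close>)
  also have "\<dots> = 0" using summand[OF _ ind] by (auto simp: indicator_def intro!: sum.neutral)
  finally show "(\<integral>\<omega>. indicator A \<omega> * J \<omega> \<partial>M) = 0" .
qed

text \<open>Mean square convergence of the elementary integrals implies convergence in mean on a
  probability space, and under convergence in mean integrals over a fixed event pass to the
  limit.\<close>

lemma ito_integral_zero:
  assumes I: "has_ito_integral M F W t T Z I" and t: "t \<in> {0..T}"
  shows "integrable M I" "A \<in> sets (F t) \<Longrightarrow> (\<integral>\<omega>. indicator A \<omega> * I \<omega> \<partial>M) = 0"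
proof -
  have [measurable]: "I \<in> borel_measurable M" using I unfolding has_ito_integral_def by blast
  obtain H J where HJ: "\<And>n::nat. simple_ito_integral F W t T (H n) (J n)"
    and lim: "(\<lambda>n. \<integral>\<^sup>+\<omega>. ennreal ((I \<omega> - J n \<omega>)\<^sup>2) \<partial>M) \<longlonglongrightarrow> 0"
    using I unfolding has_ito_integral_def by blast
  have iJ: "integrable M (J n)" for n
    by (rule simple_ito_integral_zero(1)[OF HJ t, of "{}"]) simp
  have approx: "\<exists>n. integrable M (\<lambda>\<omega>. I \<omega> - J n \<omega>) \<and> (\<integral>\<omega>. \<bar>I \<omega> - J n \<omega>\<bar> \<partial>M) \<le> 2 * \<delta>" if \<delta>: "0 < \<delta>" for \<delta> :: real
  proof -
    have "eventually (\<lambda>n. (\<integral>\<^sup>+\<omega>. ennreal ((I \<omega> - J n \<omega>)\<^sup>2) \<partial>M) < ennreal (\<delta>\<^sup>2)) sequentially"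
      using order_tendstoD(2)[OF lim, of "ennreal (\<delta>\<^sup>2)"] \<delta> by simp
    then obtain n where n: "(\<integral>\<^sup>+\<omega>. ennreal ((I \<omega> - J n \<omega>)\<^sup>2) \<partial>M) < ennreal (\<delta>\<^sup>2)"
      unfolding eventually_sequentially by blast
    have [measurable]: "J n \<in> borel_measurable M" using iJ by auto
    have sq: "integrable M (\<lambda>\<omega>. (I \<omega> - J n \<omega>)\<^sup>2)"
      by (rule integrableI_bounded) (use n in \<open>auto simp: less_top[symmetric] intro: order.strict_trans\<close>)
    have "ennreal (\<integral>\<omega>. (I \<omega> - J n \<omega>)\<^sup>2 \<partial>M) < ennreal (\<delta>\<^sup>2)"
      using n by (subst (asm) nn_integral_eq_integral[OF sq]) auto
    then have less: "(\<integral>\<omega>. (I \<omega> - J n \<omega>)\<^sup>2 \<partial>M) < \<delta>\<^sup>2"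
      by (subst (asm) ennreal_less_iff) auto
    \<comment> \<open>This elementary inequality takes the place of Cauchy-Schwarz: a second moment
      below the square of \<open>\<delta>\<close> gives a first absolute moment of at most
      \<open>2 * \<delta>\<close>.\<close>
    have le: "\<bar>x\<bar> \<le> \<delta> + x\<^sup>2 / \<delta>" for x :: real
    proof (cases "\<bar>x\<bar> \<le> \<delta>")
      case True then show ?thesis using \<delta> by (intro order_trans[OF True]) simp
    next
      case False
      then have "\<bar>x\<bar> * \<delta> \<le> \<bar>x\<bar> * \<bar>x\<bar>" by (intro mult_left_mono) auto
      then have "\<bar>x\<bar> \<le> x\<^sup>2 / \<delta>" using \<delta> by (simp add: field_simps power2_eq_square)
      then show ?thesis using \<delta> by linarith
    qed
    have i1: "integrable M (\<lambda>\<omega>. \<delta> + (I \<omega> - J n \<omega>)\<^sup>2 / \<delta>)" using sq by simp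
    have i2: "integrable M (\<lambda>\<omega>. I \<omega> - J n \<omega>)"
    proof (rule Bochner_Integration.integrable_bound[OF i1])
      show "AE \<omega> in M. norm (I \<omega> - J n \<omega>) \<le> norm (\<delta> + (I \<omega> - J n \<omega>)\<^sup>2 / \<delta>)"
        using le \<delta> by (auto intro!: AE_I2 order_trans[OF le] abs_ge_self)
    qed simp
    have "(\<integral>\<omega>. \<bar>I \<omega> - J n \<omega>\<bar> \<partial>M) \<le> (\<integral>\<omega>. \<delta> + (I \<omega> - J n \<omega>)\<^sup>2 / \<delta> \<partial>M)"
      by (rule integral_mono[OF integrable_abs[OF i2] i1 le])
    also have "\<dots> = \<delta> + (\<integral>\<omega>. (I \<omega> - J n \<omega>)\<^sup>2 \<partial>M) / \<delta>" using sq prob_space by simp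
    also have "\<dots> \<le> \<delta> + \<delta>\<^sup>2 / \<delta>" using less \<delta> by (intro add_left_mono divide_right_mono) auto
    also have "\<dots> = 2 * \<delta>" using \<delta> by (simp add: power2_eq_square)
    finally show ?thesis using i2 by blast
  qed
  obtain n where "integrable M (\<lambda>\<omega>. I \<omega> - J n \<omega>)" using approx[of 1] by auto
  from Bochner_Integration.integrable_add[OF this iJ[of n]] show iI: "integrable M I" by simp
  show "(\<integral>\<omega>. indicator A \<omega> * I \<omega> \<partial>M) = 0" if A: "A \<in> sets (F t)"
  proof -
    have A': "A \<in> sets M" using sets_filtration_M[OF t A] .
    have bound: "\<bar>\<integral>\<omega>. indicator A \<omega> * I \<omega> \<partial>M\<bar> \<le> 2 * \<delta>" if \<delta>: "0 < \<delta>" for \<delta>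
    proof -
      obtain n where n: "integrable M (\<lambda>\<omega>. I \<omega> - J n \<omega>)" "(\<integral>\<omega>. \<bar>I \<omega> - J n \<omega>\<bar> \<partial>M) \<le> 2 * \<delta>"
        using approx[OF \<delta>] by blast
      have iA: "integrable M (\<lambda>\<omega>. indicator A \<omega> * I \<omega>)" "integrable M (\<lambda>\<omega>. indicator A \<omega> * J n \<omega>)"
        "integrable M (\<lambda>\<omega>. indicator A \<omega> * (I \<omega> - J n \<omega>))"
        using integrable_mult_indicator[OF A' iI] integrable_mult_indicator[OF A' iJ[of n]] integrable_mult_indicator[OF A' n(1)] by auto
      have "(\<integral>\<omega>. indicator A \<omega> * I \<omega> \<partial>M) = (\<integral>\<omega>. indicator A \<omega> * I \<omega> - indicator A \<omega> * J n \<omega> \<partial>M)"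
        using iA simple_ito_integral_zero(2)[OF HJ t A, of n] by simp
      also have "\<bar>\<dots>\<bar> \<le> (\<integral>\<omega>. \<bar>I \<omega> - J n \<omega>\<bar> \<partial>M)"
        unfolding right_diff_distrib[symmetric]
        by (intro order_trans[OF integral_abs_bound] integral_mono integrable_abs iA n) (auto simp: indicator_def)
      also have "\<dots> \<le> 2 * \<delta>" by (rule n(2))
      finally show ?thesis .
    qed
    have "\<bar>\<integral>\<omega>. indicator A \<omega> * I \<omega> \<partial>M\<bar> \<le> 0"
    proof (rule field_le_epsilon)
      fix e :: real assume "0 < e"
      then show "\<bar>\<integral>\<omega>. indicator A \<omega> * I \<omega> \<partial>M\<bar> \<le> 0 + e" using bound[of "e / 2"] by simp
    qed
    then show ?thesis by simp
  qed
qed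

text \<open>Testing against the two sign events avoids measurability in time of the absolute moment.\<close>
lemma expectation_abs_le_test:
  fixes X :: "'a \<Rightarrow> real"
  assumes t: "t \<in> {0..T}" and X: "X \<in> borel_measurable (F t)" "integrable M X"
    and test: "\<And>A. A \<in> sets (F t) \<Longrightarrow> \<bar>\<integral>\<omega>. indicator A \<omega> * X \<omega> \<partial>M\<bar> \<le> b"
  shows "(\<integral>\<omega>. \<bar>X \<omega>\<bar> \<partial>M) \<le> 2 * b"
proof -
  define A where "A = {\<omega> \<in> space (F t). 0 \<le> X \<omega>}"
  define B where "B = {\<omega> \<in> space (F t). X \<omega> < 0}"
  have "A = X -` {0..} \<inter> space (F t)" "B = X -` {..<0} \<inter> space (F t)" by (auto simp: A_def B_def)
  then have AB: "A \<in> sets (F t)" "B \<in> sets (F t)" using measurable_sets[OF X(1), of "{0..}"] measurable_sets[OF X(1), of "{..<0}"] by simp_all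
  have AB': "A \<in> sets M" "B \<in> sets M" using AB sets_filtration_M[OF t] by auto
  have i: "integrable M (\<lambda>\<omega>. indicator A \<omega> * X \<omega>)" "integrable M (\<lambda>\<omega>. indicator B \<omega> * X \<omega>)"
    using integrable_mult_indicator[OF AB'(1) X(2)] integrable_mult_indicator[OF AB'(2) X(2)] by auto
  have "(\<integral>\<omega>. \<bar>X \<omega>\<bar> \<partial>M) = (\<integral>\<omega>. indicator A \<omega> * X \<omega> - indicator B \<omega> * X \<omega> \<partial>M)"
    by (rule Bochner_Integration.integral_cong)
      (auto simp: A_def B_def indicator_def space_filtration[OF t])
  also have "\<dots> = (\<integral>\<omega>. indicator A \<omega> * X \<omega> \<partial>M) - (\<integral>\<omega>. indicator B \<omega> * X \<omega> \<partial>M)"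
    by (rule Bochner_Integration.integral_diff[OF i])
  also have "\<dots> \<le> 2 * b" using test[OF AB(1)] test[OF AB(2)] by linarith
  finally show ?thesis .
qed

section \<open>The backward equation and the mild formula, integrated over events\<close>

lemma expectation_indicator_le:
  fixes X :: "'a \<Rightarrow> real"
  assumes "\<And>\<omega>. \<bar>X \<omega>\<bar> \<le> c" "integrable M X" "A \<in> sets M"
  shows "\<bar>\<integral>\<omega>. indicator A \<omega> * X \<omega> \<partial>M\<bar> \<le> c"
proof -
  have i: "integrable M (\<lambda>\<omega>. indicator A \<omega> * X \<omega>)" using integrable_mult_indicator[OF assms(3,2)] by simp
  have "\<bar>\<integral>\<omega>. indicator A \<omega> * X \<omega> \<partial>M\<bar> \<le> (\<integral>\<omega>. \<bar>indicator A \<omega> * X \<omega>\<bar> \<partial>M)" by (rule integral_abs_bound)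
  also have "\<dots> \<le> (\<integral>\<omega>. c \<partial>M)"
  proof (rule integral_mono[OF integrable_abs[OF i]])
    show "\<bar>indicator A \<omega> * X \<omega>\<bar> \<le> c" for \<omega> using assms(1)[of \<omega>] by (auto simp: indicator_def)
  qed simp
  finally show ?thesis using prob_space by simp
qed

lemma time_fubini:
  fixes h :: "real \<Rightarrow> 'a \<Rightarrow> real"
  assumes h: "(\<lambda>(s, \<omega>). h s \<omega>) \<in> borel_measurable (borel \<Otimes>\<^sub>M M)"
    and b: "\<And>s \<omega>. s \<in> {t..T} \<Longrightarrow> \<omega> \<in> space M \<Longrightarrow> \<bar>h s \<omega>\<bar> \<le> B"
  shows "(\<lambda>\<omega>. LINT s:{t..T}|lborel. h s \<omega>) \<in> borel_measurable M"
    and "set_integrable lborel {t..T} (\<lambda>s. \<integral>\<omega>. h s \<omega> \<partial>M)"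
    and "integrable M (\<lambda>\<omega>. LINT s:{t..T}|lborel. h s \<omega>)"
    and "(\<integral>\<omega>. (LINT s:{t..T}|lborel. h s \<omega>) \<partial>M) = (LINT s:{t..T}|lborel. \<integral>\<omega>. h s \<omega> \<partial>M)"
proof -
  interpret LM: pair_sigma_finite lborel M ..
  define k where "k s \<omega> = indicator {t..T} s * h s \<omega>" for s \<omega>
  have km: "(\<lambda>(s, \<omega>). k s \<omega>) \<in> borel_measurable (lborel \<Otimes>\<^sub>M M)"
    unfolding k_def using h by (simp add: split_beta' cong: measurable_cong_sets)
  have int: "integrable (lborel \<Otimes>\<^sub>M M) (\<lambda>(s, \<omega>). k s \<omega>)"
  proof (rule integrableI_bounded_set[where A = "{t..T} \<times> space M" and B = B])
    show "{t..T} \<times> space M \<in> sets (lborel \<Otimes>\<^sub>M M)" by auto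
    show "(\<lambda>(s, \<omega>). k s \<omega>) \<in> borel_measurable (lborel \<Otimes>\<^sub>M M)" by (rule km)
    have "emeasure (lborel \<Otimes>\<^sub>M M) ({t..T} \<times> space M) = emeasure lborel {t..T} * emeasure M (space M)"
      by (rule emeasure_pair_measure_Times) auto
    then show "emeasure (lborel \<Otimes>\<^sub>M M) ({t..T} \<times> space M) < \<infinity>"
      by (simp add: emeasure_space_1 emeasure_lborel_Icc_eq)
    show "AE x\<in>{t..T} \<times> space M in lborel \<Otimes>\<^sub>M M. norm (case x of (s, \<omega>) \<Rightarrow> k s \<omega>) \<le> B"
      by (rule AE_I2) (use b in \<open>auto simp: k_def\<close>)
    show "AE x in lborel \<Otimes>\<^sub>M M. x \<notin> {t..T} \<times> space M \<longrightarrow> (case x of (s, \<omega>) \<Rightarrow> k s \<omega>) = 0"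
      by (rule AE_I2) (auto simp: k_def space_pair_measure indicator_def split: if_splits)
  qed
  have e1: "(\<integral>s. k s \<omega> \<partial>lborel) = (LINT s:{t..T}|lborel. h s \<omega>)" for \<omega>
    unfolding k_def set_lebesgue_integral_def by simp
  have e2: "(\<integral>\<omega>. k s \<omega> \<partial>M) = indicator {t..T} s * (\<integral>\<omega>. h s \<omega> \<partial>M)" for s
    unfolding k_def by simp
  show I: "integrable M (\<lambda>\<omega>. LINT s:{t..T}|lborel. h s \<omega>)"
    using LM.integrable_snd[OF int] unfolding e1 .
  show "(\<lambda>\<omega>. LINT s:{t..T}|lborel. h s \<omega>) \<in> borel_measurable M" using I by auto
  show "set_integrable lborel {t..T} (\<lambda>s. \<integral>\<omega>. h s \<omega> \<partial>M)"
    using LM.integrable_fst[OF int] unfolding e2 set_integrable_def by simp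
  show "(\<integral>\<omega>. (LINT s:{t..T}|lborel. h s \<omega>) \<partial>M) = (LINT s:{t..T}|lborel. \<integral>\<omega>. h s \<omega> \<partial>M)"
    using LM.Fubini_integral[OF int] unfolding e1 e2 by (simp add: set_lebesgue_integral_def)
qed

text \<open>Joint measurability of \<open>Y\<close> is given only for times in
  \<open>{0..T}\<close>. Clamping time to that interval extends the driver measurably to the whole
  line and changes nothing inside.\<close>

lemma driver_measurable:
  assumes T: "0 < T" and f: "strip_bc T f"
    and Y: "(\<lambda>(t, \<omega>). Y t \<omega>) \<in> borel_measurable (restrict_space borel {0..T} \<Otimes>\<^sub>M M)"
  shows "(\<lambda>(s, \<omega>). f (max 0 (min T s)) (Y (max 0 (min T s)) \<omega>)) \<in> borel_measurable (borel \<Otimes>\<^sub>M M)"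
proof -
  let ?c = "\<lambda>s. max 0 (min T s)"
  have c: "?c s \<in> {0..T}" for s using T by auto
  have c1: "?c \<in> measurable borel (restrict_space borel {0..T})"
    by (rule measurable_restrict_space2) (use c in auto)
  have "(\<lambda>p. (?c (fst p), snd p)) \<in> measurable (borel \<Otimes>\<^sub>M M) (restrict_space borel {0..T} \<Otimes>\<^sub>M M)"
    by (intro measurable_Pair measurable_compose[OF measurable_fst c1] measurable_snd)
  from measurable_compose[OF this Y]
  have Ym: "(\<lambda>p. Y (?c (fst p)) (snd p)) \<in> borel_measurable (borel \<Otimes>\<^sub>M M)" by simp
  have "continuous_on UNIV (\<lambda>q. f (?c (fst q)) (snd q))"
    by (rule strip_bc_comp[OF f]) (use c in \<open>auto intro!: continuous_intros\<close>)
  then have fm: "(\<lambda>q. f (?c (fst q)) (snd q)) \<in> borel_measurable borel"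
    by (rule borel_measurable_continuous_onI)
  have "(\<lambda>p. (fst p, Y (?c (fst p)) (snd p))) \<in> measurable (borel \<Otimes>\<^sub>M M) borel"
    unfolding borel_prod[symmetric] by (intro measurable_Pair measurable_fst Ym)
  from measurable_compose[OF this fm] show ?thesis by (simp add: split_beta')
qed

lemma indicator_snd_measurable:
  assumes "A \<in> sets M" "(\<lambda>(s, \<omega>). h s \<omega>) \<in> borel_measurable (borel \<Otimes>\<^sub>M M)"
  shows "(\<lambda>(s, \<omega>). indicator A \<omega> * h s \<omega> :: real) \<in> borel_measurable (borel \<Otimes>\<^sub>M M)"
proof -
  have "(\<lambda>p. indicator A (snd p) :: real) \<in> borel_measurable (borel \<Otimes>\<^sub>M M)"
    by (rule measurable_compose[OF measurable_snd borel_measurable_indicator[OF assms(1)]])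
  from borel_measurable_times[OF this assms(2)] show ?thesis by (simp add: split_beta')
qed

text \<open>Integration over an event of \<open>F t\<close> removes the stochastic integral and the
  exceptional null sets. These identities carry all that is used about \<open>Y\<close> from here
  on.\<close>

lemma bsde_test:
  assumes T: "0 < T" and f: "strip_bc T f" and g: "bc g"
    and sol: "bsde_solution M F T W f g Y Z" and t: "t \<in> {0..T}"
  shows "integrable M (Y t)" "Y t \<in> borel_measurable (F t)"
    and "A \<in> sets (F t) \<Longrightarrow> set_integrable lborel {t..T} (\<lambda>s. \<integral>\<omega>. indicator A \<omega> * f s (Y s \<omega>) \<partial>M)"
    and "A \<in> sets (F t) \<Longrightarrow> (\<integral>\<omega>. indicator A \<omega> * Y t \<omega> \<partial>M) = (\<integral>\<omega>. indicator A \<omega> * g (W T \<omega>) \<partial>M)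
      + (LINT s:{t..T}|lborel. \<integral>\<omega>. indicator A \<omega> * f s (Y s \<omega>) \<partial>M)"
proof -
  let ?c = "\<lambda>s. max 0 (min T s)"
  let ?h = "\<lambda>s \<omega>. f (?c s) (Y (?c s) \<omega>)"
  have cs: "?c s = s" if "s \<in> {t..T}" for s using that t by auto
  have Yj: "(\<lambda>(t, \<omega>). Y t \<omega>) \<in> borel_measurable (restrict_space borel {0..T} \<Otimes>\<^sub>M M)"
    using sol unfolding bsde_solution_def by blast
  show Yt: "Y t \<in> borel_measurable (F t)" using sol t unfolding bsde_solution_def by blast
  obtain I where I: "has_ito_integral M F W t T Z I"
    and Yeq: "AE \<omega> in M. Y t \<omega> = g (W T \<omega>) + (LINT s:{t..T}|lborel. f s (Y s \<omega>)) - I \<omega>"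
    using sol t unfolding bsde_solution_def by blast
  note hm = driver_measurable[OF T f Yj]
  obtain C where C: "\<And>t x. t \<in> {0..T} \<Longrightarrow> \<bar>f t x\<bar> \<le> C" using strip_bc_bound[OF f] by blast
  have cT: "?c s \<in> {0..T}" for s using T by auto
  have C0: "0 \<le> C" using C[OF t, of 0] by linarith
  have h1: "(LINT s:{t..T}|lborel. ?h s \<omega>) = (LINT s:{t..T}|lborel. f s (Y s \<omega>))" for \<omega>
    by (rule set_lebesgue_integral_cong) (use cs in auto)
  have ih: "integrable M (\<lambda>\<omega>. LINT s:{t..T}|lborel. f s (Y s \<omega>))"
    using time_fubini(3)[OF hm, of t C] C cT unfolding h1 by auto
  have ig: "integrable M (\<lambda>\<omega>. g (W T \<omega>))" by (rule integrable_bc_brownian[OF _ g]) (use T in auto)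
  note iI = ito_integral_zero[OF I t]
  have irhs: "integrable M (\<lambda>\<omega>. g (W T \<omega>) + (LINT s:{t..T}|lborel. f s (Y s \<omega>)) - I \<omega>)"
    using ig ih iI(1) by simp
  have YM: "Y t \<in> borel_measurable M" using filtration_borel_M[OF t Yt] .
  show iY: "integrable M (Y t)"
    by (rule Bochner_Integration.integrable_cong_AE_imp[OF irhs YM]) (use Yeq in auto)
  assume A: "A \<in> sets (F t)"
  have A': "A \<in> sets M" using sets_filtration_M[OF t A] .
  have bA: "\<bar>indicator A \<omega> * ?h s \<omega>\<bar> \<le> C" for s \<omega>
    using C[OF cT, of s "Y (?c s) \<omega>"] C0 by (auto simp: indicator_def)
  note fub = time_fubini[OF indicator_snd_measurable[OF A' hm], of t C, OF bA]
  have si: "set_integrable lborel {t..T} (\<lambda>s. \<integral>\<omega>. indicator A \<omega> * ?h s \<omega> \<partial>M)" by (rule fub(2))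
  show "set_integrable lborel {t..T} (\<lambda>s. \<integral>\<omega>. indicator A \<omega> * f s (Y s \<omega>) \<partial>M)"
    using si by (subst set_integrable_cong[OF refl refl, where f' = "\<lambda>s. \<integral>\<omega>. indicator A \<omega> * ?h s \<omega> \<partial>M"]) (use cs in auto)
  have iA: "integrable M (\<lambda>\<omega>. indicator A \<omega> * g (W T \<omega>))"
    "integrable M (\<lambda>\<omega>. indicator A \<omega> * (LINT s:{t..T}|lborel. f s (Y s \<omega>)))"
    "integrable M (\<lambda>\<omega>. indicator A \<omega> * I \<omega>)"
    using integrable_mult_indicator[OF A' ig] integrable_mult_indicator[OF A' ih] integrable_mult_indicator[OF A' iI(1)] by auto
  have "(\<integral>\<omega>. indicator A \<omega> * Y t \<omega> \<partial>M)
      = (\<integral>\<omega>. indicator A \<omega> * g (W T \<omega>) + indicator A \<omega> * (LINT s:{t..T}|lborel. f s (Y s \<omega>)) - indicator A \<omega> * I \<omega> \<partial>M)"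
  proof (rule integral_cong_AE)
    show "AE \<omega> in M. indicator A \<omega> * Y t \<omega> = indicator A \<omega> * g (W T \<omega>) + indicator A \<omega> * (LINT s:{t..T}|lborel. f s (Y s \<omega>)) - indicator A \<omega> * I \<omega>"
      using Yeq by eventually_elim (simp only: distrib_left right_diff_distrib)
  qed (use YM A' iA in auto)
  also have "\<dots> = (\<integral>\<omega>. indicator A \<omega> * g (W T \<omega>) \<partial>M) + (\<integral>\<omega>. indicator A \<omega> * (LINT s:{t..T}|lborel. f s (Y s \<omega>)) \<partial>M)"
    using iA iI(2)[OF A] by simp
  also have "(\<integral>\<omega>. indicator A \<omega> * (LINT s:{t..T}|lborel. f s (Y s \<omega>)) \<partial>M) = (\<integral>\<omega>. (LINT s:{t..T}|lborel. indicator A \<omega> * ?h s \<omega>) \<partial>M)"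
    by (simp add: h1)
  also have "\<dots> = (LINT s:{t..T}|lborel. \<integral>\<omega>. indicator A \<omega> * ?h s \<omega> \<partial>M)"
    by (rule fub(4))
  also have "\<dots> = (LINT s:{t..T}|lborel. \<integral>\<omega>. indicator A \<omega> * f s (Y s \<omega>) \<partial>M)"
    by (rule set_lebesgue_integral_cong) (use cs in auto)
  finally show "(\<integral>\<omega>. indicator A \<omega> * Y t \<omega> \<partial>M) = (\<integral>\<omega>. indicator A \<omega> * g (W T \<omega>) \<partial>M)
      + (LINT s:{t..T}|lborel. \<integral>\<omega>. indicator A \<omega> * f s (Y s \<omega>) \<partial>M)" .
qed

text \<open>By the Markov property, the mild function evaluated along \<open>W\<close> satisfies the
  same integrated equation as \<open>Y\<close>, with \<open>G\<close> in place of the driver. The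
  terminal terms then cancel in a difference.\<close>

lemma mild_test:
  assumes T: "0 < T" and G: "strip_bc T G" and g: "bc g" and t: "t \<in> {0..T}" and A: "A \<in> sets (F t)"
  shows "set_integrable lborel {t..T} (\<lambda>s. \<integral>\<omega>. indicator A \<omega> * G s (W s \<omega>) \<partial>M)"
    and "(\<integral>\<omega>. indicator A \<omega> * mild T g G t (W t \<omega>) \<partial>M) = (\<integral>\<omega>. indicator A \<omega> * g (W T \<omega>) \<partial>M)
      + (LINT s:{t..T}|lborel. \<integral>\<omega>. indicator A \<omega> * G s (W s \<omega>) \<partial>M)"
proof -
  let ?c = "\<lambda>s. max 0 (min T s)"
  let ?h = "\<lambda>s \<omega>. heat (s - t) (G (?c s)) (W t \<omega>)"
  have cs: "?c s = s" if "s \<in> {t..T}" for s using that t by auto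
  have cT: "?c s \<in> {0..T}" for s using T by auto
  obtain C where C: "\<And>t x. t \<in> {0..T} \<Longrightarrow> \<bar>G t x\<bar> \<le> C" using strip_bc_bound[OF G] by blast
  have C0: "0 \<le> C" using C[OF t, of 0] by linarith
  have A': "A \<in> sets M" using sets_filtration_M[OF t A] .
  have Wt: "W t \<in> borel_measurable M" using filtration_borel_M[OF t brownian_adapted[OF t]] .
  have hb: "\<bar>heat \<tau> (G s) x\<bar> \<le> C" if "s \<in> {0..T}" for \<tau> s x
    by (rule heat_bound[OF strip_bc_slice[OF G that] C[OF that]])
  have "continuous_on UNIV (\<lambda>q. heat (fst q - t) (G (?c (fst q))) (snd q))"
    by (rule continuous_on_strip_heat[OF G]) (use cT in \<open>auto intro!: continuous_intros\<close>)
  then have fm: "(\<lambda>q. heat (fst q - t) (G (?c (fst q))) (snd q)) \<in> borel_measurable borel"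
    by (rule borel_measurable_continuous_onI)
  have "(\<lambda>p. (fst p :: real, W t (snd p))) \<in> measurable (borel \<Otimes>\<^sub>M M) borel"
    unfolding borel_prod[symmetric] by (intro measurable_Pair measurable_fst measurable_compose[OF measurable_snd Wt])
  from measurable_compose[OF this fm] have hm: "(\<lambda>(s, \<omega>). ?h s \<omega>) \<in> borel_measurable (borel \<Otimes>\<^sub>M M)"
    by (simp add: split_beta')
  have bA: "\<bar>indicator A \<omega> * ?h s \<omega>\<bar> \<le> C" for s \<omega>
    using hb[OF cT] C0 by (auto simp: indicator_def)
  note fub = time_fubini[OF indicator_snd_measurable[OF A' hm], of t C, OF bA]
  have h2: "(\<integral>\<omega>. indicator A \<omega> * ?h s \<omega> \<partial>M) = (\<integral>\<omega>. indicator A \<omega> * G s (W s \<omega>) \<partial>M)" if s: "s \<in> {t..T}" for s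
    unfolding cs[OF s] by (rule markov_integral[OF _ _ _ A strip_bc_imp_bc[OF G], symmetric]) (use s t in auto)
  have si: "set_integrable lborel {t..T} (\<lambda>s. \<integral>\<omega>. indicator A \<omega> * ?h s \<omega> \<partial>M)" by (rule fub(2))
  show "set_integrable lborel {t..T} (\<lambda>s. \<integral>\<omega>. indicator A \<omega> * G s (W s \<omega>) \<partial>M)"
    using si by (subst set_integrable_cong[OF refl refl, where f' = "\<lambda>s. \<integral>\<omega>. indicator A \<omega> * ?h s \<omega> \<partial>M"]) (use h2 in auto)
  have 1: "integral {t..T} (\<lambda>s. heat (s - t) (G s) x) = (LINT s:{t..T}|lborel. heat (s - t) (G (?c s)) x)" for x
  proof -
    have c: "continuous_on {t..T} (\<lambda>s. heat (s - t) (G s) x)"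
      by (rule continuous_on_strip_heat[OF G]) (use t in \<open>auto intro!: continuous_intros\<close>)
    have "set_integrable lborel {t..T} (\<lambda>s. heat (s - t) (G s) x)"
      unfolding set_integrable_def by (rule borel_integrable_compact[OF _ c]) simp
    then have "integral {t..T} (\<lambda>s. heat (s - t) (G s) x) = (LINT s:{t..T}|lborel. heat (s - t) (G s) x)"
      by (simp add: set_borel_integral_eq_integral)
    also have "\<dots> = (LINT s:{t..T}|lborel. heat (s - t) (G (?c s)) x)"
      by (rule set_lebesgue_integral_cong) (use cs in auto)
    finally show ?thesis .
  qed
  have iT: "integrable M (\<lambda>\<omega>. indicator A \<omega> * heat (T - t) g (W t \<omega>))"
    using integrable_mult_indicator[OF A' integrable_bc_brownian[OF t bc_heat[OF g]]] by simp
  have "(\<integral>\<omega>. indicator A \<omega> * mild T g G t (W t \<omega>) \<partial>M)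
      = (\<integral>\<omega>. indicator A \<omega> * heat (T - t) g (W t \<omega>) + (LINT s:{t..T}|lborel. indicator A \<omega> * ?h s \<omega>) \<partial>M)"
    unfolding mild_def 1 by (simp add: distrib_left)
  also have "\<dots> = (\<integral>\<omega>. indicator A \<omega> * heat (T - t) g (W t \<omega>) \<partial>M) + (\<integral>\<omega>. (LINT s:{t..T}|lborel. indicator A \<omega> * ?h s \<omega>) \<partial>M)"
    by (rule Bochner_Integration.integral_add[OF iT fub(3)])
  also have "(\<integral>\<omega>. indicator A \<omega> * heat (T - t) g (W t \<omega>) \<partial>M) = (\<integral>\<omega>. indicator A \<omega> * g (W T \<omega>) \<partial>M)"
    by (rule markov_integral[OF _ _ _ A g, symmetric]) (use t in auto)
  also have "(\<integral>\<omega>. (LINT s:{t..T}|lborel. indicator A \<omega> * ?h s \<omega>) \<partial>M) = (LINT s:{t..T}|lborel. \<integral>\<omega>. indicator A \<omega> * ?h s \<omega> \<partial>M)"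
    by (rule fub(4))
  also have "\<dots> = (LINT s:{t..T}|lborel. \<integral>\<omega>. indicator A \<omega> * G s (W s \<omega>) \<partial>M)"
    by (rule set_lebesgue_integral_cong) (use h2 in auto)
  finally show "(\<integral>\<omega>. indicator A \<omega> * mild T g G t (W t \<omega>) \<partial>M) = (\<integral>\<omega>. indicator A \<omega> * g (W T \<omega>) \<partial>M)
      + (LINT s:{t..T}|lborel. \<integral>\<omega>. indicator A \<omega> * G s (W s \<omega>) \<partial>M)" .
qed

text \<open>A contraction argument in the weight \<open>exp (\<beta> * (T - t))\<close>: subtracting
  the two integrated equations leaves the difference of the drivers, which is at most
  \<open>L\<close> times the previous error.\<close>

lemma picard_converges:
  assumes T: "0 < T" and f: "strip_bc T f" and g: "bc g" and L: "\<And>t y y'. t \<in> {0..T} \<Longrightarrow> \<bar>f t y - f t y'\<bar> \<le> L * \<bar>y - y'\<bar>"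
    and sol: "bsde_solution M F T W f g Y Z"
  shows "\<exists>R \<beta>. \<forall>n. \<forall>t\<in>{0..T}. (\<integral>\<omega>. \<bar>Y t \<omega> - picard T f g n t (W t \<omega>)\<bar> \<partial>M) \<le> R * (1 / 2) ^ n * exp (\<beta> * (T - t))"
proof -
  let ?u = "picard T f g"
  have u: "family_bc T ?u" by (rule picard_bc[OF f g])
  obtain C where C: "\<And>t x. t \<in> {0..T} \<Longrightarrow> \<bar>f t x\<bar> \<le> C" using strip_bc_bound[OF f] by blast
  obtain B where B: "continuous_on UNIV g" "\<And>y. \<bar>g y\<bar> \<le> B" using bcE[OF g] by blast
  have T0: "0 \<in> {0..T}" "T \<in> {0..T}" using T by auto
  have C0: "0 \<le> C" using C[OF T0(1), of 0] by linarith
  have L0: "0 \<le> L" using L[OF T0(1), of 1 0] by simp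
  \<comment> \<open>Testing on the two sign events costs a factor 2, and the error is to be halved
    in each round, so \<open>2 * L / \<beta> \<le> 1 / 2\<close> is required.\<close>
  define \<beta> where "\<beta> = 4 * L + 1"
  have \<beta>: "0 < \<beta>" "4 * L \<le> \<beta>" using L0 by (auto simp: \<beta>_def)
  \<comment> \<open>A bound on the mean of the absolute value of \<open>Y t\<close>, the error of
    iterate 0; the 2 again comes from the two sign events.\<close>
  define R where "R = 2 * (B + T * C)"
  have B0: "0 \<le> B" using B(2)[of 0] by linarith
  have R0: "0 \<le> R" using B0 C0 T by (simp add: R_def)
  have YM: "integrable M (Y t)" "Y t \<in> borel_measurable (F t)" if "t \<in> {0..T}" for t
    using bsde_test(1,2)[OF T f g sol that] by auto
  have uM: "integrable M (\<lambda>\<omega>. ?u n t (W t \<omega>))" "(\<lambda>\<omega>. ?u n t (W t \<omega>)) \<in> borel_measurable (F t)" if "t \<in> {0..T}" for n t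
    using integrable_bc_brownian[OF that family_bc_slice[OF u that]] brownian_comp_measurable[OF that family_bc_slice[OF u that]] by auto
  have main: "\<forall>t\<in>{0..T}. (\<integral>\<omega>. \<bar>Y t \<omega> - ?u n t (W t \<omega>)\<bar> \<partial>M) \<le> R * (1 / 2) ^ n * exp (\<beta> * (T - t))" for n
  proof (induction n)
    case 0
    show ?case
    proof
      fix t assume t: "t \<in> {0..T}"
      have "(\<integral>\<omega>. \<bar>Y t \<omega>\<bar> \<partial>M) \<le> 2 * (B + T * C)"
      proof (rule expectation_abs_le_test[OF t YM(2,1)[OF t]])
        fix A assume A: "A \<in> sets (F t)"
        have A': "A \<in> sets M" using sets_filtration_M[OF t A] .
        have "\<bar>\<integral>\<omega>. indicator A \<omega> * g (W T \<omega>) \<partial>M\<bar> \<le> B"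
          by (rule expectation_indicator_le[OF B(2) integrable_bc_brownian[OF T0(2) g] A'])
        moreover have "\<bar>LINT s:{t..T}|lborel. \<integral>\<omega>. indicator A \<omega> * f s (Y s \<omega>) \<partial>M\<bar> \<le> T * C"
        proof -
          have si: "set_integrable lborel {t..T} (\<lambda>s. \<integral>\<omega>. indicator A \<omega> * f s (Y s \<omega>) \<partial>M)"
            by (rule bsde_test(3)[OF T f g sol t A])
          have ib: "set_integrable lborel {t..T} (\<lambda>s. C)"
            unfolding set_integrable_def by (rule borel_integrable_compact) auto
          have "\<bar>LINT s:{t..T}|lborel. \<integral>\<omega>. indicator A \<omega> * f s (Y s \<omega>) \<partial>M\<bar>
              \<le> (LINT s:{t..T}|lborel. \<bar>\<integral>\<omega>. indicator A \<omega> * f s (Y s \<omega>) \<partial>M\<bar>)"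
            using set_integral_norm_bound[OF si] by simp
          also have "\<dots> \<le> (LINT s:{t..T}|lborel. C)"
          proof (rule set_integral_mono[OF set_integrable_abs[OF si] ib])
            fix s assume s: "s \<in> {t..T}"
            then have sT: "s \<in> {0..T}" using t by auto
            have "integrable M (\<lambda>\<omega>. f s (Y s \<omega>))"
              by (rule integrable_bc_comp[OF strip_bc_imp_bc[OF f sT] YM(1)[OF sT]])
            then show "\<bar>\<integral>\<omega>. indicator A \<omega> * f s (Y s \<omega>) \<partial>M\<bar> \<le> C"
              by (intro expectation_indicator_le A') (use C sT in auto)
          qed
          also have "\<dots> = (T - t) * C" using t by (simp add: set_lebesgue_integral_def)
          also have "\<dots> \<le> T * C" using t C0 by (intro mult_right_mono) auto
          finally show ?thesis .
        qed
        ultimately show "\<bar>\<integral>\<omega>. indicator A \<omega> * Y t \<omega> \<partial>M\<bar> \<le> B + T * C"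
          unfolding bsde_test(4)[OF T f g sol t A] by linarith
      qed
      also have "\<dots> \<le> R * exp (\<beta> * (T - t))"
      proof -
        have "1 \<le> exp (\<beta> * (T - t))" using \<beta> t by simp
        from mult_left_mono[OF this R0] show ?thesis by (simp add: R_def)
      qed
      finally show "(\<integral>\<omega>. \<bar>Y t \<omega> - ?u 0 t (W t \<omega>)\<bar> \<partial>M) \<le> R * (1 / 2) ^ 0 * exp (\<beta> * (T - t))" by simp
    qed
  next
    case (Suc n)
    define K where "K = R * (1 / 2) ^ n"
    have K0: "0 \<le> K" using R0 by (simp add: K_def)
    define G where "G = (\<lambda>t x. f t (?u n t x))"
    have G: "strip_bc T G" unfolding G_def by (rule strip_bc_compose[OF f family_bc_strip[OF u]])
    show ?case
    proof
      fix t assume t: "t \<in> {0..T}"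
      have uS: "?u (Suc n) t (W t \<omega>) = mild T g G t (W t \<omega>)" for \<omega> by (simp add: G_def)
      have "(\<integral>\<omega>. \<bar>Y t \<omega> - ?u (Suc n) t (W t \<omega>)\<bar> \<partial>M) \<le> 2 * (L * K * ((exp (\<beta> * (T - t)) - 1) / \<beta>))"
      proof (rule expectation_abs_le_test[OF t])
        show "(\<lambda>\<omega>. Y t \<omega> - ?u (Suc n) t (W t \<omega>)) \<in> borel_measurable (F t)" using YM(2)[OF t] uM(2)[OF t] by (rule borel_measurable_diff)
        show "integrable M (\<lambda>\<omega>. Y t \<omega> - ?u (Suc n) t (W t \<omega>))" using YM(1)[OF t] uM(1)[OF t] by (rule Bochner_Integration.integrable_diff)
        fix A assume A: "A \<in> sets (F t)"
        have A': "A \<in> sets M" using sets_filtration_M[OF t A] .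
        let ?a = "\<lambda>s. \<integral>\<omega>. indicator A \<omega> * f s (Y s \<omega>) \<partial>M" and ?b = "\<lambda>s. \<integral>\<omega>. indicator A \<omega> * G s (W s \<omega>) \<partial>M"
        note ab = bsde_test(3)[OF T f g sol t A] mild_test(1)[OF T G g t A]
        have "(\<integral>\<omega>. indicator A \<omega> * (Y t \<omega> - ?u (Suc n) t (W t \<omega>)) \<partial>M)
            = (\<integral>\<omega>. indicator A \<omega> * Y t \<omega> \<partial>M) - (\<integral>\<omega>. indicator A \<omega> * mild T g G t (W t \<omega>) \<partial>M)"
          unfolding uS right_diff_distrib
          by (rule Bochner_Integration.integral_diff)
            (use integrable_mult_indicator[OF A' YM(1)[OF t]] integrable_mult_indicator[OF A' uM(1)[OF t, of "Suc n"]] in \<open>auto simp: G_def\<close>)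
        also have "\<dots> = (LINT s:{t..T}|lborel. ?a s - ?b s)"
          unfolding bsde_test(4)[OF T f g sol t A] mild_test(2)[OF T G g t A] using set_integral_diff(2)[OF ab] by simp
        finally have e: "(\<integral>\<omega>. indicator A \<omega> * (Y t \<omega> - ?u (Suc n) t (W t \<omega>)) \<partial>M) = (LINT s:{t..T}|lborel. ?a s - ?b s)" .
        let ?w = "\<lambda>s. L * K * exp (\<beta> * (T - s))"
        have wc: "continuous_on {t..T} ?w" by (intro continuous_intros)
        have wi: "set_integrable lborel {t..T} ?w"
          unfolding set_integrable_def by (rule borel_integrable_compact[OF _ wc]) simp
        have "\<bar>LINT s:{t..T}|lborel. ?a s - ?b s\<bar> \<le> (LINT s:{t..T}|lborel. \<bar>?a s - ?b s\<bar>)"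
          using set_integral_norm_bound[OF set_integral_diff(1)[OF ab]] by simp
        \<comment> \<open>The induction hypothesis is inserted for each fixed \<open>s\<close>, so
          only the explicit continuous weight has to be integrated in time.\<close>
        also have "\<dots> \<le> (LINT s:{t..T}|lborel. ?w s)"
        proof (rule set_integral_mono[OF set_integrable_abs[OF set_integral_diff(1)[OF ab]] wi])
          fix s assume s: "s \<in> {t..T}"
          then have sT: "s \<in> {0..T}" using t by auto
          have i1: "integrable M (\<lambda>\<omega>. f s (Y s \<omega>))"
            by (rule integrable_bc_comp[OF strip_bc_imp_bc[OF f sT] YM(1)[OF sT]])
          have i2: "integrable M (\<lambda>\<omega>. G s (W s \<omega>))" by (rule integrable_bc_brownian[OF sT strip_bc_imp_bc[OF G sT]])
          have i3: "integrable M (\<lambda>\<omega>. \<bar>Y s \<omega> - ?u n s (W s \<omega>)\<bar>)"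
            using YM(1)[OF sT] uM(1)[OF sT] by (intro integrable_abs Bochner_Integration.integrable_diff)
          have iA: "integrable M (\<lambda>\<omega>. indicator A \<omega> * f s (Y s \<omega>))" "integrable M (\<lambda>\<omega>. indicator A \<omega> * G s (W s \<omega>))"
            using integrable_mult_indicator[OF A' i1] integrable_mult_indicator[OF A' i2] by auto
          have "\<bar>?a s - ?b s\<bar> = \<bar>\<integral>\<omega>. indicator A \<omega> * f s (Y s \<omega>) - indicator A \<omega> * G s (W s \<omega>) \<partial>M\<bar>"
            using Bochner_Integration.integral_diff[OF iA] by simp
          also have "\<dots> \<le> (\<integral>\<omega>. \<bar>indicator A \<omega> * f s (Y s \<omega>) - indicator A \<omega> * G s (W s \<omega>)\<bar> \<partial>M)"
            by (rule integral_abs_bound)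
          also have "\<dots> \<le> (\<integral>\<omega>. L * \<bar>Y s \<omega> - ?u n s (W s \<omega>)\<bar> \<partial>M)"
          proof (rule integral_mono)
            show "\<bar>indicator A \<omega> * f s (Y s \<omega>) - indicator A \<omega> * G s (W s \<omega>)\<bar> \<le> L * \<bar>Y s \<omega> - ?u n s (W s \<omega>)\<bar>" for \<omega>
              using L[OF sT, of "Y s \<omega>" "?u n s (W s \<omega>)"] L0 by (auto simp: indicator_def G_def)
          qed (use iA i3 in auto)
          also have "\<dots> = L * (\<integral>\<omega>. \<bar>Y s \<omega> - ?u n s (W s \<omega>)\<bar> \<partial>M)" by simp
          also have "\<dots> \<le> L * (K * exp (\<beta> * (T - s)))"
            using Suc sT L0 unfolding K_def by (intro mult_left_mono) auto
          finally show "\<bar>?a s - ?b s\<bar> \<le> ?w s" by simp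
        qed
        also have "\<dots> = integral {t..T} ?w" by (rule set_borel_integral_eq_integral(2)[OF wi])
        also have "\<dots> = L * K * ((exp (\<beta> * (T - t)) - 1) / \<beta>)"
          using has_integral_mult_right[OF has_integral_exp_weight[OF \<beta>(1), of t T], of "L * K"] t by (intro integral_unique) auto
        finally show "\<bar>\<integral>\<omega>. indicator A \<omega> * (Y t \<omega> - ?u (Suc n) t (W t \<omega>)) \<partial>M\<bar> \<le> L * K * ((exp (\<beta> * (T - t)) - 1) / \<beta>)"
          unfolding e .
      qed
      also have "\<dots> \<le> K / 2 * exp (\<beta> * (T - t))"
      proof -
        have e1: "1 \<le> exp (\<beta> * (T - t))" using \<beta> t by simp
        have "2 * L / \<beta> \<le> 1 / 2" using \<beta> by (simp add: field_simps)
        then have "(2 * L / \<beta>) * (K * (exp (\<beta> * (T - t)) - 1)) \<le> (1 / 2) * (K * (exp (\<beta> * (T - t)) - 1))"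
          using K0 e1 by (intro mult_right_mono) auto
        also have "\<dots> \<le> K / 2 * exp (\<beta> * (T - t))" using K0 by (simp add: algebra_simps)
        finally have "(2 * L / \<beta>) * (K * (exp (\<beta> * (T - t)) - 1)) \<le> K / 2 * exp (\<beta> * (T - t))" .
        moreover have "2 * (L * K * ((exp (\<beta> * (T - t)) - 1) / \<beta>)) = (2 * L / \<beta>) * (K * (exp (\<beta> * (T - t)) - 1))" by simp
        ultimately show ?thesis by linarith
      qed
      finally show "(\<integral>\<omega>. \<bar>Y t \<omega> - ?u (Suc n) t (W t \<omega>)\<bar> \<partial>M) \<le> R * (1 / 2) ^ Suc n * exp (\<beta> * (T - t))"
        by (simp add: K_def)
    qed
  qed
  then show ?thesis by blast
qed

end

section \<open>Stability and convergence of the scheme\<close>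

text \<open>The scheme is implicit: the term \<open>j = 0\<close> of the sum is \<open>a i\<close>
  itself and is moved to the left, which needs \<open>b \<le> 1 / 2\<close>. The other terms are
  controlled by induction on the distance to \<open>N\<close>. The rate comes from
  \<open>(1 + 2 * b) * (1 + b * K) \<le> 1 + (2 + 2 * K) * b\<close>.\<close>

lemma discrete_gronwall:
  fixes a :: "nat \<Rightarrow> real"
  assumes K: "1 \<le> K" and b: "0 \<le> b" "b \<le> 1 / 2" and \<eta>: "0 \<le> \<eta>" and \<delta>: "0 \<le> \<delta>"
    and nonneg: "\<And>i. 0 \<le> a i"
    and init: "\<And>i. i \<le> N \<Longrightarrow> N < i + K \<Longrightarrow> a i \<le> \<eta>"
    and step: "\<And>i. i + K \<le> N \<Longrightarrow> a i \<le> a (i + K) + b * (\<Sum>j\<le>K. a (i + j)) + \<delta>"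
    and i: "i \<le> N"
  shows "a i \<le> (1 + (2 + 2 * real K) * b) ^ (N - i) * (\<eta> + 2 * \<delta> * real (N - i))"
proof -
  define q where "q = 1 + (2 + 2 * real K) * b"
  have q: "1 \<le> q" using b by (simp add: q_def)
  have "a i \<le> q ^ (N - i) * (\<eta> + 2 * \<delta> * real (N - i))" if "i \<le> N" for i
    using that
  proof (induction "N - i" arbitrary: i rule: less_induct)
    case less
    show ?case
    proof (cases "N < i + K")
      case True
      have "a i \<le> 1 * (\<eta> + 0)" using init[OF less.prems True] by simp
      also have "\<dots> \<le> q ^ (N - i) * (\<eta> + 2 * \<delta> * real (N - i))"
        using q \<eta> \<delta> by (intro mult_mono add_left_mono) auto
      finally show ?thesis .
    next
      case False
      then have iK: "i + K \<le> N" by simp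
      obtain d where d: "N - i = Suc d" using iK K by (cases "N - i") auto
      \<comment> \<open>The claimed bound at \<open>i + 1\<close>; it grows with the distance to
        \<open>N\<close>, so it dominates \<open>a l\<close> at every later index.\<close>
      define E where "E = q ^ d * (\<eta> + 2 * \<delta> * real d)"
      have E0: "0 \<le> E" using q \<eta> \<delta> by (simp add: E_def)
      have later: "a l \<le> E" if "i < l" "l \<le> N" for l
      proof -
        have "a l \<le> q ^ (N - l) * (\<eta> + 2 * \<delta> * real (N - l))" by (rule less.hyps) (use that in auto)
        also have "\<dots> \<le> E" unfolding E_def
          using that d q \<eta> \<delta> by (intro mult_mono power_increasing add_left_mono mult_left_mono) auto
        finally show ?thesis .
      qed
      have "(\<Sum>j\<le>K. a (i + j)) = a i + (\<Sum>j=1..K. a (i + j))"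
        by (simp add: sum.atMost_shift sum.atLeast1_atMost_eq)
      also have "(\<Sum>j=1..K. a (i + j)) \<le> (\<Sum>j=1..K. E)"
        by (rule sum_mono) (use later iK in auto)
      finally have s: "(\<Sum>j\<le>K. a (i + j)) \<le> a i + real K * E" by simp
      define X where "X = (1 + b * real K) * E + \<delta>"
      have "a i \<le> E + b * (a i + real K * E) + \<delta>"
        using step[OF iK] later[of "i + K"] iK K mult_left_mono[OF s b(1)] by simp
      then have X: "(1 - b) * a i \<le> X" by (simp add: X_def algebra_simps)
      \<comment> \<open>Replaces division by \<open>1 - b\<close>; it amounts to
        \<open>b * (1 - 2 * b) \<ge> 0\<close>.\<close>
      have "1 \<le> (1 - b) * (1 + 2 * b)"
        using mult_nonneg_nonneg[of b "1 - 2 * b"] b by (simp add: algebra_simps)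
      from mult_right_mono[OF this nonneg[of i]] have "a i \<le> (1 + 2 * b) * ((1 - b) * a i)"
        by (simp add: algebra_simps)
      also have "\<dots> \<le> (1 + 2 * b) * X" using X b by (intro mult_left_mono) auto
      also have "\<dots> = ((1 + 2 * b) * (1 + b * real K)) * E + (1 + 2 * b) * \<delta>"
        by (simp add: X_def algebra_simps)
      also have "\<dots> \<le> q * E + 2 * \<delta>"
      proof (intro add_mono mult_right_mono E0 \<delta>)
        have "b * (b * real K) \<le> 1 / 2 * (b * real K)" using b by (intro mult_right_mono) auto
        then show "(1 + 2 * b) * (1 + b * real K) \<le> q" by (simp add: q_def algebra_simps)
      qed (use b in auto)
      also have "2 * \<delta> \<le> q ^ Suc d * (2 * \<delta>)"
        using mult_right_mono[of 1 "q ^ Suc d" "2 * \<delta>"] one_le_power[OF q, of "Suc d"] \<delta> by simp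
      also have "q * E + q ^ Suc d * (2 * \<delta>) = q ^ (N - i) * (\<eta> + 2 * \<delta> * real (N - i))"
        unfolding d E_def by (simp add: algebra_simps)
      finally show ?thesis by simp
    qed
  qed
  then show ?thesis using i by (simp add: q_def)
qed

section \<open>The scheme as an operator: stability, consistency, convergence\<close>

lemma integral_abs_triangle:
  fixes X Y :: "'a \<Rightarrow> real"
  assumes "integrable M X" "integrable M Y"
  shows "(\<integral>\<omega>. \<bar>X \<omega> + Y \<omega>\<bar> \<partial>M) \<le> (\<integral>\<omega>. \<bar>X \<omega>\<bar> \<partial>M) + (\<integral>\<omega>. \<bar>Y \<omega>\<bar> \<partial>M)"
proof -
  have "(\<integral>\<omega>. \<bar>X \<omega> + Y \<omega>\<bar> \<partial>M) \<le> (\<integral>\<omega>. \<bar>X \<omega>\<bar> + \<bar>Y \<omega>\<bar> \<partial>M)"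
    by (rule integral_mono) (use assms in \<open>auto intro: abs_triangle_ineq\<close>)
  then show ?thesis using assms by simp
qed

context brownian_basis
begin

text \<open>The far value \<open>A\<close> is kept apart from the driver values \<open>X\<close>
  because Picard iterates enter with index \<open>n + 1\<close> in the former and \<open>n\<close>
  in the latter.\<close>

definition scheme_step :: "real \<Rightarrow> real \<Rightarrow> nat \<Rightarrow> (nat \<Rightarrow> real) \<Rightarrow> (nat \<Rightarrow> real \<Rightarrow> real) \<Rightarrow> ('a \<Rightarrow> real) \<Rightarrow> (nat \<Rightarrow> 'a \<Rightarrow> real) \<Rightarrow> 'a \<Rightarrow> real" where
  "scheme_step t c K \<gamma> \<phi> A X \<omega> = real_cond_exp M (F t) A \<omega> +
     c * (\<Sum>j\<le>K. \<gamma> j * real_cond_exp M (F t) (\<lambda>\<omega>'. \<phi> j (X j \<omega>')) \<omega>)"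

lemma integrable_scheme_step:
  assumes t: "t \<in> {0..T}" and A: "integrable M A"
    and X: "\<And>j. j \<le> K \<Longrightarrow> integrable M (X j)" and \<phi>: "\<And>j. j \<le> K \<Longrightarrow> bc (\<phi> j)"
  shows "integrable M (scheme_step t c K \<gamma> \<phi> A X)"
proof -
  interpret S: finite_measure_subalgebra M "F t" by (rule finite_measure_subalgebra_filtration[OF t])
  have comp: "integrable M (\<lambda>\<omega>. \<phi> j (X j \<omega>))" if "j \<le> K" for j
    by (rule integrable_bc_comp[OF \<phi>[OF that] X[OF that]])
  show ?thesis
    unfolding scheme_step_def[abs_def]
    by (intro Bochner_Integration.integrable_add integrable_mult_right Bochner_Integration.integrable_sum
        S.real_cond_exp_int A comp) auto
qed

text \<open>Stability in \<open>L^1\<close>: conditional expectations contract, so the far value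
  passes with factor 1, and only the driver terms are amplified, by \<open>c * L\<close> times the
  absolute weights.\<close>

lemma scheme_step_diff:
  assumes t: "t \<in> {0..T}" and c: "0 \<le> c"
    and A: "integrable M A" "integrable M A'"
    and X: "\<And>j. j \<le> K \<Longrightarrow> integrable M (X j)" "\<And>j. j \<le> K \<Longrightarrow> integrable M (X' j)"
    and \<phi>: "\<And>j. j \<le> K \<Longrightarrow> bc (\<phi> j)"
    and L: "\<And>j y y'. j \<le> K \<Longrightarrow> \<bar>\<phi> j y - \<phi> j y'\<bar> \<le> L * \<bar>y - y'\<bar>"
  shows "(\<integral>\<omega>. \<bar>scheme_step t c K \<gamma> \<phi> A X \<omega> - scheme_step t c K \<gamma> \<phi> A' X' \<omega>\<bar> \<partial>M)
      \<le> (\<integral>\<omega>. \<bar>A \<omega> - A' \<omega>\<bar> \<partial>M) + c * L * (\<Sum>j\<le>K. \<bar>\<gamma> j\<bar> * (\<integral>\<omega>. \<bar>X j \<omega> - X' j \<omega>\<bar> \<partial>M))"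
proof -
  interpret S: finite_measure_subalgebra M "F t" by (rule finite_measure_subalgebra_filtration[OF t])
  have comp: "integrable M (\<lambda>\<omega>. \<phi> j (V \<omega>))" if "j \<le> K" "integrable M V" for j V
    by (rule integrable_bc_comp[OF \<phi>[OF that(1)] that(2)])
  have iS: "integrable M (scheme_step t c K \<gamma> \<phi> A X)"
    by (rule integrable_scheme_step[OF t A(1) X(1) \<phi>]; assumption)
  have iS': "integrable M (scheme_step t c K \<gamma> \<phi> A' X')"
    by (rule integrable_scheme_step[OF t A(2) X(2) \<phi>]; assumption)
  define dA where "dA \<omega> = A \<omega> - A' \<omega>" for \<omega>
  define dX where "dX j \<omega> = \<phi> j (X j \<omega>) - \<phi> j (X' j \<omega>)" for j \<omega>
  have iA: "integrable M dA" unfolding dA_def using A by simp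
  have iX: "integrable M (dX j)" if "j \<le> K" for j
    unfolding dX_def using comp[OF that X(1)[OF that]] comp[OF that X(2)[OF that]] by simp
  have 1: "AE \<omega> in M. real_cond_exp M (F t) dA \<omega> = real_cond_exp M (F t) A \<omega> - real_cond_exp M (F t) A' \<omega>"
    unfolding dA_def by (rule S.real_cond_exp_diff[OF A])
  have 2: "AE \<omega> in M. \<forall>j\<in>{..K}. real_cond_exp M (F t) (dX j) \<omega>
      = real_cond_exp M (F t) (\<lambda>\<omega>'. \<phi> j (X j \<omega>')) \<omega> - real_cond_exp M (F t) (\<lambda>\<omega>'. \<phi> j (X' j \<omega>')) \<omega>"
    unfolding dX_def by (rule AE_finite_allI) (use comp X in \<open>auto intro!: S.real_cond_exp_diff\<close>)
  have "AE \<omega> in M. \<bar>scheme_step t c K \<gamma> \<phi> A X \<omega> - scheme_step t c K \<gamma> \<phi> A' X' \<omega>\<bar>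
      \<le> \<bar>real_cond_exp M (F t) dA \<omega>\<bar> + c * (\<Sum>j\<le>K. \<bar>\<gamma> j\<bar> * \<bar>real_cond_exp M (F t) (dX j) \<omega>\<bar>)"
    using 1 2
  proof eventually_elim
    case (elim \<omega>)
    have "scheme_step t c K \<gamma> \<phi> A X \<omega> - scheme_step t c K \<gamma> \<phi> A' X' \<omega>
        = real_cond_exp M (F t) dA \<omega> + c * (\<Sum>j\<le>K. \<gamma> j * real_cond_exp M (F t) (dX j) \<omega>)"
    proof -
      have "(\<Sum>j\<le>K. \<gamma> j * real_cond_exp M (F t) (dX j) \<omega>)
          = (\<Sum>j\<le>K. \<gamma> j * real_cond_exp M (F t) (\<lambda>\<omega>'. \<phi> j (X j \<omega>')) \<omega>) - (\<Sum>j\<le>K. \<gamma> j * real_cond_exp M (F t) (\<lambda>\<omega>'. \<phi> j (X' j \<omega>')) \<omega>)"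
        unfolding sum_subtractf[symmetric] right_diff_distrib[symmetric]
        by (rule sum.cong) (use elim(2) in auto)
      then show ?thesis unfolding scheme_step_def elim(1) by (simp add: right_diff_distrib)
    qed
    also have "\<bar>\<dots>\<bar> \<le> \<bar>real_cond_exp M (F t) dA \<omega>\<bar> + c * (\<Sum>j\<le>K. \<bar>\<gamma> j * real_cond_exp M (F t) (dX j) \<omega>\<bar>)"
      using c by (intro order_trans[OF abs_triangle_ineq] add_left_mono) (auto simp: abs_mult intro!: mult_left_mono order_trans[OF sum_abs])
    finally show ?case by (simp add: abs_mult)
  qed
  then have "(\<integral>\<omega>. \<bar>scheme_step t c K \<gamma> \<phi> A X \<omega> - scheme_step t c K \<gamma> \<phi> A' X' \<omega>\<bar> \<partial>M)
      \<le> (\<integral>\<omega>. \<bar>real_cond_exp M (F t) dA \<omega>\<bar> + c * (\<Sum>j\<le>K. \<bar>\<gamma> j\<bar> * \<bar>real_cond_exp M (F t) (dX j) \<omega>\<bar>) \<partial>M)"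
    by (intro integral_mono_AE integrable_abs Bochner_Integration.integrable_diff iS iS'
        Bochner_Integration.integrable_add integrable_mult_right Bochner_Integration.integrable_sum S.real_cond_exp_int iA iX) auto
  also have "\<dots> = (\<integral>\<omega>. \<bar>real_cond_exp M (F t) dA \<omega>\<bar> \<partial>M) + c * (\<Sum>j\<le>K. \<bar>\<gamma> j\<bar> * (\<integral>\<omega>. \<bar>real_cond_exp M (F t) (dX j) \<omega>\<bar> \<partial>M))"
  proof -
    have i: "integrable M (\<lambda>\<omega>. \<bar>real_cond_exp M (F t) (dX j) \<omega>\<bar>)" if "j \<le> K" for j
      by (intro integrable_abs S.real_cond_exp_int iX that)
    have "(\<integral>\<omega>. (\<Sum>j\<le>K. \<bar>\<gamma> j\<bar> * \<bar>real_cond_exp M (F t) (dX j) \<omega>\<bar>) \<partial>M) = (\<Sum>j\<le>K. \<bar>\<gamma> j\<bar> * (\<integral>\<omega>. \<bar>real_cond_exp M (F t) (dX j) \<omega>\<bar> \<partial>M))"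
      by (subst Bochner_Integration.integral_sum) (use i in auto)
    moreover have "integrable M (\<lambda>\<omega>. \<Sum>j\<le>K. \<bar>\<gamma> j\<bar> * \<bar>real_cond_exp M (F t) (dX j) \<omega>\<bar>)"
      by (intro Bochner_Integration.integrable_sum integrable_mult_right i) auto
    ultimately show ?thesis
      using S.real_cond_exp_int(1)[OF iA] by (subst Bochner_Integration.integral_add) auto
  qed
  also have "\<dots> \<le> (\<integral>\<omega>. \<bar>dA \<omega>\<bar> \<partial>M) + c * (\<Sum>j\<le>K. \<bar>\<gamma> j\<bar> * (L * (\<integral>\<omega>. \<bar>X j \<omega> - X' j \<omega>\<bar> \<partial>M)))"
  proof (intro add_mono mult_left_mono[OF _ c] sum_mono mult_left_mono)
    show "(\<integral>\<omega>. \<bar>real_cond_exp M (F t) dA \<omega>\<bar> \<partial>M) \<le> (\<integral>\<omega>. \<bar>dA \<omega>\<bar> \<partial>M)"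
      by (rule expectation_cond_exp_abs_le[OF t iA])
    fix j assume "j \<in> {..K}"
    then have j: "j \<le> K" by simp
    have "(\<integral>\<omega>. \<bar>real_cond_exp M (F t) (dX j) \<omega>\<bar> \<partial>M) \<le> (\<integral>\<omega>. \<bar>dX j \<omega>\<bar> \<partial>M)"
      by (rule expectation_cond_exp_abs_le[OF t iX[OF j]])
    also have "\<dots> \<le> (\<integral>\<omega>. L * \<bar>X j \<omega> - X' j \<omega>\<bar> \<partial>M)"
    proof (rule integral_mono[OF integrable_abs[OF iX[OF j]]])
      show "integrable M (\<lambda>\<omega>. L * \<bar>X j \<omega> - X' j \<omega>\<bar>)" using X[OF j] by simp
      show "\<bar>dX j \<omega>\<bar> \<le> L * \<bar>X j \<omega> - X' j \<omega>\<bar>" for \<omega> unfolding dX_def by (rule L[OF j])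
    qed
    finally show "(\<integral>\<omega>. \<bar>real_cond_exp M (F t) (dX j) \<omega>\<bar> \<partial>M) \<le> L * (\<integral>\<omega>. \<bar>X j \<omega> - X' j \<omega>\<bar> \<partial>M)" by simp
  qed simp
  finally show "(\<integral>\<omega>. \<bar>scheme_step t c K \<gamma> \<phi> A X \<omega> - scheme_step t c K \<gamma> \<phi> A' X' \<omega>\<bar> \<partial>M)
      \<le> (\<integral>\<omega>. \<bar>A \<omega> - A' \<omega>\<bar> \<partial>M) + c * L * (\<Sum>j\<le>K. \<bar>\<gamma> j\<bar> * (\<integral>\<omega>. \<bar>X j \<omega> - X' j \<omega>\<bar> \<partial>M))"
    by (simp add: dA_def sum_distrib_left mult.assoc mult.left_commute)
qed

text \<open>
  The local error is bounded for the Picard iterates, uniformly in the iterate, and the bound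
  survives the limit.
\<close>
lemma truncation_error:
  assumes T: "0 < T" and f: "strip_bc T f" and g: "bc g"
    and L: "\<And>t y y'. t \<in> {0..T} \<Longrightarrow> \<bar>f t y - f t y'\<bar> \<le> L * \<bar>y - y'\<bar>"
    and sol: "bsde_solution M F T W f g Y Z"
    and h: "0 < h" "0 \<le> t" "t + real K * h \<le> T"
    and loc: "\<And>n x. \<bar>picard T f g (Suc n) t x - heat (real K * h) (picard T f g (Suc n) (t + real K * h)) x
      - h * real K * (\<Sum>j\<le>K. \<gamma> j * heat (real j * h) (\<lambda>y. f (t + real j * h) (picard T f g n (t + real j * h) y)) x)\<bar> \<le> e"
  shows "(\<integral>\<omega>. \<bar>Y t \<omega> - scheme_step t (h * real K) K \<gamma> (\<lambda>j. f (t + real j * h)) (Y (t + real K * h)) (\<lambda>j. Y (t + real j * h)) \<omega>\<bar> \<partial>M) \<le> e"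
proof -
  let ?u = "picard T f g"
  let ?s = "\<lambda>j. t + real j * h"
  let ?\<phi> = "\<lambda>j. f (?s j)"
  let ?c = "h * real K"
  have s: "?s j \<in> {0..T}" if "j \<le> K" for j
  proof -
    have "real j * h \<le> real K * h" using that h by (intro mult_right_mono) auto
    then have "t + real j * h \<le> T" using h(3) by linarith
    then show ?thesis using h by simp
  qed
  have t: "t \<in> {0..T}" using s[of 0] by simp
  have c: "0 \<le> ?c" using h by simp
  have u: "family_bc T ?u" by (rule picard_bc[OF f g])
  have \<phi>: "bc (?\<phi> j)" if "j \<le> K" for j
    by (rule strip_bc_imp_bc[OF f s[OF that]])
  have L': "\<bar>?\<phi> j y - ?\<phi> j y'\<bar> \<le> L * \<bar>y - y'\<bar>" if "j \<le> K" for j y y' using L[OF s[OF that]] .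
  have iY: "integrable M (Y s)" if "s \<in> {0..T}" for s by (rule bsde_test(1)[OF T f g sol that])
  have iu: "integrable M (\<lambda>\<omega>. ?u n s (W s \<omega>))" if "s \<in> {0..T}" for n s
    by (rule integrable_bc_brownian[OF that family_bc_slice[OF u that]])
  let ?S = "scheme_step t ?c K \<gamma> ?\<phi>"
  let ?Y = "?S (Y (?s K)) (\<lambda>j. Y (?s j))"
  let ?U = "\<lambda>n. ?S (\<lambda>\<omega>. ?u (Suc n) (?s K) (W (?s K) \<omega>)) (\<lambda>j \<omega>. ?u n (?s j) (W (?s j) \<omega>))"
  define d where "d n s = (\<integral>\<omega>. \<bar>Y s \<omega> - ?u n s (W s \<omega>)\<bar> \<partial>M)" for n s
  obtain R \<beta> where R: "\<And>n s. s \<in> {0..T} \<Longrightarrow> d n s \<le> R * (1 / 2) ^ n * exp (\<beta> * (T - s))"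
    using picard_converges[OF T f g L sol] unfolding d_def by blast
  have d0: "(\<lambda>n. d n s) \<longlonglongrightarrow> 0" if "s \<in> {0..T}" for s
  proof (rule tendsto_sandwich[where f = "\<lambda>_. 0" and h = "\<lambda>n. R * (1 / 2) ^ n * exp (\<beta> * (T - s))"])
    show "\<forall>\<^sub>F n in sequentially. d n s \<le> R * (1 / 2) ^ n * exp (\<beta> * (T - s))" using R[OF that] by simp
    have "(\<lambda>n. (1 / 2 :: real) ^ n) \<longlonglongrightarrow> 0" by (rule LIMSEQ_power_zero) simp
    then show "(\<lambda>n. R * (1 / 2) ^ n * exp (\<beta> * (T - s))) \<longlonglongrightarrow> 0"
      by (auto intro!: tendsto_eq_intros)
  qed (auto simp: d_def)
  have bound: "(\<integral>\<omega>. \<bar>Y t \<omega> - ?Y \<omega>\<bar> \<partial>M)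
      \<le> e + d (Suc n) t + (d (Suc n) (?s K) + ?c * L * (\<Sum>j\<le>K. \<bar>\<gamma> j\<bar> * d n (?s j)))" for n
  proof -
    have iU: "integrable M (?U n)" by (rule integrable_scheme_step[OF t iu[OF s] iu[OF s] \<phi>]) auto
    have iSY: "integrable M ?Y" by (rule integrable_scheme_step[OF t iY[OF s] iY[OF s] \<phi>]) auto
    \<comment> \<open>By the Markov property the defect of the iterates is the deterministic local
      error evaluated at \<open>W t\<close>, hence at most \<open>e\<close> almost surely.\<close>
    have 1: "(\<integral>\<omega>. \<bar>?u (Suc n) t (W t \<omega>) - ?U n \<omega>\<bar> \<partial>M) \<le> e"
    proof -
      have a1: "AE \<omega> in M. real_cond_exp M (F t) (\<lambda>\<omega>. ?u (Suc n) (?s K) (W (?s K) \<omega>)) \<omega> = heat (?s K - t) (?u (Suc n) (?s K)) (W t \<omega>)"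
        by (rule cond_exp_brownian[OF _ _ _ family_bc_slice[OF u s]]) (use h in auto)
      have a2: "AE \<omega> in M. \<forall>j\<in>{..K}. real_cond_exp M (F t) (\<lambda>\<omega>. ?\<phi> j (?u n (?s j) (W (?s j) \<omega>))) \<omega>
          = heat (?s j - t) (\<lambda>y. ?\<phi> j (?u n (?s j) y)) (W t \<omega>)"
      proof (rule AE_finite_allI)
        fix j assume "j \<in> {..K}"
        then have j: "j \<le> K" by simp
        have "strip_bc T (\<lambda>t x. f t (?u n t x))" by (rule strip_bc_compose[OF f family_bc_strip[OF u]])
        from strip_bc_imp_bc[OF this s[OF j]] have "bc (\<lambda>y. ?\<phi> j (?u n (?s j) y))" .
        then show "AE \<omega> in M. real_cond_exp M (F t) (\<lambda>\<omega>. ?\<phi> j (?u n (?s j) (W (?s j) \<omega>))) \<omega>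
          = heat (?s j - t) (\<lambda>y. ?\<phi> j (?u n (?s j) y)) (W t \<omega>)"
          by (intro cond_exp_brownian) (use h s[OF j] in auto)
      qed simp
      have "AE \<omega> in M. \<bar>?u (Suc n) t (W t \<omega>) - ?U n \<omega>\<bar> \<le> e"
        using a1 a2
      proof eventually_elim
        case (elim \<omega>)
        have "(\<Sum>j\<le>K. \<gamma> j * real_cond_exp M (F t) (\<lambda>\<omega>. ?\<phi> j (?u n (?s j) (W (?s j) \<omega>))) \<omega>)
            = (\<Sum>j\<le>K. \<gamma> j * heat (real j * h) (\<lambda>y. ?\<phi> j (?u n (?s j) y)) (W t \<omega>))"
          by (rule sum.cong) (use elim(2) in auto)
        then show ?case using loc[of n "W t \<omega>"] unfolding scheme_step_def elim(1) by (simp add: diff_diff_eq)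
      qed
      then have "(\<integral>\<omega>. \<bar>?u (Suc n) t (W t \<omega>) - ?U n \<omega>\<bar> \<partial>M) \<le> (\<integral>\<omega>. e \<partial>M)"
        by (intro integral_mono_AE integrable_abs Bochner_Integration.integrable_diff iu t iU) auto
      then show ?thesis using prob_space by simp
    qed
    have d_sym: "d n s = (\<integral>\<omega>. \<bar>?u n s (W s \<omega>) - Y s \<omega>\<bar> \<partial>M)" for n s
      by (simp add: d_def abs_minus_commute)
    have 2: "(\<integral>\<omega>. \<bar>?U n \<omega> - ?Y \<omega>\<bar> \<partial>M) \<le> d (Suc n) (?s K) + ?c * L * (\<Sum>j\<le>K. \<bar>\<gamma> j\<bar> * d n (?s j))"
      unfolding d_sym
      by (rule scheme_step_diff[OF t c iu[OF s] iY[OF s] iu[OF s] iY[OF s] \<phi> L']) auto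
    have "(\<integral>\<omega>. \<bar>Y t \<omega> - ?Y \<omega>\<bar> \<partial>M)
        = (\<integral>\<omega>. \<bar>((?u (Suc n) t (W t \<omega>) - ?U n \<omega>) + (Y t \<omega> - ?u (Suc n) t (W t \<omega>))) + (?U n \<omega> - ?Y \<omega>)\<bar> \<partial>M)"
      by simp
    also have "\<dots> \<le> (\<integral>\<omega>. \<bar>(?u (Suc n) t (W t \<omega>) - ?U n \<omega>) + (Y t \<omega> - ?u (Suc n) t (W t \<omega>))\<bar> \<partial>M) + (\<integral>\<omega>. \<bar>?U n \<omega> - ?Y \<omega>\<bar> \<partial>M)"
      by (intro integral_abs_triangle Bochner_Integration.integrable_add Bochner_Integration.integrable_diff iu iY t iU iSY)
    also have "\<dots> \<le> ((\<integral>\<omega>. \<bar>?u (Suc n) t (W t \<omega>) - ?U n \<omega>\<bar> \<partial>M) + (\<integral>\<omega>. \<bar>Y t \<omega> - ?u (Suc n) t (W t \<omega>)\<bar> \<partial>M)) + (\<integral>\<omega>. \<bar>?U n \<omega> - ?Y \<omega>\<bar> \<partial>M)"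
      by (intro add_right_mono integral_abs_triangle Bochner_Integration.integrable_diff iu iY t iU iSY)
    finally show ?thesis using 1 2 unfolding d_def by linarith
  qed
  \<comment> \<open>Only finitely many nodes occur, so convergence at each fixed time is enough,
    while \<open>e\<close> does not depend on \<open>n\<close>.\<close>
  have "(\<lambda>n. e + d (Suc n) t + (d (Suc n) (?s K) + ?c * L * (\<Sum>j\<le>K. \<bar>\<gamma> j\<bar> * d n (?s j))))
      \<longlonglongrightarrow> e + 0 + (0 + ?c * L * (\<Sum>j\<le>K. \<bar>\<gamma> j\<bar> * 0))"
    by (intro tendsto_intros LIMSEQ_Suc d0 s t) auto
  then show ?thesis
    by (intro LIMSEQ_le_const[where X = "\<lambda>n. e + d (Suc n) t + (d (Suc n) (?s K) + ?c * L * (\<Sum>j\<le>K. \<bar>\<gamma> j\<bar> * d n (?s j)))"])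
      (use bound in auto)
qed

text \<open>Consistency and stability combine to a recursion for the mean errors to which the
  discrete Gronwall inequality applies with \<open>b = \<kappa> * h\<close>. Since
  \<open>N * h = T\<close>, the local errors of order \<open>p + 1\<close> accumulate to order
  \<open>p\<close>.\<close>

lemma scheme_error:
  assumes T: "0 < T" and f: "strip_bc T f" and g: "bc g"
    and L: "\<And>t y y'. t \<in> {0..T} \<Longrightarrow> \<bar>f t y - f t y'\<bar> \<le> L * \<bar>y - y'\<bar>"
    and sol: "bsde_solution M F T W f g Y Z"
    and scheme: "multistep_scheme M F T f K \<gamma> N y"
    and K: "1 \<le> K" and N: "0 < N" and h: "h = T / real N"
    and C: "0 \<le> C"
    and loc: "\<And>n t x. 0 \<le> t \<Longrightarrow> t + real K * h \<le> T \<Longrightarrow>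
      \<bar>picard T f g (Suc n) t x - heat (real K * h) (picard T f g (Suc n) (t + real K * h)) x
      - h * real K * (\<Sum>j\<le>K. \<gamma> j * heat (real j * h) (\<lambda>y. f (t + real j * h) (picard T f g n (t + real j * h) y)) x)\<bar> \<le> C * h ^ Suc p"
    and \<eta>: "0 \<le> \<eta>" "\<And>i. i \<le> N \<Longrightarrow> N < i + K \<Longrightarrow> (\<integral>\<omega>. \<bar>Y (node T N i) \<omega> - y i \<omega>\<bar> \<partial>M) \<le> \<eta> * h ^ p"
    and \<kappa>: "\<kappa> = real K * L * (\<Sum>j\<le>K. \<bar>\<gamma> j\<bar>)" "\<kappa> * h \<le> 1 / 2"
    and i: "i \<le> N"
  shows "(\<integral>\<omega>. \<bar>Y (node T N i) \<omega> - y i \<omega>\<bar> \<partial>M) \<le> exp ((2 + 2 * real K) * \<kappa> * T) * (\<eta> + 2 * C * T) * h ^ p"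
proof -
  have h0: "0 < h" using T N h by simp
  have hN: "real N * h = T" using N h by simp
  have node: "node T N i = real i * h" for i by (simp add: node_def h)
  have nT: "node T N i \<in> {0..T}" if "i \<le> N" for i
  proof -
    have "real i * h \<le> real N * h" using that h0 by (intro mult_right_mono) auto
    then show ?thesis using h0 hN by (simp add: node)
  qed
  have L0: "0 \<le> L" using L[of 0 1 0] T by simp
  define G where "G = (\<Sum>j\<le>K. \<bar>\<gamma> j\<bar>)"
  have G0: "0 \<le> G" unfolding G_def by (rule sum_nonneg) auto
  have \<kappa>0: "0 \<le> \<kappa>" using \<kappa>(1) L0 G0 by (simp add: G_def)
  have yi: "integrable M (y i)" if "i \<le> N" for i
  proof -
    have y: "y i \<in> borel_measurable (F (node T N i))" "integrable M (\<lambda>\<omega>. (y i \<omega>)\<^sup>2)"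
      using scheme that unfolding multistep_scheme_def by auto
    have m: "y i \<in> borel_measurable M" using filtration_borel_M[OF nT[OF that] y(1)] .
    have sq: "integrable M (\<lambda>\<omega>. 1 + (y i \<omega>)\<^sup>2)" using y(2) by simp
    \<comment> \<open>The scheme supplies second moments; this gives the first moments that the
      error is measured in.\<close>
    have le: "\<bar>r\<bar> \<le> 1 + r\<^sup>2" for r :: real
    proof -
      have "0 \<le> (\<bar>r\<bar> - 1)\<^sup>2 + \<bar>r\<bar>" by simp
      then show ?thesis by (simp add: power2_diff)
    qed
    show "integrable M (y i)"
      by (rule Bochner_Integration.integrable_bound[OF sq m]) (auto intro!: le)
  qed
  have iY: "integrable M (Y (node T N i))" if "i \<le> N" for i by (rule bsde_test(1)[OF T f g sol nT[OF that]])
  define a where "a i = (\<integral>\<omega>. \<bar>Y (node T N i) \<omega> - y i \<omega>\<bar> \<partial>M)" for i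
  have a0: "0 \<le> a i" for i by (simp add: a_def)
  have step: "a i \<le> a (i + K) + \<kappa> * h * (\<Sum>j\<le>K. a (i + j)) + C * h ^ Suc p" if iK: "i + K \<le> N" for i
  proof -
    let ?t = "node T N i"
    have nj: "?t + real j * h = node T N (i + j)" for j by (simp add: node algebra_simps)
    have tK: "?t + real K * h \<le> T" using nT[OF iK] nj[of K] by simp
    have t: "?t \<in> {0..T}" using nT iK by simp
    let ?\<phi> = "\<lambda>j. f (node T N (i + j))"
    let ?S = "scheme_step ?t (h * real K) K \<gamma> ?\<phi>"
    let ?Y = "?S (Y (node T N (i + K))) (\<lambda>j. Y (node T N (i + j)))"
    let ?y = "?S (y (i + K)) (\<lambda>j. y (i + j))"
    have tr: "(\<integral>\<omega>. \<bar>Y ?t \<omega> - ?Y \<omega>\<bar> \<partial>M) \<le> C * h ^ Suc p"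
      using truncation_error[OF T f g L sol h0 _ tK, of \<gamma> "C * h ^ Suc p"] loc[OF _ tK] t unfolding nj by auto
    have ijN: "i + j \<le> N" if "j \<le> K" for j using that iK by simp
    have \<phi>: "bc (?\<phi> j)" if "j \<le> K" for j
      by (rule strip_bc_imp_bc[OF f nT[OF ijN[OF that]]])
    have L': "\<bar>?\<phi> j v - ?\<phi> j v'\<bar> \<le> L * \<bar>v - v'\<bar>" if "j \<le> K" for j v v' using L[OF nT[OF ijN[OF that]]] .
    have c: "0 \<le> h * real K" using h0 by simp
    have iSY: "integrable M ?Y" by (rule integrable_scheme_step[OF t iY[OF iK] iY[OF ijN] \<phi>])
    have iSy: "integrable M ?y" by (rule integrable_scheme_step[OF t yi[OF iK] yi[OF ijN] \<phi>])
    have st: "(\<integral>\<omega>. \<bar>?Y \<omega> - ?y \<omega>\<bar> \<partial>M) \<le> a (i + K) + h * real K * L * (\<Sum>j\<le>K. \<bar>\<gamma> j\<bar> * a (i + j))"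
      unfolding a_def
      by (rule scheme_step_diff[OF t c iY[OF iK] yi[OF iK] iY[OF ijN] yi[OF ijN] \<phi> L']; assumption)
    have eq: "AE \<omega> in M. y i \<omega> = ?y \<omega>"
      using scheme iK unfolding multistep_scheme_def scheme_step_def h by blast
    have iN: "i \<le> N" using iK by simp
    have "a i = (\<integral>\<omega>. \<bar>(Y ?t \<omega> - ?Y \<omega>) + (?Y \<omega> - ?y \<omega>)\<bar> \<partial>M)"
      unfolding a_def
    proof (rule integral_cong_AE)
      show "AE \<omega> in M. \<bar>Y ?t \<omega> - y i \<omega>\<bar> = \<bar>(Y ?t \<omega> - ?Y \<omega>) + (?Y \<omega> - ?y \<omega>)\<bar>"
        using eq by eventually_elim simp
    qed (use iY[OF iN] yi[OF iN] iSY iSy in auto)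
    also have "\<dots> \<le> (\<integral>\<omega>. \<bar>Y ?t \<omega> - ?Y \<omega>\<bar> \<partial>M) + (\<integral>\<omega>. \<bar>?Y \<omega> - ?y \<omega>\<bar> \<partial>M)"
      by (intro integral_abs_triangle Bochner_Integration.integrable_diff iY iN iSY iSy)
    \<comment> \<open>Each weight is replaced by the sum of all absolute weights, to reach the
      unweighted sum in the Gronwall inequality.\<close>
    also have "h * real K * L * (\<Sum>j\<le>K. \<bar>\<gamma> j\<bar> * a (i + j)) \<le> h * real K * L * (\<Sum>j\<le>K. G * a (i + j))"
    proof (intro mult_left_mono sum_mono mult_right_mono a0)
      fix j assume j: "j \<in> {..K}"
      show "\<bar>\<gamma> j\<bar> \<le> G" unfolding G_def by (rule member_le_sum[OF j]) auto
    qed (use h0 L0 in auto)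
    then have "a (i + K) + h * real K * L * (\<Sum>j\<le>K. \<bar>\<gamma> j\<bar> * a (i + j)) \<le> a (i + K) + \<kappa> * h * (\<Sum>j\<le>K. a (i + j))"
      by (simp add: \<kappa>(1) G_def[symmetric] sum_distrib_left[symmetric] algebra_simps)
    ultimately show ?thesis using tr st by linarith
  qed
  have b: "0 \<le> \<kappa> * h" using \<kappa>0 h0 by simp
  have Ch: "0 \<le> C * h ^ Suc p" using C h0 by simp
  have \<eta>h: "0 \<le> \<eta> * h ^ p" using \<eta>(1) h0 by simp
  have "a i \<le> (1 + (2 + 2 * real K) * (\<kappa> * h)) ^ (N - i) * (\<eta> * h ^ p + 2 * (C * h ^ Suc p) * real (N - i))"
    by (rule discrete_gronwall[where K = K]) (use K b \<kappa>(2) \<eta>h Ch a0 step i \<eta>(2) in \<open>auto simp: a_def\<close>)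
  \<comment> \<open>With \<open>1 + x \<le> exp x\<close> the growth over at most \<open>N\<close>
    steps depends on \<open>N * h = T\<close> only, and the same identity turns \<open>N\<close>
    local errors into one factor \<open>T\<close>.\<close>
  also have "\<dots> \<le> exp ((2 + 2 * real K) * \<kappa> * T) * ((\<eta> + 2 * C * T) * h ^ p)"
  proof (rule mult_mono)
    let ?x = "(2 + 2 * real K) * (\<kappa> * h)"
    have x0: "0 \<le> ?x" using b by simp
    have "(1 + ?x) ^ (N - i) \<le> (1 + ?x) ^ N" using x0 by (intro power_increasing) auto
    also have "\<dots> \<le> exp ?x ^ N" using x0 by (intro power_mono exp_ge_add_one_self) auto
    also have "\<dots> = exp (real N * ?x)" by (simp add: exp_of_nat_mult)
    also have "real N * ?x = (2 + 2 * real K) * \<kappa> * (real N * h)" by (simp add: algebra_simps)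
    also have "\<dots> = (2 + 2 * real K) * \<kappa> * T" by (simp only: hN)
    finally show "(1 + ?x) ^ (N - i) \<le> exp ((2 + 2 * real K) * \<kappa> * T)" .
    have "2 * (C * h ^ Suc p) * real (N - i) \<le> 2 * (C * h ^ Suc p) * real N"
      using Ch by (intro mult_left_mono) auto
    also have "\<dots> = 2 * C * (real N * h) * h ^ p" by (simp add: algebra_simps)
    finally show "\<eta> * h ^ p + 2 * (C * h ^ Suc p) * real (N - i) \<le> (\<eta> + 2 * C * T) * h ^ p"
      unfolding hN by (simp add: algebra_simps)
    show "0 \<le> \<eta> * h ^ p + 2 * (C * h ^ Suc p) * real (N - i)" using \<eta>h Ch by simp
  qed simp
  finally show ?thesis by (simp add: a_def mult.assoc)
qed

end

theorem theorem4p2: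
  "\<exists>m::nat. \<forall>(K::nat) (\<gamma>::nat \<Rightarrow> real) (T::real) (f::real \<Rightarrow> real \<Rightarrow> real) (g::real \<Rightarrow> real).
     1 \<le> K \<longrightarrow> interpolation_weights K \<gamma> \<longrightarrow> 0 < T \<longrightarrow> Cb_strip m T f \<longrightarrow> Cb m g \<longrightarrow>
     (\<forall>c::real. \<exists>C>0.
        \<forall>(M::'a measure) (F::real \<Rightarrow> 'a measure) (W::real \<Rightarrow> 'a \<Rightarrow> real)
          (Y::real \<Rightarrow> 'a \<Rightarrow> real) (Z::real \<Rightarrow> 'a \<Rightarrow> real) (Yh::nat \<Rightarrow> nat \<Rightarrow> 'a \<Rightarrow> real).
          brownian_basis M F T W \<longrightarrow>
          bsde_solution M F T W f g Y Z \<longrightarrow>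
          (\<forall>\<^sub>F N in sequentially. multistep_scheme M F T f K \<gamma> N (Yh N)) \<longrightarrow>
          (\<forall>\<^sub>F N in sequentially.
             (MAX i\<in>{i. N < i + K \<and> i \<le> N}. LINT \<omega>|M. \<bar>Y (node T N i) \<omega> - Yh N i \<omega>\<bar>)
               \<le> c * (T / real N) ^ (if K \<le> 3 then K + 1 else 4)) \<longrightarrow>
          (\<forall>\<^sub>F N in sequentially.
             (SUP i\<in>{0..N}. LINT \<omega>|M. \<bar>Y (node T N i) \<omega> - Yh N i \<omega>\<bar>)
               \<le> C * (T / real N) ^ min (K + 1) 4))"
proof (intro exI[of _ "8::nat"] allI impI)
  fix K :: nat and \<gamma> :: "nat \<Rightarrow> real" and T :: real and f :: "real \<Rightarrow> real \<Rightarrow> real" and g :: "real \<Rightarrow> real" and c :: real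
  assume K: "1 \<le> K" and w: "interpolation_weights K \<gamma>" and T: "0 < T" and f8: "Cb_strip 8 T f" and g8: "Cb 8 g"
  obtain D where D: "smooth_strip 8 T D" "D 0 0 = f" using Cb_strip_imp_smooth_strip[OF f8] by blast
  have g: "Cb_order 8 g" using Cb_imp_Cb_order[OF g8, of 0 8] by simp
  have gb: "bc g" using Cb_order_bc[OF g] .
  have f: "strip_bc T f" using D unfolding smooth_strip_def by force
  have D1: "has_dx T f (D 0 1)" "strip_bc T (D 0 1)"
    using D(1) unfolding smooth_strip_def D(2)[symmetric] by auto
  obtain L where L1: "\<And>t x. t \<in> {0..T} \<Longrightarrow> \<bar>D 0 1 t x\<bar> \<le> L" using strip_bc_bound[OF D1(2)] by blast
  have L: "\<bar>f t v - f t v'\<bar> \<le> L * \<bar>v - v'\<bar>" if t: "t \<in> {0..T}" for t v v'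
  proof -
    have "norm (f t v - f t v') \<le> L * norm (v - v')"
      by (rule field_differentiable_bound[of UNIV "f t" "D 0 1 t"]) (use D1(1) L1 t in \<open>auto simp: has_dx_def\<close>)
    then show ?thesis by simp
  qed
  define p where "p = min K 3 + 1"
  have p1: "min (K + 1) 4 = p" "(if K \<le> 3 then K + 1 else 4) = p" by (auto simp: p_def)
  obtain C0 where C0: "0 \<le> C0" "\<And>n t x h. 0 < h \<Longrightarrow> 0 \<le> t \<Longrightarrow> t + real K * h \<le> T \<Longrightarrow>
    \<bar>picard T f g (Suc n) t x - heat (real K * h) (picard T f g (Suc n) (t + real K * h)) x
      - h * real K * (\<Sum>j\<le>K. \<gamma> j * heat (real j * h) (\<lambda>y. f (t + real j * h) (picard T f g n (t + real j * h) y)) x)\<bar>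
    \<le> C0 * h ^ Suc p"
    using picard_local_error[OF D(1) g w] unfolding D(2) p_def by (auto simp del: picard.simps)
  define \<kappa> where "\<kappa> = real K * L * (\<Sum>j\<le>K. \<bar>\<gamma> j\<bar>)"
  \<comment> \<open>The sign of \<open>c\<close> is free, hence the absolute value; adding 1 makes
    \<open>C\<close> positive. All ingredients come from the data, so \<open>C\<close> is fixed
    before the probability space and the solution.\<close>
  define C where "C = exp ((2 + 2 * real K) * \<kappa> * T) * (\<bar>c\<bar> + 2 * C0 * T) + 1"
  have C: "0 < C"
  proof -
    have "0 \<le> exp ((2 + 2 * real K) * \<kappa> * T) * (\<bar>c\<bar> + 2 * C0 * T)" using C0(1) T by simp
    then show ?thesis unfolding C_def by linarith
  qed
  have "(\<forall>\<^sub>F N in sequentially. (SUP i\<in>{0..N}. LINT \<omega>|M. \<bar>Y (node T N i) \<omega> - Yh N i \<omega>\<bar>) \<le> C * (T / real N) ^ p)"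
    if B: "brownian_basis M F T W" and sol: "bsde_solution M F T W f g Y Z"
      and sch: "\<forall>\<^sub>F N in sequentially. multistep_scheme M F T f K \<gamma> N (Yh N)"
      and init: "\<forall>\<^sub>F N in sequentially.
             (MAX i\<in>{i. N < i + K \<and> i \<le> N}. LINT \<omega>|M. \<bar>Y (node T N i) \<omega> - Yh N i \<omega>\<bar>) \<le> c * (T / real N) ^ p"
    for M :: "'a measure" and F W Y Z Yh
  proof -
    interpret brownian_basis M F T W by (rule B)
    \<comment> \<open>This is where a small step is needed: \<open>\<kappa> * h \<le> 1 / 2\<close>
      lets the implicit term be absorbed.\<close>
    have "(\<lambda>N. \<kappa> * (T / real N)) \<longlonglongrightarrow> \<kappa> * 0"
      by (intro tendsto_intros lim_const_over_n)
    then have small: "\<forall>\<^sub>F N in sequentially. \<kappa> * (T / real N) < 1 / 2"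
      by (intro order_tendstoD(2)) auto
    show ?thesis
      using sch init small eventually_gt_at_top[of 0]
    proof eventually_elim
      case (elim N)
      show ?case
      proof (rule cSUP_least)
        fix i assume i: "i \<in> {0..N}"
        have hp: "0 \<le> (T / real N) ^ p" using T by simp
        have \<eta>: "(\<integral>\<omega>. \<bar>Y (node T N i) \<omega> - Yh N i \<omega>\<bar> \<partial>M) \<le> \<bar>c\<bar> * (T / real N) ^ p" if "i \<le> N" "N < i + K" for i
        proof -
          have "(\<integral>\<omega>. \<bar>Y (node T N i) \<omega> - Yh N i \<omega>\<bar> \<partial>M)
              \<le> (MAX i\<in>{i. N < i + K \<and> i \<le> N}. LINT \<omega>|M. \<bar>Y (node T N i) \<omega> - Yh N i \<omega>\<bar>)"
            by (rule Max_ge) (use that in auto)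
          also have "\<dots> \<le> c * (T / real N) ^ p" by (rule elim(2))
          also have "\<dots> \<le> \<bar>c\<bar> * (T / real N) ^ p" using hp by (intro mult_right_mono) auto
          finally show ?thesis .
        qed
        have "(\<integral>\<omega>. \<bar>Y (node T N i) \<omega> - Yh N i \<omega>\<bar> \<partial>M)
            \<le> exp ((2 + 2 * real K) * \<kappa> * T) * (\<bar>c\<bar> + 2 * C0 * T) * (T / real N) ^ p"
        proof (rule scheme_error[OF T f gb L sol elim(1) K elim(4) refl C0(1) _ _ \<eta> \<kappa>_def])
          show "\<kappa> * (T / real N) \<le> 1 / 2" using elim(3) by simp
        qed (use C0(2)[of "T / real N"] T elim(4) i in \<open>auto simp del: picard.simps\<close>)
        also have "\<dots> \<le> C * (T / real N) ^ p" unfolding C_def using hp by (intro mult_right_mono) auto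
        finally show "(\<integral>\<omega>. \<bar>Y (node T N i) \<omega> - Yh N i \<omega>\<bar> \<partial>M) \<le> C * (T / real N) ^ p" .
      qed simp
    qed
  qed
  then show "\<exists>C>0. \<forall>(M::'a measure) (F::real \<Rightarrow> 'a measure) (W::real \<Rightarrow> 'a \<Rightarrow> real)
          (Y::real \<Rightarrow> 'a \<Rightarrow> real) (Z::real \<Rightarrow> 'a \<Rightarrow> real) (Yh::nat \<Rightarrow> nat \<Rightarrow> 'a \<Rightarrow> real).
          brownian_basis M F T W \<longrightarrow>
          bsde_solution M F T W f g Y Z \<longrightarrow>
          (\<forall>\<^sub>F N in sequentially. multistep_scheme M F T f K \<gamma> N (Yh N)) \<longrightarrow>
          (\<forall>\<^sub>F N in sequentially.
             (MAX i\<in>{i. N < i + K \<and> i \<le> N}. LINT \<omega>|M. \<bar>Y (node T N i) \<omega> - Yh N i \<omega>\<bar>)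
               \<le> c * (T / real N) ^ (if K \<le> 3 then K + 1 else 4)) \<longrightarrow>
          (\<forall>\<^sub>F N in sequentially.
             (SUP i\<in>{0..N}. LINT \<omega>|M. \<bar>Y (node T N i) \<omega> - Yh N i \<omega>\<bar>)
               \<le> C * (T / real N) ^ min (K + 1) 4)"
    unfolding p1 using C by (intro exI[of _ C] conjI allI impI) blast+
qed

end
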